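(* Let $H$ be a finite dimensional Hopf algebra over $\mathbb{C}$ and let $V$ be a simple vertex operator algebra which is an $H$-module VOA. If $H$ acts faithfully on $V$, then the action is a group action, i.e. $H$ is a group algebra: $H\cong\mathbb{C}[G]$ as Hopf algebras for some finite group $G$.
   Context: Everything is over $\mathbb{C}$. A Hopf algebra $H$ has comultiplication $\Delta(h)=\sum h_1\otimes h_2$ (Sweedler notation), counit $\epsilon$ and antipode $S$. The group algebra $\mathbb{C}[G]$ carries the Hopf structure $\Delta(g)=g\otimes g$, $\epsilon(g)=1$, $S(g)=g^{-1}$ for $g\in G$. A vertex operator algebra (VOA) is $(V,Y,\mathbf 1,\omega)$ with $V=\bigoplus_{n\in\mathbb{Z}}V_n$, $\dim V_n<\infty$, $V_n=0$ for $n\ll 0$, $\mathbf 1\in V_0$, $\omega\in V_2$, and a linear map $u\mapsto Y(u,z)=\sum_{n\in\mathbb{Z}}u_nz^{-n-1}\in \mathrm{End}(V)[[z,z^{-1}]]$ such that: $u_nv=0$ for $n\gg0$; $Y(\mathbf 1,z)v=v$ and $\lim_{z\to0}Y(v,z)\mathbf 1=v$; writing $Y(\omega,z)=\sum_n L(n)z^{-n-2}$, one has $V_n=\{v\mid L(0)v=nv\}$, $Y(L(-1)v,z)=\frac{d}{dz}Y(v,z)$ and $[L(n),L(m)]=(n-m)L(n+m)+\delta_{n+m,0}\frac{n^3-n}{12}c$ for some $c\in\mathbb{C}$; and the Jacobi identity holds: $$z_0^{-1}\delta\!\left(\tfrac{z_1-z_2}{z_0}\right)Y(u,z_1)Y(v,z_2)-z_0^{-1}\delta\!\left(\tfrac{-z_2+z_1}{z_0}\right)Y(v,z_2)Y(u,z_1)=z_1^{-1}\delta\!\left(\tfrac{z_2+z_0}{z_1}\right)Y(Y(u,z_0)v,z_2),$$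 where $\delta(z)=\sum_{n\in\mathbb{Z}}z^n$ and $(z_1+z_2)^n=\sum_{i\ge0}\binom{n}{i}z_1^iz_2^{n-i}$. $V$ is simple if it is nonzero and has no nontrivial ideals. $V$ is an $H$-module VOA if: (i) $V$ is an $H$-module; (ii) $h\omega=\epsilon(h)\omega$ for all $h\in H$; (iii) $hY(u,z)v=\sum Y(h_1u,z)h_2v$ for all $h\in H$, $u,v\in V$. The action is faithful if no nonzero $h\in H$ satisfies $hV=0$.
   Formalization: In the Jacobi identity, powers (z_1+z_2)^n are expanded in nonnegative powers of the second summand (the standard convention), since expanding in the first summand as printed makes the products undefined infinite sums. *)

theory Defs
  imports Complex_Main "HOL-Library.Poly_Mapping" "HOL-Algebra.Group"
begin

section \<open>Complex vector spaces\<close>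

class scaleC =
  fixes scaleC :: "complex \<Rightarrow> 'a \<Rightarrow> 'a" (infixr \<open>*\<^sub>C\<close> 75)

class complex_vector = scaleC + ab_group_add +
  assumes scaleC_add_right: "a *\<^sub>C (x + y) = a *\<^sub>C x + a *\<^sub>C y"
    and scaleC_add_left: "(a + b) *\<^sub>C x = a *\<^sub>C x + b *\<^sub>C x"
    and scaleC_scaleC: "a *\<^sub>C b *\<^sub>C x = (a * b) *\<^sub>C x"
    and scaleC_one: "1 *\<^sub>C x = x"

global_interpretation complex_vector: vector_space "scaleC :: complex \<Rightarrow> 'a \<Rightarrow> 'a::complex_vector"
  by unfold_locales (rule scaleC_add_right scaleC_add_left scaleC_scaleC scaleC_one)+

global_interpretation complex_vector:
  vector_space_pair "scaleC :: complex \<Rightarrow> 'a \<Rightarrow> 'a::complex_vector"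
    "scaleC :: complex \<Rightarrow> 'b \<Rightarrow> 'b::complex_vector"
  by unfold_locales

lemma scaleC_linearI:
  assumes "\<And>x y. f (x + y) = f x + f y" and "\<And>c x. f (c *\<^sub>C x) = c *\<^sub>C f x"
  shows "Vector_Spaces.linear (scaleC :: complex \<Rightarrow> 'a \<Rightarrow> 'a::complex_vector)
    (scaleC :: complex \<Rightarrow> 'b \<Rightarrow> 'b::complex_vector) f"
  by (simp add: Vector_Spaces.linear_iff assms complex_vector.vector_space_axioms)

instantiation complex :: complex_vector
begin

definition scaleC_complex :: "complex \<Rightarrow> complex \<Rightarrow> complex" where
  [simp]: "scaleC_complex c x = c * x"

instance by standard (simp_all add: algebra_simps)

end

instantiation poly_mapping :: (type, complex_vector) complex_vector
begin

lift_definition scaleC_poly_mapping :: "complex \<Rightarrow> ('a \<Rightarrow>\<^sub>0 'b) \<Rightarrow> ('a \<Rightarrow>\<^sub>0 'b)"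
  is "\<lambda>c f k. c *\<^sub>C f k"
  by (rule rev_finite_subset) auto

instance
  by standard
    (transfer, simp add: fun_eq_iff scaleC_add_right scaleC_add_left scaleC_scaleC scaleC_one)+

end

lemma lookup_scaleC [simp]: "Poly_Mapping.lookup (c *\<^sub>C p) k = c *\<^sub>C Poly_Mapping.lookup p k"
  by transfer simp

definition finite_dim :: "'a::complex_vector set \<Rightarrow> bool" where
  "finite_dim A \<longleftrightarrow> (\<exists>B. finite B \<and> complex_vector.span B = A)"

definition linear_on :: "'a::complex_vector set \<Rightarrow> ('a \<Rightarrow> 'b::complex_vector) \<Rightarrow> bool" where
  "linear_on A f \<longleftrightarrow>
     (\<forall>x\<in>A. \<forall>y\<in>A. f (x + y) = f x + f y) \<and> (\<forall>c. \<forall>x\<in>A. f (c *\<^sub>C x) = c *\<^sub>C f x)"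

definition bilinear_on ::
  "'a::complex_vector set \<Rightarrow> 'b::complex_vector set \<Rightarrow> ('a \<Rightarrow> 'b \<Rightarrow> 'c::complex_vector) \<Rightarrow> bool" where
  "bilinear_on A B f \<longleftrightarrow> (\<forall>a\<in>A. linear_on B (f a)) \<and> (\<forall>b\<in>B. linear_on A (\<lambda>a. f a b))"


section \<open>Tensor products\<close>

text \<open>The tensor product is the free vector space on pairs modulo the bilinearity relations.\<close>

definition tensor_null :: "(('a::complex_vector \<times> 'b::complex_vector) \<Rightarrow>\<^sub>0 complex) set" where
  "tensor_null = complex_vector.span
     ({Poly_Mapping.single (a + a', b) 1 - Poly_Mapping.single (a, b) 1 - Poly_Mapping.single (a', b) 1 | a a' b. True} \<union>
      {Poly_Mapping.single (a, b + b') 1 - Poly_Mapping.single (a, b) 1 - Poly_Mapping.single (a, b') 1 | a b b'. True} \<union>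
      {Poly_Mapping.single (c *\<^sub>C a, b) 1 - c *\<^sub>C Poly_Mapping.single (a, b) 1 | a b c. True} \<union>
      {Poly_Mapping.single (a, c *\<^sub>C b) 1 - c *\<^sub>C Poly_Mapping.single (a, b) 1 | a b c. True})"

lemma subspace_tensor_null: "complex_vector.subspace tensor_null"
  unfolding tensor_null_def by (rule complex_vector.subspace_span)

quotient_type (overloaded) ('a, 'b) tensor =
  "('a::complex_vector \<times> 'b::complex_vector) \<Rightarrow>\<^sub>0 complex" / "\<lambda>p q. p - q \<in> tensor_null"
  morphisms rep_tensor abs_tensor
proof (rule equivpI)
  note S = subspace_tensor_null
  show "reflp (\<lambda>p q. p - q \<in> (tensor_null :: ('a \<times> 'b \<Rightarrow>\<^sub>0 complex) set))"
    using complex_vector.subspace_0[OF S] by (simp add: reflp_def)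
  show "symp (\<lambda>p q. p - q \<in> (tensor_null :: ('a \<times> 'b \<Rightarrow>\<^sub>0 complex) set))"
  proof (rule sympI)
    fix p q :: "'a \<times> 'b \<Rightarrow>\<^sub>0 complex"
    assume "p - q \<in> tensor_null"
    from complex_vector.subspace_neg[OF S this] show "q - p \<in> tensor_null" by simp
  qed
  show "transp (\<lambda>p q. p - q \<in> (tensor_null :: ('a \<times> 'b \<Rightarrow>\<^sub>0 complex) set))"
  proof (rule transpI)
    fix p q r :: "'a \<times> 'b \<Rightarrow>\<^sub>0 complex"
    assume "p - q \<in> tensor_null" "q - r \<in> tensor_null"
    from complex_vector.subspace_add[OF S this] show "p - r \<in> tensor_null" by simp
  qed
qed

instantiation tensor :: (complex_vector, complex_vector) complex_vector
begin

lift_definition zero_tensor :: "('a, 'b) tensor" is 0 .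

lift_definition plus_tensor :: "('a, 'b) tensor \<Rightarrow> ('a, 'b) tensor \<Rightarrow> ('a, 'b) tensor" is "(+)"
proof -
  fix p p' q q' :: "'a \<times> 'b \<Rightarrow>\<^sub>0 complex"
  assume "p - p' \<in> tensor_null" "q - q' \<in> tensor_null"
  from complex_vector.subspace_add[OF subspace_tensor_null this]
  show "p + q - (p' + q') \<in> tensor_null" by (simp add: algebra_simps)
qed

lift_definition minus_tensor :: "('a, 'b) tensor \<Rightarrow> ('a, 'b) tensor \<Rightarrow> ('a, 'b) tensor" is "(-)"
proof -
  fix p p' q q' :: "'a \<times> 'b \<Rightarrow>\<^sub>0 complex"
  assume "p - p' \<in> tensor_null" "q - q' \<in> tensor_null"
  from complex_vector.subspace_diff[OF subspace_tensor_null this]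
  show "p - q - (p' - q') \<in> tensor_null" by (simp add: algebra_simps)
qed

lift_definition uminus_tensor :: "('a, 'b) tensor \<Rightarrow> ('a, 'b) tensor" is uminus
proof -
  fix p p' :: "'a \<times> 'b \<Rightarrow>\<^sub>0 complex"
  assume "p - p' \<in> tensor_null"
  from complex_vector.subspace_neg[OF subspace_tensor_null this]
  show "- p - - p' \<in> tensor_null" by simp
qed

lift_definition scaleC_tensor :: "complex \<Rightarrow> ('a, 'b) tensor \<Rightarrow> ('a, 'b) tensor" is scaleC
proof -
  fix c and p p' :: "'a \<times> 'b \<Rightarrow>\<^sub>0 complex"
  assume "p - p' \<in> tensor_null"
  from complex_vector.subspace_scale[OF subspace_tensor_null this, of c]
  show "c *\<^sub>C p - c *\<^sub>C p' \<in> tensor_null"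
    by (simp add: complex_vector.scale_right_diff_distrib)
qed

instance
  by standard
    (transfer, simp add: algebra_simps scaleC_add_right scaleC_add_left scaleC_scaleC scaleC_one
       complex_vector.subspace_0[OF subspace_tensor_null])+

end

lift_definition pure_tensor :: "'a::complex_vector \<Rightarrow> 'b::complex_vector \<Rightarrow> ('a, 'b) tensor"
    (infixl \<open>\<otimes>\<^sub>t\<close> 70)
  is "\<lambda>a b. Poly_Mapping.single (a, b) 1" .

text \<open>The tensor product of two subspaces, as a subspace of the ambient tensor product (over a field
  the canonical map between the two is injective).\<close>

definition tensor_space ::
  "'a::complex_vector set \<Rightarrow> 'b::complex_vector set \<Rightarrow> ('a, 'b) tensor set" where
  "tensor_space A B = complex_vector.span {a \<otimes>\<^sub>t b | a b. a \<in> A \<and> b \<in> B}"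

text \<open>For \<open>f\<close> bilinear on \<open>A \<times> B\<close>, \<open>tensor_lift A B f\<close> is the induced linear map on
  \<open>tensor_space A B\<close>; see \<open>tensor_lift_pure\<close> and \<open>linear_on_tensor_lift\<close> below. In Sweedler
  notation, \<open>tensor_lift A A f (\<Delta> h)\<close> is \<open>\<Sum> f h\<^sub>1 h\<^sub>2\<close>.\<close>

definition tensor_lift ::
  "'a::complex_vector set \<Rightarrow> 'b::complex_vector set \<Rightarrow> ('a \<Rightarrow> 'b \<Rightarrow> 'c::complex_vector) \<Rightarrow>
   ('a, 'b) tensor \<Rightarrow> 'c" where
  "tensor_lift A B f t =
     (let p = (SOME p. Poly_Mapping.keys p \<subseteq> A \<times> B \<and> abs_tensor p = t)
      in \<Sum>(a, b)\<in>Poly_Mapping.keys p. Poly_Mapping.lookup p (a, b) *\<^sub>C f a b)"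

lemma abs_tensor_add: "abs_tensor (p + q) = abs_tensor p + abs_tensor q"
  by (simp add: plus_tensor.abs_eq)

lemma abs_tensor_scaleC: "abs_tensor (c *\<^sub>C p) = c *\<^sub>C abs_tensor p"
  by (simp add: scaleC_tensor.abs_eq)

lemma keys_scaleC_subset: "Poly_Mapping.keys (c *\<^sub>C p) \<subseteq> Poly_Mapping.keys p"
  for p :: "'a \<Rightarrow>\<^sub>0 complex"
  by (auto simp: in_keys_iff)

lemma eval_superset:
  fixes p :: "'k \<Rightarrow>\<^sub>0 complex" and g :: "'k \<Rightarrow> 'c::complex_vector"
  assumes "finite K" "Poly_Mapping.keys p \<subseteq> K"
  shows "(\<Sum>k\<in>Poly_Mapping.keys p. Poly_Mapping.lookup p k *\<^sub>C g k) =
         (\<Sum>k\<in>K. Poly_Mapping.lookup p k *\<^sub>C g k)"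
  by (rule sum.mono_neutral_left) (use assms in \<open>auto simp: in_keys_iff\<close>)

lemma linear_eval:
  fixes g :: "'k \<Rightarrow> 'c::complex_vector"
  defines "ev \<equiv> \<lambda>p :: 'k \<Rightarrow>\<^sub>0 complex. \<Sum>k\<in>Poly_Mapping.keys p. Poly_Mapping.lookup p k *\<^sub>C g k"
  shows "Vector_Spaces.linear scaleC scaleC ev"
proof (rule scaleC_linearI)
  fix p q :: "'k \<Rightarrow>\<^sub>0 complex" and c :: complex
  let ?K = "Poly_Mapping.keys p \<union> Poly_Mapping.keys q"
  have K: "finite ?K" by simp
  have "ev (p + q) = (\<Sum>k\<in>?K. Poly_Mapping.lookup (p + q) k *\<^sub>C g k)"
    unfolding ev_def by (rule eval_superset[OF K keys_add])
  also have "\<dots> = (\<Sum>k\<in>?K. Poly_Mapping.lookup p k *\<^sub>C g k) + (\<Sum>k\<in>?K. Poly_Mapping.lookup q k *\<^sub>C g k)"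
    by (simp add: lookup_add scaleC_add_left sum.distrib)
  also have "\<dots> = ev p + ev q"
    unfolding ev_def using eval_superset[OF K, of p g] eval_superset[OF K, of q g] by simp
  finally show "ev (p + q) = ev p + ev q" .
  have "ev (c *\<^sub>C p) = (\<Sum>k\<in>Poly_Mapping.keys p. Poly_Mapping.lookup (c *\<^sub>C p) k *\<^sub>C g k)"
    unfolding ev_def by (rule eval_superset[OF _ keys_scaleC_subset]) simp
  then show "ev (c *\<^sub>C p) = c *\<^sub>C ev p"
    by (simp add: ev_def complex_vector.scale_sum_right complex_vector.scale_scale)
qed

lemma subspace_projection:
  assumes "complex_vector.subspace A"
  obtains \<pi> :: "'a::complex_vector \<Rightarrow> 'a" where
    "Vector_Spaces.linear scaleC scaleC \<pi>" "range \<pi> \<subseteq> A" "\<And>a. a \<in> A \<Longrightarrow> \<pi> a = a"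
proof -
  have "Vector_Spaces.linear scaleC scaleC (id :: 'a \<Rightarrow> 'a)"
    by (rule complex_vector.linear_id)
  from complex_vector.linear_exists_left_inverse_on[OF this assms]
  obtain g :: "'a \<Rightarrow> 'a" where "g ` UNIV \<subseteq> A" "Vector_Spaces.linear scaleC scaleC g" "\<forall>v\<in>A. g (id v) = v"
    by auto
  then show thesis by (intro that[of g]) auto
qed

lemma tensor_lift_abs:
  fixes f :: "'a::complex_vector \<Rightarrow> 'b::complex_vector \<Rightarrow> 'c::complex_vector"
  assumes A: "complex_vector.subspace A" and B: "complex_vector.subspace B"
    and f: "bilinear_on A B f" and p: "Poly_Mapping.keys p \<subseteq> A \<times> B"
  shows "tensor_lift A B f (abs_tensor p) =
    (\<Sum>(a, b)\<in>Poly_Mapping.keys p. Poly_Mapping.lookup p (a, b) *\<^sub>C f a b)"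
proof -
  obtain \<pi> where \<pi>: "Vector_Spaces.linear scaleC scaleC \<pi>" "range \<pi> \<subseteq> A" "\<And>a. a \<in> A \<Longrightarrow> \<pi> a = a"
    using subspace_projection[OF A] by metis
  obtain \<rho> where \<rho>: "Vector_Spaces.linear scaleC scaleC \<rho>" "range \<rho> \<subseteq> B" "\<And>b. b \<in> B \<Longrightarrow> \<rho> b = b"
    using subspace_projection[OF B] by metis
  note l = complex_vector.linear_add[OF \<pi>(1)] complex_vector.linear_add[OF \<rho>(1)]
    complex_vector.linear_scale[OF \<pi>(1)] complex_vector.linear_scale[OF \<rho>(1)]
  have f': "\<And>a a' b. a \<in> A \<Longrightarrow> a' \<in> A \<Longrightarrow> b \<in> B \<Longrightarrow> f (a + a') b = f a b + f a' b"
      "\<And>a b b'. a \<in> A \<Longrightarrow> b \<in> B \<Longrightarrow> b' \<in> B \<Longrightarrow> f a (b + b') = f a b + f a b'"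
      "\<And>c a b. a \<in> A \<Longrightarrow> b \<in> B \<Longrightarrow> f (c *\<^sub>C a) b = c *\<^sub>C f a b"
      "\<And>c a b. a \<in> A \<Longrightarrow> b \<in> B \<Longrightarrow> f a (c *\<^sub>C b) = c *\<^sub>C f a b"
    using f by (auto simp: bilinear_on_def linear_on_def)
  define g where "g = (\<lambda>(a, b). f (\<pi> a) (\<rho> b))"
  define ev where "ev = (\<lambda>p. \<Sum>k\<in>Poly_Mapping.keys p. Poly_Mapping.lookup p k *\<^sub>C g k)"
  have lin: "Vector_Spaces.linear scaleC scaleC ev"
    unfolding ev_def by (rule linear_eval)
  have ev_single: "ev (Poly_Mapping.single k 1) = g k" for k
    by (simp add: ev_def scaleC_one)
  have in_A: "\<pi> a \<in> A" and in_B: "\<rho> b \<in> B" for a b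
    using \<pi>(2) \<rho>(2) by auto
  have ker: "complex_vector.subspace {p. ev p = 0}"
    by (rule complex_vector.linear_subspace_kernel[OF lin])
  have null: "ev q = 0" if "q \<in> tensor_null" for q
  proof -
    have "tensor_null \<subseteq> {p. ev p = 0}"
      unfolding tensor_null_def
      by (rule complex_vector.span_minimal[OF _ ker])
        (auto simp: complex_vector.linear_diff[OF lin] complex_vector.linear_scale[OF lin]
           ev_single g_def l f' in_A in_B)
    with that show ?thesis by auto
  qed
  have ev_f: "(\<Sum>(a, b)\<in>Poly_Mapping.keys q. Poly_Mapping.lookup q (a, b) *\<^sub>C f a b) = ev q"
    if "Poly_Mapping.keys q \<subseteq> A \<times> B" for q
    unfolding ev_def g_def by (rule sum.cong) (use that \<pi>(3) \<rho>(3) in auto)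
  define q where "q = (SOME q. Poly_Mapping.keys q \<subseteq> A \<times> B \<and> abs_tensor q = abs_tensor p)"
  have q: "Poly_Mapping.keys q \<subseteq> A \<times> B \<and> abs_tensor q = abs_tensor p"
    unfolding q_def by (rule someI[of _ p]) (use p in simp)
  then have "q - p \<in> tensor_null"
    using tensor.abs_eq_iff by blast
  from null[OF this] have "ev q = ev p"
    by (simp add: complex_vector.linear_diff[OF lin])
  then show ?thesis
    using ev_f[of q] ev_f[of p] q p by (simp add: tensor_lift_def q_def[symmetric])
qed

lemma tensor_space_rep:
  assumes "complex_vector.subspace A" "complex_vector.subspace B" "t \<in> tensor_space A B"
  obtains p where "Poly_Mapping.keys p \<subseteq> A \<times> B" "abs_tensor p = t"
proof -
  let ?R = "{t. \<exists>p. Poly_Mapping.keys p \<subseteq> A \<times> B \<and> abs_tensor p = t}"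
  have "complex_vector.subspace ?R"
  proof (rule complex_vector.subspaceI)
    show "0 \<in> ?R" by (auto intro!: exI[of _ 0] simp: zero_tensor.abs_eq)
  next
    fix x y assume "x \<in> ?R" "y \<in> ?R"
    then obtain p q where "Poly_Mapping.keys p \<subseteq> A \<times> B" "abs_tensor p = x"
      "Poly_Mapping.keys q \<subseteq> A \<times> B" "abs_tensor q = y" by auto
    then show "x + y \<in> ?R"
      using keys_add[of p q] by (auto intro!: exI[of _ "p + q"] simp: abs_tensor_add)
  next
    fix c x assume "x \<in> ?R"
    then obtain p where "Poly_Mapping.keys p \<subseteq> A \<times> B" "abs_tensor p = x" by auto
    then show "c *\<^sub>C x \<in> ?R"
      using keys_scaleC_subset[of c p] by (auto intro!: exI[of _ "c *\<^sub>C p"] simp: abs_tensor_scaleC)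
  qed
  moreover have "{a \<otimes>\<^sub>t b | a b. a \<in> A \<and> b \<in> B} \<subseteq> ?R"
  proof clarify
    fix a b assume "a \<in> A" "b \<in> B"
    then show "\<exists>p. Poly_Mapping.keys p \<subseteq> A \<times> B \<and> abs_tensor p = a \<otimes>\<^sub>t b"
      by (intro exI[of _ "Poly_Mapping.single (a, b) 1"]) (simp add: pure_tensor.abs_eq)
  qed
  ultimately have "tensor_space A B \<subseteq> ?R"
    unfolding tensor_space_def by (intro complex_vector.span_minimal)
  with assms(3) that show thesis by auto
qed

lemma tensor_lift_pure:
  assumes "complex_vector.subspace A" "complex_vector.subspace B" "bilinear_on A B f" "a \<in> A" "b \<in> B"
  shows "tensor_lift A B f (a \<otimes>\<^sub>t b) = f a b"
  using tensor_lift_abs[OF assms(1-3), of "Poly_Mapping.single (a, b) 1"] assms(4,5)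
  by (simp add: pure_tensor.abs_eq scaleC_one)

lemma linear_on_tensor_lift:
  fixes f :: "'a::complex_vector \<Rightarrow> 'b::complex_vector \<Rightarrow> 'c::complex_vector"
  assumes A: "complex_vector.subspace A" and B: "complex_vector.subspace B" and f: "bilinear_on A B f"
  shows "linear_on (tensor_space A B) (tensor_lift A B f)"
proof -
  let ?ev = "\<lambda>p :: ('a \<times> 'b) \<Rightarrow>\<^sub>0 complex.
    \<Sum>k\<in>Poly_Mapping.keys p. Poly_Mapping.lookup p k *\<^sub>C (case k of (a, b) \<Rightarrow> f a b)"
  have lin: "Vector_Spaces.linear scaleC scaleC ?ev"
    by (rule linear_eval)
  have ev: "tensor_lift A B f (abs_tensor p) = ?ev p" if "Poly_Mapping.keys p \<subseteq> A \<times> B" for p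
    using tensor_lift_abs[OF A B f that] by (simp add: case_prod_unfold)
  show ?thesis
    unfolding linear_on_def
  proof (intro conjI ballI allI)
    fix x y assume "x \<in> tensor_space A B" "y \<in> tensor_space A B"
    then obtain p q where p: "Poly_Mapping.keys p \<subseteq> A \<times> B" "x = abs_tensor p"
      and q: "Poly_Mapping.keys q \<subseteq> A \<times> B" "y = abs_tensor q"
      using tensor_space_rep[OF A B] by metis
    have "Poly_Mapping.keys (p + q) \<subseteq> A \<times> B"
      using keys_add[of p q] p(1) q(1) by blast
    then show "tensor_lift A B f (x + y) = tensor_lift A B f x + tensor_lift A B f y"
      using ev[of "p + q"] ev[OF p(1)] ev[OF q(1)] complex_vector.linear_add[OF lin, of p q]
      by (simp add: p(2) q(2) abs_tensor_add)
  next
    fix c x assume "x \<in> tensor_space A B"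
    then obtain p where p: "Poly_Mapping.keys p \<subseteq> A \<times> B" "x = abs_tensor p"
      using tensor_space_rep[OF A B] by metis
    have "Poly_Mapping.keys (c *\<^sub>C p) \<subseteq> A \<times> B"
      using keys_scaleC_subset[of c p] p(1) by blast
    then show "tensor_lift A B f (c *\<^sub>C x) = c *\<^sub>C tensor_lift A B f x"
      using ev[of "c *\<^sub>C p"] ev[OF p(1)] complex_vector.linear_scale[OF lin, of c p]
      by (simp add: p(2) abs_tensor_scaleC)
  qed
qed


section \<open>Hopf algebras\<close>

text \<open>The underlying vector space is a subspace \<open>carrier H\<close> of an ambient complex vector space.\<close>

record (overloaded) 'a hopf = "'a monoid" +
  comult :: "'a \<Rightarrow> ('a, 'a) tensor"
  counit :: "'a \<Rightarrow> complex"
  antipode :: "'a \<Rightarrow> 'a"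

definition tensor_mult :: "('a::complex_vector, 'm) monoid_scheme \<Rightarrow>
    ('a, 'a) tensor \<Rightarrow> ('a, 'a) tensor \<Rightarrow> ('a, 'a) tensor" where
  "tensor_mult H s t =
     (let A = carrier H in
      tensor_lift A A (\<lambda>a b. tensor_lift A A (\<lambda>c d. (a \<otimes>\<^bsub>H\<^esub> c) \<otimes>\<^sub>t (b \<otimes>\<^bsub>H\<^esub> d)) t) s)"

definition tensor_assoc :: "'a::complex_vector set \<Rightarrow>
    (('a, 'a) tensor, 'a) tensor \<Rightarrow> ('a, ('a, 'a) tensor) tensor" where
  "tensor_assoc A =
     tensor_lift (tensor_space A A) A (\<lambda>s c. tensor_lift A A (\<lambda>a b. a \<otimes>\<^sub>t (b \<otimes>\<^sub>t c)) s)"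

locale hopf_algebra = monoid H for H :: "'a::complex_vector hopf" (structure) +
  assumes subspace_carrier: "complex_vector.subspace (carrier H)"
    and bilinear_mult: "bilinear_on (carrier H) (carrier H) (\<lambda>x y. x \<otimes> y)"
    and comult_closed: "\<And>x. x \<in> carrier H \<Longrightarrow> comult H x \<in> tensor_space (carrier H) (carrier H)"
    and linear_comult: "linear_on (carrier H) (comult H)"
    and linear_counit: "linear_on (carrier H) (counit H)"
    and coassoc: "\<And>x. x \<in> carrier H \<Longrightarrow>
      tensor_assoc (carrier H)
        (tensor_lift (carrier H) (carrier H) (\<lambda>a b. comult H a \<otimes>\<^sub>t b) (comult H x)) =
      tensor_lift (carrier H) (carrier H) (\<lambda>a b. a \<otimes>\<^sub>t comult H b) (comult H x)"
    and counit_left: "\<And>x. x \<in> carrier H \<Longrightarrow>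
      tensor_lift (carrier H) (carrier H) (\<lambda>a b. counit H a *\<^sub>C b) (comult H x) = x"
    and counit_right: "\<And>x. x \<in> carrier H \<Longrightarrow>
      tensor_lift (carrier H) (carrier H) (\<lambda>a b. counit H b *\<^sub>C a) (comult H x) = x"
    and comult_mult: "\<And>x y. x \<in> carrier H \<Longrightarrow> y \<in> carrier H \<Longrightarrow>
      comult H (x \<otimes> y) = tensor_mult H (comult H x) (comult H y)"
    and comult_one: "comult H \<one> = \<one> \<otimes>\<^sub>t \<one>"
    and counit_mult: "\<And>x y. x \<in> carrier H \<Longrightarrow> y \<in> carrier H \<Longrightarrow>
      counit H (x \<otimes> y) = counit H x * counit H y"
    and counit_one: "counit H \<one> = 1"
    and antipode_closed: "\<And>x. x \<in> carrier H \<Longrightarrow> antipode H x \<in> carrier H"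
    and linear_antipode: "linear_on (carrier H) (antipode H)"
    and antipode_left: "\<And>x. x \<in> carrier H \<Longrightarrow>
      tensor_lift (carrier H) (carrier H) (\<lambda>a b. antipode H a \<otimes> b) (comult H x) = counit H x *\<^sub>C \<one>"
    and antipode_right: "\<And>x. x \<in> carrier H \<Longrightarrow>
      tensor_lift (carrier H) (carrier H) (\<lambda>a b. a \<otimes> antipode H b) (comult H x) = counit H x *\<^sub>C \<one>"

definition hopf_iso :: "'a::complex_vector hopf \<Rightarrow> 'b::complex_vector hopf \<Rightarrow> ('a \<Rightarrow> 'b) \<Rightarrow> bool" where
  "hopf_iso H K \<phi> \<longleftrightarrow>
     bij_betw \<phi> (carrier H) (carrier K) \<and>
     linear_on (carrier H) \<phi> \<and>
     (\<forall>x\<in>carrier H. \<forall>y\<in>carrier H. \<phi> (x \<otimes>\<^bsub>H\<^esub> y) = \<phi> x \<otimes>\<^bsub>K\<^esub> \<phi> y) \<and>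
     \<phi> \<one>\<^bsub>H\<^esub> = \<one>\<^bsub>K\<^esub> \<and>
     (\<forall>x\<in>carrier H.
        comult K (\<phi> x) = tensor_lift (carrier H) (carrier H) (\<lambda>a b. \<phi> a \<otimes>\<^sub>t \<phi> b) (comult H x)) \<and>
     (\<forall>x\<in>carrier H. counit K (\<phi> x) = counit H x) \<and>
     (\<forall>x\<in>carrier H. antipode K (\<phi> x) = \<phi> (antipode H x))"

definition group_algebra :: "('g, 'm) monoid_scheme \<Rightarrow> ('g \<Rightarrow>\<^sub>0 complex) hopf" where
  "group_algebra G =
     \<lparr>carrier = {p. Poly_Mapping.keys p \<subseteq> carrier G},
      mult = (\<lambda>p q. \<Sum>x\<in>Poly_Mapping.keys p. \<Sum>y\<in>Poly_Mapping.keys q.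
                Poly_Mapping.single (x \<otimes>\<^bsub>G\<^esub> y) (Poly_Mapping.lookup p x * Poly_Mapping.lookup q y)),
      one = Poly_Mapping.single \<one>\<^bsub>G\<^esub> 1,
      comult = (\<lambda>p. \<Sum>x\<in>Poly_Mapping.keys p. Poly_Mapping.lookup p x *\<^sub>C
                  (Poly_Mapping.single x 1 \<otimes>\<^sub>t Poly_Mapping.single x 1)),
      counit = (\<lambda>p. \<Sum>x\<in>Poly_Mapping.keys p. Poly_Mapping.lookup p x),
      antipode = (\<lambda>p. \<Sum>x\<in>Poly_Mapping.keys p.
                  Poly_Mapping.single (inv\<^bsub>G\<^esub> x) (Poly_Mapping.lookup p x))\<rparr>"


section \<open>Vertex operator algebras\<close>

text \<open>A formal series in \<open>z\<^sub>0, z\<^sub>1, z\<^sub>2\<close> is its coefficient function: \<open>F (a, b, c)\<close> is the coefficient of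
  \<open>z\<^sub>0\<close> to the \<open>a\<close> times \<open>z\<^sub>1\<close> to the \<open>b\<close> times \<open>z\<^sub>2\<close> to the \<open>c\<close>.\<close>

type_synonym 'a series3 = "int \<times> int \<times> int \<Rightarrow> 'a"

text \<open>\<open>binomial_coeff s t n p q\<close> is the coefficient of \<open>x\<close> to the \<open>p\<close> times \<open>y\<close> to the \<open>q\<close> in
  \<open>(s x + t y)\<close> to the \<open>n\<close>, for \<open>s, t \<in> {1, -1}\<close>, expanded in nonnegative powers of the second
  summand \<open>y\<close>. Expanding in the first summand instead would make the products in the Jacobi
  identity infinite sums.\<close>

definition binomial_coeff :: "complex \<Rightarrow> complex \<Rightarrow> int \<Rightarrow> int \<Rightarrow> int \<Rightarrow> complex" where
  "binomial_coeff s t n p q =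
     (if q \<ge> 0 \<and> p + q = n then (of_int n gchoose nat q) * s powi p * t powi q else 0)"

text \<open>Since \<open>\<delta>(z) = \<Sum>n. z\<^sup>n\<close>, the coefficient of \<open>z\<^sub>0\<close> to the \<open>a\<close> in \<open>z\<^sub>0\<^sup>-\<^sup>1 \<delta>((z\<^sub>1 - z\<^sub>2)/z\<^sub>0)\<close> is
  \<open>(z\<^sub>1 - z\<^sub>2)\<close> to the \<open>-a-1\<close>, and likewise for the other two delta functions:
  \<open>z\<^sub>0\<^sup>-\<^sup>1 \<delta>((-z\<^sub>2 + z\<^sub>1)/z\<^sub>0)\<close> and \<open>z\<^sub>1\<^sup>-\<^sup>1 \<delta>((z\<^sub>2 + z\<^sub>0)/z\<^sub>1)\<close>.\<close>

definition delta_1_minus_2 :: "complex series3" where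
  "delta_1_minus_2 = (\<lambda>(a, b, c). binomial_coeff 1 (-1) (- a - 1) b c)"

definition delta_minus_2_plus_1 :: "complex series3" where
  "delta_minus_2_plus_1 = (\<lambda>(a, b, c). binomial_coeff (-1) 1 (- a - 1) c b)"

definition delta_2_plus_0 :: "complex series3" where
  "delta_2_plus_0 = (\<lambda>(a, b, c). binomial_coeff 1 1 (- b - 1) c a)"

text \<open>\<open>Sum_any\<close> is only meaningful for finitely many nonzero terms; in the Jacobi identity this is
  guaranteed by the truncation condition \<open>u\<^sub>n v = 0\<close> for \<open>n\<close> large.\<close>

definition series3_mult :: "complex series3 \<Rightarrow> 'v::complex_vector series3 \<Rightarrow> 'v series3" where
  "series3_mult D F = (\<lambda>(a, b, c). Sum_any (\<lambda>(i, j, k). D (i, j, k) *\<^sub>C F (a - i, b - j, c - k)))"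

text \<open>\<open>mode V u n\<close> is the endomorphism \<open>u\<^sub>n\<close>, that is, the coefficient of \<open>z\<close> to the \<open>-n-1\<close> in
  \<open>Y(u,z)\<close>; \<open>grade V n\<close> is \<open>V\<^sub>n\<close>.\<close>

record 'v vertex_data =
  mode :: "'v \<Rightarrow> int \<Rightarrow> 'v \<Rightarrow> 'v"
  vacuum :: 'v
  conformal :: 'v
  grade :: "int \<Rightarrow> 'v set"

definition Y_coeff :: "('v, 'm) vertex_data_scheme \<Rightarrow> 'v \<Rightarrow> int \<Rightarrow> 'v \<Rightarrow> 'v" where
  "Y_coeff V u k w = mode V u (- k - 1) w"

definition virasoro :: "('v, 'm) vertex_data_scheme \<Rightarrow> int \<Rightarrow> 'v \<Rightarrow> 'v" where
  "virasoro V n = mode V (conformal V) (n + 1)"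

text \<open>The series \<open>Y(u,z\<^sub>1)Y(v,z\<^sub>2)w\<close>, \<open>Y(v,z\<^sub>2)Y(u,z\<^sub>1)w\<close> and \<open>Y(Y(u,z\<^sub>0)v,z\<^sub>2)w\<close>.\<close>

definition Y1_Y2 :: "('v::complex_vector, 'm) vertex_data_scheme \<Rightarrow> 'v \<Rightarrow> 'v \<Rightarrow> 'v \<Rightarrow> 'v series3" where
  "Y1_Y2 V u v w = (\<lambda>(a, b, c). if a = 0 then Y_coeff V u b (Y_coeff V v c w) else 0)"

definition Y2_Y1 :: "('v::complex_vector, 'm) vertex_data_scheme \<Rightarrow> 'v \<Rightarrow> 'v \<Rightarrow> 'v \<Rightarrow> 'v series3" where
  "Y2_Y1 V u v w = (\<lambda>(a, b, c). if a = 0 then Y_coeff V v c (Y_coeff V u b w) else 0)"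

definition Y2_Y0 :: "('v::complex_vector, 'm) vertex_data_scheme \<Rightarrow> 'v \<Rightarrow> 'v \<Rightarrow> 'v \<Rightarrow> 'v series3" where
  "Y2_Y0 V u v w = (\<lambda>(a, b, c). if b = 0 then Y_coeff V (Y_coeff V u a v) c w else 0)"

text \<open>The underlying vector space of the vertex operator algebra is the whole type \<open>'v\<close>.\<close>

locale vertex_operator_algebra =
  fixes V :: "'v::complex_vector vertex_data"
  assumes subspace_grade: "complex_vector.subspace (grade V n)"
    and direct_sum: "\<exists>!f. finite {n. f n \<noteq> 0} \<and> (\<forall>n. f n \<in> grade V n) \<and> Sum_any f = v"
    and finite_dim_grade: "finite_dim (grade V n)"
    and grade_bounded_below: "\<exists>N. \<forall>n<N. grade V n = {0}"
    and vacuum_grade: "vacuum V \<in> grade V 0"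
    and conformal_grade: "conformal V \<in> grade V 2"
    and bilinear_mode: "bilinear_on UNIV UNIV (\<lambda>u v. mode V u n v)"
    and truncation: "\<exists>N. \<forall>n\<ge>N. mode V u n v = 0"
    and vacuum_left: "mode V (vacuum V) n v = (if n = - 1 then v else 0)"
    and creation: "n \<ge> 0 \<Longrightarrow> mode V v n (vacuum V) = 0" "mode V v (- 1) (vacuum V) = v"
    and grade_eq: "grade V n = {v. virasoro V 0 v = of_int n *\<^sub>C v}"
    \<comment> \<open>the coefficient of \<open>z\<close> to the \<open>-n-1\<close> in \<open>Y(L(-1)u,z) = d/dz Y(u,z)\<close>\<close>
    and derivative: "mode V (virasoro V (- 1) u) n v = - of_int n *\<^sub>C mode V u (n - 1) v"
    and virasoro_relation: "\<exists>c. \<forall>n m v.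
      virasoro V n (virasoro V m v) - virasoro V m (virasoro V n v) =
        of_int (n - m) *\<^sub>C virasoro V (n + m) v +
        (if n + m = 0 then ((of_int n ^ 3 - of_int n) / 12 * c) *\<^sub>C v else 0)"
    and jacobi:
      "series3_mult delta_1_minus_2 (Y1_Y2 V u v w) k -
       series3_mult delta_minus_2_plus_1 (Y2_Y1 V u v w) k =
       series3_mult delta_2_plus_0 (Y2_Y0 V u v w) k"

definition voa_ideal :: "'v::complex_vector vertex_data \<Rightarrow> 'v set \<Rightarrow> bool" where
  "voa_ideal V I \<longleftrightarrow> complex_vector.subspace I \<and>
     (\<forall>u n v. v \<in> I \<longrightarrow> mode V u n v \<in> I \<and> mode V v n u \<in> I)"

definition voa_simple :: "'v::complex_vector vertex_data \<Rightarrow> bool" where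
  "voa_simple V \<longleftrightarrow> (UNIV :: 'v set) \<noteq> {0} \<and> (\<forall>I. voa_ideal V I \<longrightarrow> I = {0} \<or> I = UNIV)"


section \<open>Hopf algebra actions\<close>

definition hopf_module :: "'h::complex_vector hopf \<Rightarrow> ('h \<Rightarrow> 'v::complex_vector \<Rightarrow> 'v) \<Rightarrow> bool" where
  "hopf_module H act \<longleftrightarrow>
     bilinear_on (carrier H) UNIV act \<and>
     (\<forall>v. act \<one>\<^bsub>H\<^esub> v = v) \<and>
     (\<forall>x\<in>carrier H. \<forall>y\<in>carrier H. \<forall>v. act (x \<otimes>\<^bsub>H\<^esub> y) v = act x (act y v))"

definition hopf_module_voa ::
  "'h::complex_vector hopf \<Rightarrow> 'v::complex_vector vertex_data \<Rightarrow> ('h \<Rightarrow> 'v \<Rightarrow> 'v) \<Rightarrow> bool" where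
  "hopf_module_voa H V act \<longleftrightarrow>
     hopf_module H act \<and>
     (\<forall>h\<in>carrier H. act h (conformal V) = counit H h *\<^sub>C conformal V) \<and>
     (\<forall>h\<in>carrier H. \<forall>u n v. act h (mode V u n v) =
        tensor_lift (carrier H) (carrier H) (\<lambda>a b. mode V (act a u) n (act b v)) (comult H h))"

definition faithful_action ::
  "'h::complex_vector hopf \<Rightarrow> ('h \<Rightarrow> 'v::complex_vector \<Rightarrow> 'v) \<Rightarrow> bool" where
  "faithful_action H act \<longleftrightarrow> (\<forall>h\<in>carrier H. (\<forall>v. act h v = 0) \<longrightarrow> h = 0)"

end

theory Submission
  imports Defs "HOL-Computational_Algebra.Fundamental_Theorem_Algebra"
begin

text \<open>Skew symmetry \<open>Y(u,z)v = e\<^bsup>zL(-1)\<^esup> Y(v,-z)u\<close>, together with the fact that \<open>L(-1)\<close> commutes with the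
  action, gives \<open>\<Sum> Y(h\<^sub>1 u, z) h\<^sub>2 v = \<Sum> Y(h\<^sub>2 u, z) h\<^sub>1 v\<close>. For a simple vertex operator algebra the map
  \<open>u \<otimes> v \<mapsto> Y(u,z)v\<close> is injective on \<open>V \<otimes> V\<close> (weak commutativity and Jacobson density), so by faithfulness
  \<open>H\<close> is cocommutative. A finite dimensional cocommutative Hopf algebra over \<open>\<complex>\<close> has no nonzero primitive
  elements, and it is spanned by its grouplike elements, which form a finite group.\<close>


section \<open>Linear algebra over the complex numbers\<close>

text \<open>Injectivity on the tensor square of V yields a relation between vectors of V, whereas
  cocommutativity concerns \<open>comult H h\<close>. The gap is bridged by functionals: applying
  one to a single tensor factor leaves a vector, and faithfulness is used twice, once for each
  factor. The same slices turn the coalgebra H into a family of operators \<open>hit f\<close> on H,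
  the action of the dual algebra. Cocommutativity makes them commute, so grouplikes can be found by
  a common eigenvector argument modulo the span of those already known. The infinite dimension of V
  matters in Schur's lemma, where the grading helps: an operator commuting with all modes commutes
  with L(0) and hence preserves the finite dimensional spaces V_n, in which an eigenvector exists.
  The action commutes with L(-1) because L(-1) is a mode of the conformal vector, on which H acts
  through the counit.\<close>

lemma linear_on_add: "linear_on A f \<Longrightarrow> x \<in> A \<Longrightarrow> y \<in> A \<Longrightarrow> f (x + y) = f x + f y"
  by (simp add: linear_on_def)

lemma linear_on_scale: "linear_on A f \<Longrightarrow> x \<in> A \<Longrightarrow> f (c *\<^sub>C x) = c *\<^sub>C f x"
  by (simp add: linear_on_def)

lemma linear_on_zero:
  assumes "linear_on A f" "complex_vector.subspace A"
  shows "f 0 = 0"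
  using linear_on_scale[OF assms(1), of 0 0] complex_vector.subspace_0[OF assms(2)] by simp

lemma linear_on_diff:
  assumes f: "linear_on A f" and A: "complex_vector.subspace A" and "x \<in> A" "y \<in> A"
  shows "f (x - y) = f x - f y"
  using linear_on_add[OF f, of "x - y" y] complex_vector.subspace_diff[OF A] assms(3,4)
  by (simp add: algebra_simps)

lemma linear_on_sum:
  assumes f: "linear_on A f" and A: "complex_vector.subspace A" and "\<And>i. i \<in> I \<Longrightarrow> x i \<in> A"
  shows "f (sum x I) = (\<Sum>i\<in>I. f (x i))"
  using assms(3)
proof (induction I rule: infinite_finite_induct)
  case (insert i I)
  then show ?case
    by (simp add: linear_on_add[OF f] complex_vector.subspace_sum[OF A])
qed (simp_all add: linear_on_zero[OF f A])

lemma linear_on_compose: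
  assumes "linear_on A f" "linear_on B g" "\<And>x. x \<in> A \<Longrightarrow> f x \<in> B"
  shows "linear_on A (\<lambda>x. g (f x))"
  using assms by (simp add: linear_on_def)

lemma linear_imp_linear_on: "Vector_Spaces.linear scaleC scaleC f \<Longrightarrow> linear_on A f"
  by (simp add: linear_on_def complex_vector.linear_add complex_vector.linear_scale)

lemma linear_on_subset: "linear_on A f \<Longrightarrow> B \<subseteq> A \<Longrightarrow> linear_on B f"
  unfolding linear_on_def by blast

lemma linear_on_span_eq:
  assumes f: "linear_on A f" and g: "linear_on A g" and A: "complex_vector.subspace A"
    and S: "S \<subseteq> A" "\<And>s. s \<in> S \<Longrightarrow> f s = g s" and x: "x \<in> complex_vector.span S"
  shows "f x = g x"
proof -
  have "complex_vector.span S \<subseteq> {x \<in> A. f x = g x}"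
    using S complex_vector.subspace_0[OF A] complex_vector.subspace_add[OF A]
      complex_vector.subspace_scale[OF A]
    by (intro complex_vector.span_minimal complex_vector.subspaceI)
      (auto simp: linear_on_zero[OF f A] linear_on_zero[OF g A] linear_on_add[OF f] linear_on_add[OF g]
        linear_on_scale[OF f] linear_on_scale[OF g])
  with x show ?thesis by auto
qed

lemma functional_extend:
  fixes B :: "'a::complex_vector set" and g :: "'a \<Rightarrow> complex"
  assumes "complex_vector.independent B"
  obtains f :: "'a \<Rightarrow> complex" where "linear_on UNIV f" "\<And>x. x \<in> B \<Longrightarrow> f x = g x"
proof -
  obtain f :: "'a \<Rightarrow> complex" where f: "Vector_Spaces.linear scaleC scaleC f" "\<forall>x\<in>B. f x = g x"
    using complex_vector.linear_independent_extend[OF assms, of g] by auto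
  show thesis by (rule that[of f]) (use f linear_imp_linear_on in auto)
qed

lemma functional_separating:
  fixes x :: "'a::complex_vector"
  assumes "x \<noteq> 0"
  obtains f :: "'a \<Rightarrow> complex" where "linear_on UNIV f" "f x = 1"
proof -
  have "complex_vector.independent {x}"
    using assms by simp
  from this show thesis
  proof (rule functional_extend[of "{x}" "\<lambda>_. 1"])
    fix f :: "'a \<Rightarrow> complex"
    assume "linear_on UNIV f" "\<And>y. y \<in> {x} \<Longrightarrow> f y = 1"
    then show thesis by (intro that[of f]) simp_all
  qed
qed

lemma eq_zero_if_functionals_zero:
  fixes x :: "'a::complex_vector"
  assumes "\<And>f :: 'a \<Rightarrow> complex. linear_on UNIV f \<Longrightarrow> f x = 0"
  shows "x = 0"
proof (rule ccontr)
  assume "x \<noteq> 0"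
  then obtain f :: "'a \<Rightarrow> complex" where f: "linear_on UNIV f" "f x = 1"
    by (rule functional_separating)
  from assms[OF f(1)] f(2) show False by simp
qed

text \<open>Otherwise each term enlarges the span of its predecessors, and \<open>card B + 1\<close>
  terms would be independent inside \<open>span B\<close>. Used for the iterates of an operator and
  for the powers of a primitive element.\<close>

lemma dependent_sequence:
  fixes a :: "nat \<Rightarrow> 'a::complex_vector"
  assumes "finite B" "\<And>k. a k \<in> complex_vector.span B"
  shows "\<exists>n. a n \<in> complex_vector.span (a ` {..<n})"
proof (rule ccontr)
  assume not: "\<not> ?thesis"
  have ind: "complex_vector.independent (a ` {..<n}) \<and> card (a ` {..<n}) = n" for n
  proof (induction n)
    case (Suc n)
    have 1: "a n \<notin> complex_vector.span (a ` {..<n})" using not by simp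
    from contrapos_nn[OF this complex_vector.span_base] have 2: "a n \<notin> a ` {..<n}" .
    from 1 2 show ?case
      using Suc by (simp add: lessThan_Suc complex_vector.independent_insert card_insert_if)
  qed (simp add: complex_vector.independent_empty)
  have "a ` {..<Suc (card B)} \<subseteq> complex_vector.span B"
    using assms(2) by auto
  from complex_vector.independent_span_bound[OF assms(1) _ this] ind[of "Suc (card B)"]
  show False by simp
qed

section \<open>Polynomials in an operator and eigenvectors modulo a subspace\<close>

definition poly_eval_at :: "('a \<Rightarrow> 'a) \<Rightarrow> 'a::complex_vector \<Rightarrow> complex poly \<Rightarrow> 'a" where
  "poly_eval_at T x p = (\<Sum>k\<le>degree p. coeff p k *\<^sub>C (T ^^ k) x)"

lemma poly_eval_at_superset:
  assumes "degree p \<le> n"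
  shows "poly_eval_at T x p = (\<Sum>k\<le>n. coeff p k *\<^sub>C (T ^^ k) x)"
  unfolding poly_eval_at_def
  by (rule sum.mono_neutral_left) (use assms in \<open>auto simp: coeff_eq_0 not_le\<close>)

lemma poly_eval_at_add: "poly_eval_at T x (p + q) = poly_eval_at T x p + poly_eval_at T x q"
proof -
  let ?n = "max (degree p) (degree q)"
  have "degree (p + q) \<le> ?n" by (simp add: degree_add_le)
  then show ?thesis
    by (simp add: poly_eval_at_superset[of _ ?n] scaleC_add_left sum.distrib)
qed

lemma poly_eval_at_smult: "poly_eval_at T x (smult c p) = c *\<^sub>C poly_eval_at T x p"
  by (simp add: poly_eval_at_superset[OF degree_smult_le]
      poly_eval_at_def complex_vector.scale_sum_right)

lemma poly_eval_at_diff: "poly_eval_at T x (p - q) = poly_eval_at T x p - poly_eval_at T x q"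
  using poly_eval_at_add[of T x "p - q" q] by (simp add: algebra_simps)

lemma poly_eval_at_monom: "poly_eval_at T x (monom 1 n) = (T ^^ n) x"
  by (simp add: poly_eval_at_def degree_monom_eq if_distrib[of "\<lambda>c. c *\<^sub>C _"] scaleC_one cong: if_cong)

text \<open>Operators such as \<open>hit f\<close> are linear only on the carrier of H, so
  eigenvectors are treated relative to a subspace \<open>S\<close>.\<close>

locale endomorphism_on =
  fixes S :: "'a::complex_vector set" and T :: "'a \<Rightarrow> 'a"
  assumes subspace: "complex_vector.subspace S"
    and linear: "linear_on S T" and closed: "\<And>x. x \<in> S \<Longrightarrow> T x \<in> S"
begin

lemma funpow_closed: "x \<in> S \<Longrightarrow> (T ^^ k) x \<in> S"
  by (induction k) (simp_all add: closed)

lemma poly_eval_at_closed: "x \<in> S \<Longrightarrow> poly_eval_at T x p \<in> S"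
  unfolding poly_eval_at_def
  by (intro complex_vector.subspace_sum[OF subspace] complex_vector.subspace_scale[OF subspace] funpow_closed)

lemma poly_eval_at_shift:
  assumes "x \<in> S"
  shows "poly_eval_at T x (pCons 0 p) = T (poly_eval_at T x p)"
proof -
  have "T (poly_eval_at T x p) = (\<Sum>k\<le>degree p. T (coeff p k *\<^sub>C (T ^^ k) x))"
    unfolding poly_eval_at_def
    by (rule linear_on_sum[OF linear subspace])
      (use assms in \<open>simp add: complex_vector.subspace_scale[OF subspace] funpow_closed\<close>)
  also have "\<dots> = (\<Sum>k\<le>degree p. coeff p k *\<^sub>C (T ^^ Suc k) x)"
    using assms by (simp add: linear_on_scale[OF linear] funpow_closed)
  also have "\<dots> = (\<Sum>k\<le>Suc (degree p). coeff (pCons 0 p) k *\<^sub>C (T ^^ k) x)"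
    by (simp del: sum.atMost_Suc add: sum.atMost_Suc_shift)
  also have "\<dots> = poly_eval_at T x (pCons 0 p)"
    by (rule poly_eval_at_superset[symmetric]) (simp add: degree_pCons_le)
  finally show ?thesis by simp
qed

lemma poly_eval_at_linear_factor:
  assumes "x \<in> S"
  shows "poly_eval_at T x ([:-c, 1:] * q) = T (poly_eval_at T x q) - c *\<^sub>C poly_eval_at T x q"
proof -
  have "[:-c, 1:] * q = pCons 0 q - smult c q" by simp
  then show ?thesis
    by (simp only: poly_eval_at_diff poly_eval_at_smult poly_eval_at_shift[OF assms])
qed

lemma annihilating_poly:
  assumes "x \<in> S" "finite B" "S \<subseteq> complex_vector.span B"
  shows "\<exists>p. p \<noteq> 0 \<and> poly_eval_at T x p = 0"
proof -
  have "(T ^^ k) x \<in> complex_vector.span B" for k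
    using funpow_closed assms by auto
  then obtain n where n: "(T ^^ n) x \<in> complex_vector.span ((\<lambda>k. (T ^^ k) x) ` {..<n})"
    using dependent_sequence[OF assms(2), of "\<lambda>k. (T ^^ k) x"] by blast
  let ?P = "{y. \<exists>q. (\<forall>k\<ge>n. coeff q k = 0) \<and> poly_eval_at T x q = y}"
  have "complex_vector.span ((\<lambda>k. (T ^^ k) x) ` {..<n}) \<subseteq> ?P"
  proof (intro complex_vector.span_minimal complex_vector.subspaceI)
    show "(\<lambda>k. (T ^^ k) x) ` {..<n} \<subseteq> ?P"
    proof clarify
      fix k assume "k < n"
      then show "\<exists>q. (\<forall>k\<ge>n. coeff q k = 0) \<and> poly_eval_at T x q = (T ^^ k) x"
        by (intro exI[of _ "monom 1 k"]) (auto simp: poly_eval_at_monom)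
    qed
    show "0 \<in> ?P" by (auto intro!: exI[of _ 0] simp: poly_eval_at_def)
    show "y + z \<in> ?P" if yz: "y \<in> ?P" "z \<in> ?P" for y z
    proof -
      from yz obtain q r where "\<forall>k\<ge>n. coeff q k = 0" "poly_eval_at T x q = y"
        "\<forall>k\<ge>n. coeff r k = 0" "poly_eval_at T x r = z" by blast
      then show ?thesis by (auto intro!: exI[of _ "q + r"] simp: poly_eval_at_add)
    qed
    show "c *\<^sub>C y \<in> ?P" if y: "y \<in> ?P" for c y
    proof -
      from y obtain q where "\<forall>k\<ge>n. coeff q k = 0" "poly_eval_at T x q = y" by blast
      then show ?thesis by (auto intro!: exI[of _ "smult c q"] simp: poly_eval_at_smult)
    qed
  qed
  with n obtain q where q: "\<forall>k\<ge>n. coeff q k = 0" "poly_eval_at T x q = (T ^^ n) x"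
    by blast
  have "coeff (monom 1 n - q) n = 1" using q by simp
  then have "monom 1 n - q \<noteq> 0" by fastforce
  moreover have "poly_eval_at T x (monom 1 n - q) = 0"
    by (simp add: poly_eval_at_diff poly_eval_at_monom q)
  ultimately show ?thesis by blast
qed

text \<open>Linear factors are split off one at a time from a polynomial p with p(T) x in
  \<open>C\<close>. A constant p would put x into \<open>C\<close>, so the descent stops at some q
  with q(T) x outside \<open>C\<close> and (T - c) q(T) x in \<open>C\<close>; then y = q(T) x. For
  \<open>C = {0}\<close> this is an ordinary eigenvector.\<close>

lemma eigenvector_modulo:
  assumes x: "x \<in> S" "x \<notin> C" and C: "complex_vector.subspace C"
    and B: "finite B" "S \<subseteq> complex_vector.span B"
  shows "\<exists>y c. y \<in> S \<and> y \<notin> C \<and> T y - c *\<^sub>C y \<in> C"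
proof -
  have main: "?thesis" if "p \<noteq> 0" "poly_eval_at T x p \<in> C" for p
    using that
  proof (induction "degree p" arbitrary: p rule: less_induct)
    case less
    have "\<not> constant (poly p)"
    proof
      assume "constant (poly p)"
      then have "degree p = 0" by (simp add: constant_degree)
      then have "poly_eval_at T x p = coeff p 0 *\<^sub>C x" "coeff p 0 \<noteq> 0"
        using less.prems(1) by (auto simp: poly_eval_at_def elim: degree_eq_zeroE)
      with less.prems(2) complex_vector.subspace_scale[OF C, of "coeff p 0 *\<^sub>C x" "inverse (coeff p 0)"] x(2)
      show False by (simp add: scaleC_scaleC scaleC_one)
    qed
    then obtain c where "poly p c = 0" using fundamental_theorem_of_algebra by blast
    then obtain q where q: "p = [:-c, 1:] * q" by (auto simp: poly_eq_0_iff_dvd elim: dvdE)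
    with less.prems(1) have "q \<noteq> 0" by auto
    then have "degree p = Suc (degree q)" unfolding q by (subst degree_mult_eq) auto
    show ?case
    proof (cases "poly_eval_at T x q \<in> C")
      case True
      with less.hyps[of q] \<open>q \<noteq> 0\<close> \<open>degree p = _\<close> show ?thesis by simp
    next
      case False
      with less.prems(2) poly_eval_at_closed[OF x(1)] show ?thesis
        unfolding q poly_eval_at_linear_factor[OF x(1)] by blast
    qed
  qed
  obtain p where "p \<noteq> 0" "poly_eval_at T x p = 0"
    using annihilating_poly[OF x(1) B] by blast
  with main[of p] complex_vector.subspace_0[OF C] show ?thesis by simp
qed

end

text \<open>Induction over the operators: the vectors of \<open>S\<close> that are eigenvectors of
  \<open>T j\<close> modulo \<open>C\<close> for one fixed eigenvalue form a subspace. The remaining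
  operators preserve it because they commute with \<open>T j\<close> and map \<open>C\<close> into
  itself.\<close>

lemma common_eigenvector_modulo:
  assumes "finite J" and "finite B" "S \<subseteq> complex_vector.span B"
    and "complex_vector.subspace S" and C: "complex_vector.subspace C"
    and "x \<in> S" "x \<notin> C"
    and "\<And>j. j \<in> J \<Longrightarrow> linear_on S (T j)"
    and "\<And>j y. j \<in> J \<Longrightarrow> y \<in> S \<Longrightarrow> T j y \<in> S"
    and TC: "\<And>j y. j \<in> J \<Longrightarrow> y \<in> C \<Longrightarrow> T j y \<in> C"
    and "\<And>i j y. i \<in> J \<Longrightarrow> j \<in> J \<Longrightarrow> y \<in> S \<Longrightarrow> T i (T j y) = T j (T i y)"
  shows "\<exists>y\<in>S - C. \<forall>j\<in>J. \<exists>c. T j y - c *\<^sub>C y \<in> C"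
  using assms(1,3,4,6-)
proof (induction J arbitrary: S x rule: finite_induct)
  case (insert j J)
  note S = insert.prems(2)
  interpret endomorphism_on S "T j"
    by unfold_locales (use insert.prems in auto)
  obtain y c where y: "y \<in> S" "y \<notin> C" "T j y - c *\<^sub>C y \<in> C"
    using eigenvector_modulo[OF insert.prems(3,4) C assms(2) insert.prems(1)] by blast
  define S' where "S' = {z \<in> S. T j z - c *\<^sub>C z \<in> C}"
  have "\<exists>y\<in>S' - C. \<forall>i\<in>J. \<exists>c. T i y - c *\<^sub>C y \<in> C"
  proof (rule insert.IH)
    show "S' \<subseteq> complex_vector.span B" using insert.prems(1) by (auto simp: S'_def)
    show "complex_vector.subspace S'"
    proof (rule complex_vector.subspaceI)
      show "0 \<in> S'" using complex_vector.subspace_0[OF S] complex_vector.subspace_0[OF C]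
        by (simp add: S'_def linear_on_zero[OF linear S])
      show "u + v \<in> S'" if "u \<in> S'" "v \<in> S'" for u v
        using that complex_vector.subspace_add[OF S, of u v]
          complex_vector.subspace_add[OF C, of "T j u - c *\<^sub>C u" "T j v - c *\<^sub>C v"]
        by (simp add: S'_def linear_on_add[OF linear] scaleC_add_right algebra_simps)
      show "a *\<^sub>C u \<in> S'" if "u \<in> S'" for a u
        using that complex_vector.subspace_scale[OF S, of u a]
          complex_vector.subspace_scale[OF C, of "T j u - c *\<^sub>C u" a]
        by (simp add: S'_def linear_on_scale[OF linear] complex_vector.scale_right_diff_distrib
            scaleC_scaleC mult.commute)
    qed
    show "y \<in> S'" "y \<notin> C" using y by (simp_all add: S'_def)
    show "linear_on S' (T i)" if "i \<in> J" for i
      using insert.prems(5)[of i] that by (auto intro: linear_on_subset simp: S'_def)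
    show "T i z \<in> S'" if i: "i \<in> J" and z: "z \<in> S'" for i z
    proof -
      have zS: "z \<in> S" "T j z - c *\<^sub>C z \<in> C" using z by (auto simp: S'_def)
      note lin = insert.prems(5)[of i]
      have "T j (T i z) - c *\<^sub>C T i z = T i (T j z - c *\<^sub>C z)"
        using i zS insert.prems(8)[of j i z] linear_on_diff[OF lin S, of "T j z" "c *\<^sub>C z"]
          closed[of z] complex_vector.subspace_scale[OF S, of z c] linear_on_scale[OF lin, of z c]
        by simp
      also have "\<dots> \<in> C" using insert.prems(7) i zS by blast
      finally show ?thesis using i zS insert.prems(6) by (simp add: S'_def)
    qed
    show "T i z \<in> C" if "i \<in> J" "z \<in> C" for i z using insert.prems(7) that by blast
    show "T i (T k z) = T k (T i z)" if "i \<in> J" "k \<in> J" "z \<in> S'" for i k z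
      using insert.prems(8) that by (simp add: S'_def)
  qed
  then obtain z where "z \<in> S' - C" "\<forall>i\<in>J. \<exists>c. T i z - c *\<^sub>C z \<in> C" by blast
  then show ?case by (intro bexI[of _ z]) (auto simp: S'_def)
qed auto


section \<open>Tensors\<close>

lemma bilinear_onI:
  assumes "\<And>a a' b. a \<in> A \<Longrightarrow> a' \<in> A \<Longrightarrow> b \<in> B \<Longrightarrow> f (a + a') b = f a b + f a' b"
    and "\<And>c a b. a \<in> A \<Longrightarrow> b \<in> B \<Longrightarrow> f (c *\<^sub>C a) b = c *\<^sub>C f a b"
    and "\<And>a b b'. a \<in> A \<Longrightarrow> b \<in> B \<Longrightarrow> b' \<in> B \<Longrightarrow> f a (b + b') = f a b + f a b'"
    and "\<And>c a b. a \<in> A \<Longrightarrow> b \<in> B \<Longrightarrow> f a (c *\<^sub>C b) = c *\<^sub>C f a b"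
  shows "bilinear_on A B f"
  using assms by (simp add: bilinear_on_def linear_on_def)

lemma bilinear_on_left: "bilinear_on A B f \<Longrightarrow> b \<in> B \<Longrightarrow> linear_on A (\<lambda>a. f a b)"
  by (simp add: bilinear_on_def)

lemma bilinear_on_right: "bilinear_on A B f \<Longrightarrow> a \<in> A \<Longrightarrow> linear_on B (f a)"
  by (simp add: bilinear_on_def)

lemma bilinear_on_compose:
  assumes "bilinear_on A B k" "linear_on C F" "\<And>a b. a \<in> A \<Longrightarrow> b \<in> B \<Longrightarrow> k a b \<in> C"
  shows "bilinear_on A B (\<lambda>a b. F (k a b))"
  using assms by (simp add: bilinear_on_def linear_on_def)

lemma bilinear_on_compose2:
  assumes "bilinear_on A' B' k" "linear_on A F" "linear_on B G"
    "\<And>a. a \<in> A \<Longrightarrow> F a \<in> A'" "\<And>b. b \<in> B \<Longrightarrow> G b \<in> B'"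
  shows "bilinear_on A B (\<lambda>a b. k (F a) (G b))"
  using assms by (simp add: bilinear_on_def linear_on_def)

lemma bilinear_on_flip: "bilinear_on A B f \<Longrightarrow> bilinear_on B A (\<lambda>b a. f a b)"
  by (simp add: bilinear_on_def)

lemma bilinear_on_scaleC_left:
  fixes f :: "'a::complex_vector \<Rightarrow> complex"
  shows "linear_on A f \<Longrightarrow> linear_on B g \<Longrightarrow> bilinear_on A B (\<lambda>a b. f a *\<^sub>C g b)"
  by (rule bilinear_onI)
    (simp_all add: linear_on_add linear_on_scale scaleC_add_left scaleC_add_right scaleC_scaleC mult.commute)

lemma bilinear_on_scaleC_right:
  fixes f :: "'b::complex_vector \<Rightarrow> complex"
  shows "linear_on A g \<Longrightarrow> linear_on B f \<Longrightarrow> bilinear_on A B (\<lambda>a b. f b *\<^sub>C g a)"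
  by (rule bilinear_on_flip) (rule bilinear_on_scaleC_left)

lemma linear_on_ident: "linear_on A (\<lambda>x. x)"
  by (simp add: linear_on_def)

lemma pure_tensor_add_left: "(a + a') \<otimes>\<^sub>t b = a \<otimes>\<^sub>t b + a' \<otimes>\<^sub>t b"
proof transfer
  fix a a' :: 'a and b :: 'b
  have "Poly_Mapping.single (a + a', b) 1 - Poly_Mapping.single (a, b) 1 - Poly_Mapping.single (a', b) 1
    \<in> (tensor_null :: (('a \<times> 'b) \<Rightarrow>\<^sub>0 complex) set)"
    unfolding tensor_null_def by (rule complex_vector.span_base) blast
  then show "Poly_Mapping.single (a + a', b) 1 - (Poly_Mapping.single (a, b) 1 + Poly_Mapping.single (a', b) 1)
    \<in> (tensor_null :: (('a \<times> 'b) \<Rightarrow>\<^sub>0 complex) set)"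
    by (simp add: diff_diff_eq)
qed

lemma pure_tensor_add_right: "a \<otimes>\<^sub>t (b + b') = a \<otimes>\<^sub>t b + a \<otimes>\<^sub>t b'"
proof transfer
  fix a :: 'a and b b' :: 'b
  have "Poly_Mapping.single (a, b + b') 1 - Poly_Mapping.single (a, b) 1 - Poly_Mapping.single (a, b') 1
    \<in> (tensor_null :: (('a \<times> 'b) \<Rightarrow>\<^sub>0 complex) set)"
    unfolding tensor_null_def by (rule complex_vector.span_base) blast
  then show "Poly_Mapping.single (a, b + b') 1 - (Poly_Mapping.single (a, b) 1 + Poly_Mapping.single (a, b') 1)
    \<in> (tensor_null :: (('a \<times> 'b) \<Rightarrow>\<^sub>0 complex) set)"
    by (simp add: diff_diff_eq)
qed

lemma pure_tensor_scale_left: "(c *\<^sub>C a) \<otimes>\<^sub>t b = c *\<^sub>C (a \<otimes>\<^sub>t b)"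
  by transfer (unfold tensor_null_def, rule complex_vector.span_base, blast)

lemma pure_tensor_scale_right: "a \<otimes>\<^sub>t (c *\<^sub>C b) = c *\<^sub>C (a \<otimes>\<^sub>t b)"
  by transfer (unfold tensor_null_def, rule complex_vector.span_base, blast)

lemma bilinear_pure_tensor: "bilinear_on A B (\<otimes>\<^sub>t)"
  by (rule bilinear_onI)
    (simp_all add: pure_tensor_add_left pure_tensor_add_right pure_tensor_scale_left pure_tensor_scale_right)

lemma pure_in_tensor_space: "a \<in> A \<Longrightarrow> b \<in> B \<Longrightarrow> a \<otimes>\<^sub>t b \<in> tensor_space A B"
  unfolding tensor_space_def by (rule complex_vector.span_base) blast

lemma subspace_tensor_space: "complex_vector.subspace (tensor_space A B)"
  unfolding tensor_space_def by (rule complex_vector.subspace_span)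

text \<open>Scalars are absorbed into the left factor, which stays in the subspace \<open>A\<close>;
  hence the three cases suffice.\<close>

lemma tensor_space_induct [consumes 2, case_names zero pure add]:
  assumes "t \<in> tensor_space A B" and A: "complex_vector.subspace A"
    and "P 0" and pure: "\<And>a b. a \<in> A \<Longrightarrow> b \<in> B \<Longrightarrow> P (a \<otimes>\<^sub>t b)"
    and add: "\<And>s t. s \<in> tensor_space A B \<Longrightarrow> t \<in> tensor_space A B \<Longrightarrow> P s \<Longrightarrow> P t \<Longrightarrow> P (s + t)"
  shows "P t"
proof -
  have "t \<in> complex_vector.span {a \<otimes>\<^sub>t b | a b. a \<in> A \<and> b \<in> B}"
    using assms(1) by (simp add: tensor_space_def)
  then have "t \<in> tensor_space A B \<and> P t"
  proof (induction rule: complex_vector.span_induct_alt)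
    case base
    then show ?case using assms(3) complex_vector.subspace_0[OF subspace_tensor_space] by blast
  next
    case (step c x y)
    then obtain a b where x: "x = a \<otimes>\<^sub>t b" "a \<in> A" "b \<in> B" by blast
    then have "c *\<^sub>C x = (c *\<^sub>C a) \<otimes>\<^sub>t b" "c *\<^sub>C a \<in> A"
      by (simp_all add: pure_tensor_scale_left complex_vector.subspace_scale[OF A])
    with step x show ?case
      using pure[of "c *\<^sub>C a" b] add[of "c *\<^sub>C x" y] pure_in_tensor_space[of "c *\<^sub>C a" A b B]
        complex_vector.subspace_add[OF subspace_tensor_space] by metis
  qed
  then show ?thesis by blast
qed

lemma linear_on_tensor_eq:
  assumes A: "complex_vector.subspace A"
    and F: "linear_on (tensor_space A B) F" and G: "linear_on (tensor_space A B) G"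
    and eq: "\<And>a b. a \<in> A \<Longrightarrow> b \<in> B \<Longrightarrow> F (a \<otimes>\<^sub>t b) = G (a \<otimes>\<^sub>t b)" and t: "t \<in> tensor_space A B"
  shows "F t = G t"
  using t A
proof (induction rule: tensor_space_induct)
  case zero
  then show ?case
    by (simp add: linear_on_zero[OF F subspace_tensor_space] linear_on_zero[OF G subspace_tensor_space])
qed (simp_all add: eq linear_on_add[OF F] linear_on_add[OF G])

text \<open>The uniqueness half of the universal property of the tensor product.\<close>

lemma tensor_lift_eq:
  assumes "complex_vector.subspace A" "complex_vector.subspace B" "bilinear_on A B f"
    and "linear_on (tensor_space A B) F" "t \<in> tensor_space A B"
    and "\<And>a b. a \<in> A \<Longrightarrow> b \<in> B \<Longrightarrow> F (a \<otimes>\<^sub>t b) = f a b"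
  shows "F t = tensor_lift A B f t"
  by (rule linear_on_tensor_eq[OF assms(1) assms(4) linear_on_tensor_lift[OF assms(1-3)] _ assms(5)])
    (simp add: tensor_lift_pure[OF assms(1-3)] assms(6))

lemma tensor_lift_cong:
  assumes "complex_vector.subspace A" "complex_vector.subspace B" "bilinear_on A B f"
    and "t \<in> tensor_space A B" and eq: "\<And>a b. a \<in> A \<Longrightarrow> b \<in> B \<Longrightarrow> f a b = g a b"
  shows "tensor_lift A B f t = tensor_lift A B g t"
proof -
  note A = complex_vector.subspace_add[OF assms(1)] complex_vector.subspace_scale[OF assms(1)]
  note B = complex_vector.subspace_add[OF assms(2)] complex_vector.subspace_scale[OF assms(2)]
  \<comment> \<open>\<open>g\<close> agrees with \<open>f\<close> only on \<open>A\<close> and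
    \<open>B\<close>; bilinearity carries over because sums and multiples stay inside these
    subspaces.\<close>
  have g: "bilinear_on A B g"
  proof (rule bilinear_onI)
    fix a a' b assume "a \<in> A" "a' \<in> A" "b \<in> B"
    then show "g (a + a') b = g a b + g a' b"
      using linear_on_add[OF bilinear_on_left[OF assms(3)], of b a a'] eq A(1) by simp
  next
    fix c a b assume "a \<in> A" "b \<in> B"
    then show "g (c *\<^sub>C a) b = c *\<^sub>C g a b" "g a (c *\<^sub>C b) = c *\<^sub>C g a b"
      using linear_on_scale[OF bilinear_on_left[OF assms(3)], of b a c]
        linear_on_scale[OF bilinear_on_right[OF assms(3)], of a b c] eq A(2) B(2) by simp_all
  next
    fix a b b' assume "a \<in> A" "b \<in> B" "b' \<in> B"
    then show "g a (b + b') = g a b + g a b'"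
      using linear_on_add[OF bilinear_on_right[OF assms(3)], of a b b'] eq B(1) by simp
  qed
  show ?thesis
    by (rule tensor_lift_eq[OF assms(1,2) g linear_on_tensor_lift[OF assms(1-3)] assms(4)])
      (simp add: tensor_lift_pure[OF assms(1-3)] eq)
qed

lemma tensor_lift_closed:
  assumes A: "complex_vector.subspace A" and B: "complex_vector.subspace B" and f: "bilinear_on A B f"
    and C: "complex_vector.subspace C" and fC: "\<And>a b. a \<in> A \<Longrightarrow> b \<in> B \<Longrightarrow> f a b \<in> C"
    and t: "t \<in> tensor_space A B"
  shows "tensor_lift A B f t \<in> C"
  using t A
proof (induction rule: tensor_space_induct)
  note lin = linear_on_tensor_lift[OF A B f]
  case zero
  then show ?case
    by (simp add: linear_on_zero[OF lin subspace_tensor_space] complex_vector.subspace_0[OF C])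
  case (add s t)
  then show ?case by (simp add: linear_on_add[OF lin] complex_vector.subspace_add[OF C])
next
  case (pure a b)
  then show ?case by (simp add: tensor_lift_pure[OF A B f] fC)
qed

text \<open>This moves a linear map under a Sweedler sum.\<close>

lemma tensor_lift_compose:
  assumes A: "complex_vector.subspace A" and B: "complex_vector.subspace B" and k: "bilinear_on A B k"
    and "complex_vector.subspace C" and kC: "\<And>a b. a \<in> A \<Longrightarrow> b \<in> B \<Longrightarrow> k a b \<in> C"
    and F: "linear_on C F" and t: "t \<in> tensor_space A B"
  shows "F (tensor_lift A B k t) = tensor_lift A B (\<lambda>a b. F (k a b)) t"
proof (rule tensor_lift_eq[OF A B _ _ t])
  show "bilinear_on A B (\<lambda>a b. F (k a b))" by (rule bilinear_on_compose[OF k F kC])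
  show "linear_on (tensor_space A B) (\<lambda>t. F (tensor_lift A B k t))"
    by (rule linear_on_compose[OF linear_on_tensor_lift[OF A B k] F]) (rule tensor_lift_closed[OF assms(1-5)])
qed (simp add: tensor_lift_pure[OF A B k])

text \<open>In Sweedler notation \<open>right_slice A B f (\<Delta> x)\<close> is \<open>\<Sum> f(x\<^sub>2) x\<^sub>1\<close>.\<close>

definition right_slice :: "'a::complex_vector set \<Rightarrow> 'b::complex_vector set \<Rightarrow> ('b \<Rightarrow> complex) \<Rightarrow>
    ('a, 'b) tensor \<Rightarrow> 'a" where
  "right_slice A B f = tensor_lift A B (\<lambda>a b. f b *\<^sub>C a)"

lemma bilinear_right_slice: "linear_on B f \<Longrightarrow> bilinear_on A B (\<lambda>a b. f b *\<^sub>C a)" for f :: "_ \<Rightarrow> complex"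
  by (rule bilinear_on_scaleC_right[OF linear_on_ident])

text \<open>Slicing with the coordinate functional of \<open>j\<close> extracts the left factor that
  stands before the basis vector \<open>j\<close>. Both sides are linear in \<open>t\<close>, so
  pure tensors suffice.\<close>

lemma tensor_space_decompose:
  assumes A: "complex_vector.subspace A"
    and E: "finite E" "complex_vector.independent E" "complex_vector.span E = B"
    and t: "t \<in> tensor_space A B"
  shows "t = (\<Sum>j\<in>E. right_slice A B (\<lambda>b. complex_vector.representation E b j) t \<otimes>\<^sub>t j)"
proof -
  let ?r = "\<lambda>j b. complex_vector.representation E b j"
  have B: "complex_vector.subspace B" using E(3) complex_vector.subspace_span by blast
  have r: "linear_on B (?r j)" for j
    using E by (auto simp: linear_on_def complex_vector.representation_add complex_vector.representation_scale)
  note bil = bilinear_right_slice[OF r]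
  have lin: "linear_on (tensor_space A B) (right_slice A B (?r j))" for j
    unfolding right_slice_def by (rule linear_on_tensor_lift[OF A B bil])
  have "linear_on (tensor_space A B) (\<lambda>t. \<Sum>j\<in>E. right_slice A B (?r j) t \<otimes>\<^sub>t j)"
    unfolding linear_on_def
    by (simp add: linear_on_add[OF lin] linear_on_scale[OF lin] pure_tensor_add_left pure_tensor_scale_left
        sum.distrib complex_vector.scale_sum_right)
  then show ?thesis
  proof (rule linear_on_tensor_eq[OF A linear_on_ident _ _ t])
    fix a b assume ab: "a \<in> A" "b \<in> B"
    have "(\<Sum>j\<in>E. right_slice A B (?r j) (a \<otimes>\<^sub>t b) \<otimes>\<^sub>t j) = (\<Sum>j\<in>E. a \<otimes>\<^sub>t (?r j b *\<^sub>C j))"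
      using ab by (simp add: right_slice_def tensor_lift_pure[OF A B bil] pure_tensor_scale_left pure_tensor_scale_right)
    also have "\<dots> = a \<otimes>\<^sub>t (\<Sum>j\<in>E. ?r j b *\<^sub>C j)"
      by (rule linear_on_sum[OF bilinear_on_right[OF bilinear_pure_tensor], symmetric, of _ UNIV UNIV])
        (simp_all add: complex_vector.subspace_UNIV)
    also have "(\<Sum>j\<in>E. ?r j b *\<^sub>C j) = b"
      using complex_vector.sum_representation_eq[OF E(2) _ E(1) subset_refl] ab E(3) by simp
    finally show "a \<otimes>\<^sub>t b = (\<Sum>j\<in>E. right_slice A B (?r j) (a \<otimes>\<^sub>t b) \<otimes>\<^sub>t j)" by simp
  qed
qed

lemma finite_dim_basis:
  assumes "finite_dim A"
  obtains E where "finite E" "complex_vector.independent E" "complex_vector.span E = A"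
proof -
  obtain B where B: "finite B" "complex_vector.span B = A" using assms by (auto simp: finite_dim_def)
  obtain E where E: "E \<subseteq> B" "complex_vector.independent E" "B \<subseteq> complex_vector.span E"
    using complex_vector.maximal_independent_subset by blast
  show thesis
  proof
    show "finite E" using E(1) B(1) finite_subset by blast
    show "complex_vector.span E = A"
      using E(1,3) B(2) complex_vector.span_mono complex_vector.span_minimal complex_vector.subspace_span by blast
  qed (rule E(2))
qed

text \<open>Replaces an identity of tensors by identities of vectors, one for each functional. This
  is how values of \<open>comult\<close> are identified below.\<close>

lemma tensor_eqI_right_slice:
  assumes A: "complex_vector.subspace A" and "finite_dim B"
    and st: "s \<in> tensor_space A B" "t \<in> tensor_space A B"
    and eq: "\<And>f. linear_on B f \<Longrightarrow> right_slice A B f s = right_slice A B f t"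
  shows "s = t"
proof -
  obtain E where E: "finite E" "complex_vector.independent E" "complex_vector.span E = B"
    using finite_dim_basis[OF assms(2)] by blast
  have "linear_on B (\<lambda>b. complex_vector.representation E b j)" for j
    using E by (auto simp: linear_on_def complex_vector.representation_add complex_vector.representation_scale)
  from eq[OF this] show ?thesis
    using tensor_space_decompose[OF A E st(1)] tensor_space_decompose[OF A E st(2)] by simp
qed


section \<open>Vertex operator algebras\<close>

text \<open>In each product of the Jacobi identity the exponents are determined by one natural
  number, the binomial index, and truncation bounds that index.\<close>

lemma Sum_any_reindex_nat:
  fixes h :: "nat \<Rightarrow> 'i"
  assumes "inj h" "\<And>x. g x \<noteq> 0 \<Longrightarrow> \<exists>q\<le>N. x = h q"
  shows "Sum_any g = (\<Sum>q\<le>N. g (h q))"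
proof -
  have "Sum_any g = sum g (h ` {..N})"
    by (rule Sum_any.expand_superset) (use assms(2) in auto)
  also have "\<dots> = (\<Sum>q\<le>N. g (h q))"
    by (subst sum.reindex) (use assms(1) in \<open>auto intro: inj_on_subset\<close>)
  finally show ?thesis .
qed

context vertex_operator_algebra
begin

section \<open>The Borcherds identity, skew symmetry and weak commutativity\<close>

lemma linear_mode_right: "linear_on UNIV (mode V u n)"
  using bilinear_mode[of n] by (simp add: bilinear_on_def)

lemma linear_mode_left: "linear_on UNIV (\<lambda>u. mode V u n v)"
  using bilinear_mode[of n] by (simp add: bilinear_on_def)

lemma mode_zero_right [simp]: "mode V u n 0 = 0"
  by (rule linear_on_zero[OF linear_mode_right complex_vector.subspace_UNIV])

lemma mode_zero_left [simp]: "mode V 0 n v = 0"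
  using linear_on_zero[OF linear_mode_left complex_vector.subspace_UNIV] .

lemmas mode_add_right = linear_on_add[OF linear_mode_right UNIV_I UNIV_I]
lemmas mode_scale_right = linear_on_scale[OF linear_mode_right UNIV_I]
lemmas mode_scale_left = linear_on_scale[OF linear_mode_left UNIV_I]
lemmas mode_sum_right = linear_on_sum[OF linear_mode_right complex_vector.subspace_UNIV UNIV_I]
lemmas mode_sum_left = linear_on_sum[OF linear_mode_left complex_vector.subspace_UNIV UNIV_I]

text \<open>The coefficient of the Jacobi identity at exponents -l-1, -m-1, -n-1 of z0, z1, z2. The
  three hypotheses provide a common cutoff \<open>N\<close> for the three sums.\<close>

lemma borcherds_identity:
  fixes l m n :: int
  assumes v: "\<And>q. q > N \<Longrightarrow> mode V v (n + int q) w = 0"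
    and u: "\<And>q. q > N \<Longrightarrow> mode V u (m + int q) w = 0"
    and uv: "\<And>q. q > N \<Longrightarrow> mode V u (l + int q) v = 0"
  shows "(\<Sum>q\<le>N. ((of_int l gchoose q) * (- 1) powi int q) *\<^sub>C mode V u (m + l - int q) (mode V v (n + int q) w)) -
    (\<Sum>q\<le>N. ((of_int l gchoose q) * (- 1) powi (l - int q)) *\<^sub>C mode V v (n + l - int q) (mode V u (m + int q) w)) =
    (\<Sum>q\<le>N. (of_int m gchoose q) *\<^sub>C mode V (mode V u (l + int q) v) (m + n - int q) w)"
proof -
  let ?k = "(- l - 1, - m - 1, - n - 1)"
  have "series3_mult delta_1_minus_2 (Y1_Y2 V u v w) ?k =
    (\<Sum>q\<le>N. ((of_int l gchoose q) * (- 1) powi int q) *\<^sub>C mode V u (m + l - int q) (mode V v (n + int q) w))"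
    unfolding series3_mult_def prod.case
  proof (subst Sum_any_reindex_nat[of "\<lambda>q. (- l - 1, l - int q, int q)" _ N])
    show "inj (\<lambda>q. (- l - 1, l - int q, int q))" by (auto intro: injI)
  next
    fix x assume x: "(case x of (i, j, k) \<Rightarrow>
      delta_1_minus_2 (i, j, k) *\<^sub>C Y1_Y2 V u v w (- l - 1 - i, - m - 1 - j, - n - 1 - k)) \<noteq> 0"
    obtain i j k where ijk: "x = (i, j, k)" by (cases x)
    from x have D: "delta_1_minus_2 (i, j, k) \<noteq> 0"
      and Y: "Y1_Y2 V u v w (- l - 1 - i, - m - 1 - j, - n - 1 - k) \<noteq> 0" by (auto simp: ijk)
    \<comment> \<open>\<open>Y1_Y2\<close> contains no power of z0, so the whole z0-exponent comes
      from the delta function. The other two products are treated alike.\<close>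
    from Y have i: "i = - l - 1" by (auto simp: Y1_Y2_def split: if_splits)
    from D i have k: "k \<ge> 0" "j = l - k" by (auto simp: delta_1_minus_2_def binomial_coeff_def split: if_splits)
    have "nat k \<le> N"
    proof (rule ccontr)
      assume "\<not> nat k \<le> N"
      with v[of "nat k"] k(1) have "mode V v (n + k) w = 0" by simp
      with Y show False by (auto simp: Y1_Y2_def Y_coeff_def algebra_simps split: if_splits)
    qed
    with i k show "\<exists>q\<le>N. x = (- l - 1, l - int q, int q)"
      by (intro exI[of _ "nat k"]) (simp add: ijk)
  qed (rule sum.cong, simp_all add: Y1_Y2_def Y_coeff_def delta_1_minus_2_def binomial_coeff_def algebra_simps)
  moreover have "series3_mult delta_minus_2_plus_1 (Y2_Y1 V u v w) ?k =
    (\<Sum>q\<le>N. ((of_int l gchoose q) * (- 1) powi (l - int q)) *\<^sub>C mode V v (n + l - int q) (mode V u (m + int q) w))"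
    unfolding series3_mult_def prod.case
  proof (subst Sum_any_reindex_nat[of "\<lambda>q. (- l - 1, int q, l - int q)" _ N])
    show "inj (\<lambda>q. (- l - 1, int q, l - int q))" by (auto intro: injI)
  next
    fix x assume x: "(case x of (i, j, k) \<Rightarrow>
      delta_minus_2_plus_1 (i, j, k) *\<^sub>C Y2_Y1 V u v w (- l - 1 - i, - m - 1 - j, - n - 1 - k)) \<noteq> 0"
    obtain i j k where ijk: "x = (i, j, k)" by (cases x)
    from x have D: "delta_minus_2_plus_1 (i, j, k) \<noteq> 0"
      and Y: "Y2_Y1 V u v w (- l - 1 - i, - m - 1 - j, - n - 1 - k) \<noteq> 0" by (auto simp: ijk)
    from Y have i: "i = - l - 1" by (auto simp: Y2_Y1_def split: if_splits)
    from D i have j: "j \<ge> 0" "k = l - j" by (auto simp: delta_minus_2_plus_1_def binomial_coeff_def split: if_splits)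
    have "nat j \<le> N"
    proof (rule ccontr)
      assume "\<not> nat j \<le> N"
      with u[of "nat j"] j(1) have "mode V u (m + j) w = 0" by simp
      with Y show False by (auto simp: Y2_Y1_def Y_coeff_def algebra_simps split: if_splits)
    qed
    with i j show "\<exists>q\<le>N. x = (- l - 1, int q, l - int q)"
      by (intro exI[of _ "nat j"]) (simp add: ijk)
  qed (rule sum.cong, simp_all add: Y2_Y1_def Y_coeff_def delta_minus_2_plus_1_def binomial_coeff_def algebra_simps)
  moreover have "series3_mult delta_2_plus_0 (Y2_Y0 V u v w) ?k =
    (\<Sum>q\<le>N. (of_int m gchoose q) *\<^sub>C mode V (mode V u (l + int q) v) (m + n - int q) w)"
    unfolding series3_mult_def prod.case
  proof (subst Sum_any_reindex_nat[of "\<lambda>q. (int q, - m - 1, m - int q)" _ N])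
    show "inj (\<lambda>q. (int q, - m - 1, m - int q))" by (auto intro: injI)
  next
    fix x assume x: "(case x of (i, j, k) \<Rightarrow>
      delta_2_plus_0 (i, j, k) *\<^sub>C Y2_Y0 V u v w (- l - 1 - i, - m - 1 - j, - n - 1 - k)) \<noteq> 0"
    obtain i j k where ijk: "x = (i, j, k)" by (cases x)
    from x have D: "delta_2_plus_0 (i, j, k) \<noteq> 0"
      and Y: "Y2_Y0 V u v w (- l - 1 - i, - m - 1 - j, - n - 1 - k) \<noteq> 0" by (auto simp: ijk)
    from Y have j: "j = - m - 1" by (auto simp: Y2_Y0_def split: if_splits)
    from D j have i: "i \<ge> 0" "k = m - i" by (auto simp: delta_2_plus_0_def binomial_coeff_def split: if_splits)
    have "nat i \<le> N"
    proof (rule ccontr)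
      assume "\<not> nat i \<le> N"
      with uv[of "nat i"] i(1) have "mode V u (l + i) v = 0" by simp
      with Y show False by (auto simp: Y2_Y0_def Y_coeff_def algebra_simps split: if_splits)
    qed
    with i j show "\<exists>q\<le>N. x = (int q, - m - 1, m - int q)"
      by (intro exI[of _ "nat i"]) (simp add: ijk)
  qed (rule sum.cong, simp_all add: Y2_Y0_def Y_coeff_def delta_2_plus_0_def binomial_coeff_def algebra_simps)
  ultimately show ?thesis using jacobi[of u v w ?k] by simp
qed

lemma truncation_nat:
  "\<exists>N. \<forall>q>N. mode V u (l + int q) v = 0"
proof -
  obtain M where "\<forall>n\<ge>M. mode V u n v = 0" using truncation by blast
  then show ?thesis by (intro exI[of _ "nat (M - l)"]) auto
qed

text \<open>The Borcherds identity at w = vacuum, m = -1, n = 0: creation kills the first sum and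
  leaves only q = 0 in the second. Since mode -1-q of y sends the vacuum to L(-1)^q y / q!, the
  right side is the corresponding coefficient of e^(zL(-1)) Y(u,-z)v. Writing the exponential
  through modes on the vacuum avoids powers of L(-1).\<close>

lemma skew_symmetry:
  assumes "\<And>q. q > N \<Longrightarrow> mode V u (l + int q) v = 0"
  shows "mode V v l u = (- ((- 1) powi l)) *\<^sub>C
    (\<Sum>q\<le>N. (- 1 gchoose q) *\<^sub>C mode V (mode V u (l + int q) v) (- 1 - int q) (vacuum V))"
    (is "_ = _ *\<^sub>C ?R")
proof -
  have v: "mode V v (0 + int q) (vacuum V) = 0" for q
    using creation(1) by simp
  have u: "mode V u (- 1 + int q) (vacuum V) = (if q = 0 then u else 0)" for q
    using creation by (cases q) simp_all
  have R: "- (((- 1) powi l) *\<^sub>C mode V v l u) = ?R"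
    using borcherds_identity[of N v 0 "vacuum V" u "- 1" l, OF v _ assms, unfolded u v]
    by (simp add: if_distrib[of "mode V _ _"] if_distrib[of "scaleC _"] cong: if_cong)
  moreover have "((- 1) powi l * (- 1) powi l :: complex) = 1"
    by (simp flip: power_int_mult_distrib)
  ultimately show ?thesis
    by (simp add: scaleC_scaleC scaleC_one flip: R)
qed

text \<open>The derivative property on the vacuum: one step towards the formula L(-1)^q y / q!, and
  the induction step of the next two lemmas.\<close>

lemma mode_vacuum_Suc:
  "mode V y (- 1 - int (Suc q)) (vacuum V) =
     (1 / of_nat (Suc q)) *\<^sub>C mode V (virasoro V (- 1) y) (- 1 - int q) (vacuum V)"
proof -
  have "mode V (virasoro V (- 1) y) (- 1 - int q) (vacuum V) =
      of_nat (Suc q) *\<^sub>C mode V y (- 1 - int (Suc q)) (vacuum V)"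
    using derivative[of y "- 1 - int q" "vacuum V"] by (simp add: algebra_simps)
  then show ?thesis by (simp add: scaleC_scaleC scaleC_one del: of_nat_Suc)
qed

lemma mode_vacuum_closed:
  assumes "complex_vector.subspace I" "\<And>y. y \<in> I \<Longrightarrow> virasoro V (- 1) y \<in> I"
  shows "y \<in> I \<Longrightarrow> mode V y (- 1 - int q) (vacuum V) \<in> I"
proof (induction q arbitrary: y)
  case 0
  then show ?case using creation(2) by simp
next
  case (Suc q)
  then show ?case unfolding mode_vacuum_Suc
    by (intro complex_vector.subspace_scale[OF assms(1)] Suc.IH assms(2))
qed

lemma mode_vacuum_commute:
  assumes "linear_on UNIV \<phi>" "\<And>y. \<phi> (virasoro V (- 1) y) = virasoro V (- 1) (\<phi> y)"
  shows "\<phi> (mode V y (- 1 - int q) (vacuum V)) = mode V (\<phi> y) (- 1 - int q) (vacuum V)"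
proof (induction q arbitrary: y)
  case 0
  then show ?case using creation(2) by simp
next
  case (Suc q)
  then show ?case unfolding mode_vacuum_Suc
    by (simp add: linear_on_scale[OF assms(1)] assms(2))
qed

text \<open>By skew symmetry \<open>mode V v l u\<close> is a combination of modes of vectors
  \<open>mode V u (l + int q) v\<close> in \<open>I\<close>, applied to the vacuum. These stay in
  \<open>I\<close>, which is stable under L(-1), itself a mode of the conformal vector.\<close>

lemma left_ideal_imp_ideal:
  assumes I: "complex_vector.subspace I" and left: "\<And>u n v. v \<in> I \<Longrightarrow> mode V u n v \<in> I"
  shows "voa_ideal V I"
proof -
  have "mode V v l u \<in> I" if "v \<in> I" for u l v
  proof -
    obtain N where N: "\<And>q. q > N \<Longrightarrow> mode V u (l + int q) v = 0"
      using truncation_nat by blast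
    have *: "mode V (mode V u (l + int q) v) (- 1 - int q) (vacuum V) \<in> I" for q
      using left that by (intro mode_vacuum_closed[OF I]) (simp_all add: virasoro_def)
    show ?thesis
      by (subst skew_symmetry[of N u l v], rule N, assumption)
        (intro complex_vector.subspace_scale[OF I] complex_vector.subspace_sum[OF I] *)
  qed
  with assms show ?thesis by (simp add: voa_ideal_def)
qed

text \<open>At l = N the iterate side of the Borcherds identity vanishes; what remains says that (z1
  - z2)^N annihilates the commutator. The binomial coefficients vanish beyond N, so the range of
  summation does not depend on \<open>w\<close>.\<close>

lemma weak_commutativity:
  assumes "\<And>q. mode V u (int N + int q) v = 0"
  shows "(\<Sum>q\<le>N. ((of_nat N gchoose q) * (- 1) powi int q) *\<^sub>C mode V u (m + int N - int q) (mode V v (n + int q) w)) =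
    (\<Sum>q\<le>N. ((of_nat N gchoose q) * (- 1) powi (int N - int q)) *\<^sub>C
       mode V v (n + int N - int q) (mode V u (m + int q) w))"
proof -
  obtain N1 where N1: "\<And>q. q > N1 \<Longrightarrow> mode V v (n + int q) w = 0"
    using truncation_nat by blast
  obtain N2 where N2: "\<And>q. q > N2 \<Longrightarrow> mode V u (m + int q) w = 0"
    using truncation_nat by blast
  let ?M = "max N (max N1 N2)"
  have choose: "(of_nat N gchoose q :: complex) = 0" if "q > N" for q
    using that by (simp flip: binomial_gbinomial)
  have "(\<Sum>q\<le>?M. ((of_nat N gchoose q) * (- 1) powi int q) *\<^sub>C mode V u (m + int N - int q) (mode V v (n + int q) w)) =
    (\<Sum>q\<le>?M. ((of_nat N gchoose q) * (- 1) powi (int N - int q)) *\<^sub>C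
       mode V v (n + int N - int q) (mode V u (m + int q) w))"
    using borcherds_identity[of ?M v n w u m "int N"] N1 N2 assms by simp
  moreover have "(\<Sum>q\<le>N. ((of_nat N gchoose q) * c q) *\<^sub>C f q) = (\<Sum>q\<le>?M. ((of_nat N gchoose q) * c q) *\<^sub>C f q)"
    for c :: "nat \<Rightarrow> complex" and f :: "nat \<Rightarrow> 'v"
    by (rule sum.mono_neutral_left) (auto simp: choose)
  ultimately show ?thesis by simp
qed

text \<open>Weak commutativity makes \<open>(z\<^sub>1 - z\<^sub>2)\<^bsup>N\<^esup>\<close> annihilate the series \<open>\<Sum>k. Y(u\<^sub>k,z\<^sub>2)Y(x,z\<^sub>1)w\<^sub>k\<close>,
  which is bounded below in \<open>z\<^sub>1\<close>; hence the series is zero.\<close>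

lemma annihilator_mode:
  assumes "finite K" and zero: "\<And>n. (\<Sum>k\<in>K. mode V (u k) n (w k)) = 0"
  shows "(\<Sum>k\<in>K. mode V (u k) n (mode V x m (w k))) = 0"
proof -
  have "\<exists>N. \<forall>k\<in>K. \<forall>q. mode V x (int N + int q) (u k) = 0"
  proof -
    have "\<forall>k\<in>K. \<exists>N. \<forall>q. q \<ge> N \<longrightarrow> mode V x (int q) (u k) = 0"
    proof
      fix k
      obtain N where "\<forall>q>N. mode V x (0 + int q) (u k) = 0" using truncation_nat by blast
      then show "\<exists>N. \<forall>q. q \<ge> N \<longrightarrow> mode V x (int q) (u k) = 0" by (intro exI[of _ "Suc N"]) auto
    qed
    from bchoice[OF this]
    obtain N where N: "\<forall>k\<in>K. \<forall>q. q \<ge> N k \<longrightarrow> mode V x (int q) (u k) = 0" ..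
    have "mode V x (int (sum N K) + int q) (u k) = 0" if "k \<in> K" for k q
      using N[rule_format, OF that, of "sum N K + q"] member_le_sum[OF that, of N] assms(1) by simp
    then show ?thesis by blast
  qed
  then obtain N where N: "\<And>k q. k \<in> K \<Longrightarrow> mode V x (int N + int q) (u k) = 0" by blast
  have "\<exists>M. \<forall>k\<in>K. \<forall>m\<ge>M. mode V x m (w k) = 0"
  proof -
    have "\<forall>k. \<exists>M. \<forall>m\<ge>M. mode V x m (w k) = 0" using truncation by blast
    from choice[OF this] obtain M where M: "\<forall>k. \<forall>m\<ge>M k. mode V x m (w k) = 0" ..
    have "mode V x m (w k) = 0" if "k \<in> K" "m \<ge> (\<Sum>k\<in>K. \<bar>M k\<bar>)" for k m
      using M[rule_format, of k m] member_le_sum[OF that(1), of "\<lambda>k. \<bar>M k\<bar>"] assms(1) that(2) by simp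
    then show ?thesis by blast
  qed
  then obtain M where M: "\<And>k m. k \<in> K \<Longrightarrow> m \<ge> M \<Longrightarrow> mode V x m (w k) = 0" by blast
  define F where "F n m = (\<Sum>k\<in>K. mode V (u k) n (mode V x m (w k)))" for n m
  \<comment> \<open>These are the coefficients of (z1 - z2)^N times the series
    \<open>F\<close>.\<close>
  have rec: "(\<Sum>q\<le>N. ((of_nat N gchoose q) * (- 1) powi (int N - int q)) *\<^sub>C F (n - int q) (m + int q)) = 0" for n m
  proof -
    let ?c = "\<lambda>q. (of_nat N gchoose q) * (- 1) powi (int N - int q) :: complex"
    let ?d = "\<lambda>q. (of_nat N gchoose q) * (- 1) powi int q :: complex"
    have "(\<Sum>q\<le>N. ?c q *\<^sub>C F (n - int q) (m + int q)) =
      (\<Sum>k\<in>K. \<Sum>q\<le>N. ?c q *\<^sub>C mode V (u k) (n - int q) (mode V x (m + int q) (w k)))"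
      unfolding F_def by (subst sum.swap) (simp add: complex_vector.scale_sum_right)
    \<comment> \<open>Weak commutativity moves the modes of \<open>u k\<close> inside, directly
      before \<open>w k\<close>. The hypothesis \<open>zero\<close> then applies for each fixed
      q.\<close>
    also have "\<dots> = (\<Sum>k\<in>K. \<Sum>q\<le>N. ?d q *\<^sub>C mode V x (m + int N - int q) (mode V (u k) (n - int N + int q) (w k)))"
      using weak_commutativity[OF N, of _ m "n - int N"] by simp
    also have "\<dots> = (\<Sum>q\<le>N. ?d q *\<^sub>C mode V x (m + int N - int q) (\<Sum>k\<in>K. mode V (u k) (n - int N + int q) (w k)))"
      by (subst sum.swap) (simp add: complex_vector.scale_sum_right mode_sum_right)
    also have "\<dots> = 0" by (simp add: zero)
    finally show ?thesis .
  qed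
  \<comment> \<open>Descending induction on m from the truncation bound \<open>M\<close>. In
    \<open>rec\<close> the term q = 0 has coefficient (-1)^N, and all other terms have a larger
    second index.\<close>
  have "F n m = 0" if "m \<ge> M - int d" for n m d
    using that
  proof (induction d arbitrary: n m)
    case 0
    then show ?case by (simp add: F_def M)
  next
    case (Suc d)
    have "F (n - int q) (m + int q) = 0" if "q \<noteq> 0" for q
      using that Suc.prems by (intro Suc.IH) simp
    then have "(\<Sum>q\<le>N. ((of_nat N gchoose q) * (- 1) powi (int N - int q)) *\<^sub>C F (n - int q) (m + int q)) =
      (\<Sum>q\<in>{0}. ((of_nat N gchoose q) * (- 1) powi (int N - int q)) *\<^sub>C F (n - int q) (m + int q))"
      by (intro sum.mono_neutral_right) auto
    with rec[of n m] show ?case by simp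
  qed
  from this[of "nat (M - m)" m n] show ?thesis by (simp add: F_def)
qed

text \<open>The unital associative algebra of operators generated by the modes, built by multiplying
  by one mode on the left at a time, the form in which \<open>annihilator_mode\<close> is
  applied.\<close>

inductive_set mode_algebra :: "('v \<Rightarrow> 'v) set" where
  ident: "(\<lambda>v. v) \<in> mode_algebra"
| mode: "a \<in> mode_algebra \<Longrightarrow> (\<lambda>v. mode V u n (a v)) \<in> mode_algebra"
| add: "a \<in> mode_algebra \<Longrightarrow> b \<in> mode_algebra \<Longrightarrow> (\<lambda>v. a v + b v) \<in> mode_algebra"
| scale: "a \<in> mode_algebra \<Longrightarrow> (\<lambda>v. c *\<^sub>C a v) \<in> mode_algebra"

lemma linear_mode_algebra: "a \<in> mode_algebra \<Longrightarrow> linear_on UNIV a"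
proof (induction rule: mode_algebra.induct)
  case (mode a u n)
  then show ?case using linear_on_compose[of UNIV a UNIV "mode V u n"] linear_mode_right by blast
qed (simp_all add: linear_on_def scaleC_add_right scaleC_scaleC mult.commute)

text \<open>The kernel of \<open>u \<otimes> w \<mapsto> Y(u,z)w\<close> is stable under operators
  of the mode algebra acting on the right factor.\<close>

lemma annihilator_mode_algebra:
  assumes "a \<in> mode_algebra" "finite K" "\<And>n. (\<Sum>k\<in>K. mode V (u k) n (w k)) = 0"
  shows "(\<Sum>k\<in>K. mode V (u k) n (a (w k))) = 0"
  using assms(1)
proof (induction arbitrary: n rule: mode_algebra.induct)
  case ident
  then show ?case by (rule assms(3))
next
  case (mode a x m)
  then show ?case by (intro annihilator_mode[OF assms(2)])
next
  case (add a b)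
  then show ?case by (simp add: mode_add_right sum.distrib)
next
  case (scale a c)
  then show ?case by (simp add: mode_scale_right flip: complex_vector.scale_sum_right)
qed

end

section \<open>Schur's lemma, Jacobson density and nondegeneracy for a simple vertex operator
  algebra\<close>

locale simple_voa = vertex_operator_algebra V for V :: "'v::complex_vector vertex_data" +
  assumes simple: "voa_simple V"
begin

lemma left_ideal_eq_UNIV:
  assumes "complex_vector.subspace I" "\<And>u n v. v \<in> I \<Longrightarrow> mode V u n v \<in> I" "x \<in> I" "x \<noteq> 0"
  shows "I = UNIV"
  using left_ideal_imp_ideal[OF assms(1,2)] simple assms(3,4) by (auto simp: voa_simple_def)

lemma nonzero_grade: "\<exists>n. grade V n \<noteq> {0}"
proof (rule ccontr)
  assume "\<not> ?thesis"
  moreover have "v = 0" if g: "\<And>n. grade V n = {0}" for v :: 'v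
  proof -
    obtain f where "\<forall>n. f n \<in> grade V n" "Sum_any f = v" using direct_sum[of v] by blast
    then have "f = (\<lambda>_. 0)" using g by auto
    with \<open>Sum_any f = v\<close> show ?thesis by simp
  qed
  ultimately have "(UNIV :: 'v set) = {0}" by auto
  with simple show False by (simp add: voa_simple_def)
qed

text \<open>Commuting with L(0), \<open>\<phi>\<close> preserves a nonzero finite dimensional
  \<open>grade V n\<close> and has an eigenvector there. The full eigenspace is closed under all
  modes, hence everything by simplicity.\<close>

lemma schur:
  assumes lin: "linear_on UNIV \<phi>" and comm: "\<And>u n v. \<phi> (mode V u n v) = mode V u n (\<phi> v)"
  obtains c where "\<And>v. \<phi> v = c *\<^sub>C v"
proof -
  obtain n where "grade V n \<noteq> {0}" using nonzero_grade by blast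
  then obtain x where x: "x \<in> grade V n" "x \<noteq> 0"
    using complex_vector.subspace_0[OF subspace_grade[of n]] by auto
  obtain B where B: "finite B" "complex_vector.span B = grade V n"
    using finite_dim_grade[of n] by (auto simp: finite_dim_def)
  interpret endomorphism_on "grade V n" \<phi>
  proof
    show "\<phi> v \<in> grade V n" if "v \<in> grade V n" for v
    proof -
      have "virasoro V 0 v = of_int n *\<^sub>C v" using that by (simp add: grade_eq)
      then have "\<phi> (virasoro V 0 v) = of_int n *\<^sub>C \<phi> v" by (simp add: linear_on_scale[OF lin])
      then show ?thesis by (simp add: grade_eq virasoro_def comm)
    qed
  qed (rule subspace_grade linear_on_subset[OF lin subset_UNIV])+
  obtain y c where y: "y \<notin> {0}" "\<phi> y - c *\<^sub>C y \<in> {0}"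
    using eigenvector_modulo[OF x(1), of "{0}" B] x(2) B by auto
  have "{v. \<phi> v = c *\<^sub>C v} = UNIV"
  proof (rule left_ideal_eq_UNIV)
    show "complex_vector.subspace {v. \<phi> v = c *\<^sub>C v}"
      by (rule complex_vector.subspaceI)
        (auto simp: linear_on_zero[OF lin complex_vector.subspace_UNIV] linear_on_add[OF lin] linear_on_scale[OF lin]
          scaleC_add_right scaleC_scaleC mult.commute)
    show "y \<in> {v. \<phi> v = c *\<^sub>C v}" "y \<noteq> 0" using y by auto
  qed (simp add: comm mode_scale_right)
  then show thesis using that by blast
qed

text \<open>Jacobson density: if every \<open>a\<close> that kills \<open>W\<close> and \<open>y\<close> also kills \<open>w\<close>, then \<open>a y \<mapsto> a w\<close> (for \<open>a\<close>
  killing \<open>W\<close>) commutes with all modes and is a scalar \<open>c\<close> by Schur's lemma, so every \<open>a\<close> that kills \<open>W\<close>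
  kills \<open>w - c y\<close>.\<close>

lemma density:
  assumes "finite W" "w \<notin> complex_vector.span W"
  shows "\<exists>a\<in>mode_algebra. a w \<noteq> 0 \<and> (\<forall>x\<in>W. a x = 0)"
  using assms
proof (induction W arbitrary: w rule: finite_induct)
  case empty
  then show ?case using ident by auto
next
  case (insert y W)
  have w: "w \<notin> complex_vector.span W"
    using insert.prems complex_vector.span_mono[of W "insert y W"] by auto
  show ?case
  proof (cases "y \<in> complex_vector.span W")
    case True
    obtain a where a: "a \<in> mode_algebra" "a w \<noteq> 0" "\<forall>x\<in>W. a x = 0" using insert.IH[OF w] by blast
    have "linear_on UNIV (\<lambda>_. 0 :: 'v)" by (simp add: linear_on_def)
    from linear_on_span_eq[OF linear_mode_algebra[OF a(1)] this complex_vector.subspace_UNIV _ _ True] a(3)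
    have "a y = 0" by simp
    with a show ?thesis by auto
  next
    case y: False
    define J where "J = {a \<in> mode_algebra. \<forall>x\<in>W. a x = 0}"
    have J: "(\<lambda>v. mode V u n (a v)) \<in> J" "(\<lambda>v. c *\<^sub>C a v) \<in> J" "b \<in> J \<Longrightarrow> (\<lambda>v. a v + b v) \<in> J"
      if "a \<in> J" for a b u n c
      using that by (auto simp: J_def intro: mode_algebra.intros)
    have lin: "linear_on UNIV a" if "a \<in> J" for a using that linear_mode_algebra by (simp add: J_def)
    obtain a0 where a0: "a0 \<in> J" "a0 y \<noteq> 0" using insert.IH[OF y] by (auto simp: J_def)
    \<comment> \<open>\<open>J\<close> is stable under modes on the left, so its values at
      \<open>y\<close> form a left ideal, nonzero because of \<open>a0\<close>. Hence every vector
      has the form \<open>a y\<close>, and the map a y to a w is defined on all of V.\<close>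
    have "{v. \<exists>a\<in>J. a y = v} = UNIV"
    proof (rule left_ideal_eq_UNIV)
      show "complex_vector.subspace {v. \<exists>a\<in>J. a y = v}"
      proof (rule complex_vector.subspaceI)
        show "0 \<in> {v. \<exists>a\<in>J. a y = v}" using J(2)[OF a0(1), of 0] by force
        show "u + v \<in> {v. \<exists>a\<in>J. a y = v}" if "u \<in> {v. \<exists>a\<in>J. a y = v}" "v \<in> {v. \<exists>a\<in>J. a y = v}" for u v
          using that J(3) by fastforce
        show "c *\<^sub>C u \<in> {v. \<exists>a\<in>J. a y = v}" if "u \<in> {v. \<exists>a\<in>J. a y = v}" for c u
          using that J(2) by fastforce
      qed
      show "mode V u n v \<in> {v. \<exists>a\<in>J. a y = v}" if "v \<in> {v. \<exists>a\<in>J. a y = v}" for u n v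
        using that J(1) by fastforce
      show "a0 y \<in> {v. \<exists>a\<in>J. a y = v}" "a0 y \<noteq> 0" using a0 by auto
    qed
    then have ex: "\<exists>a\<in>J. a y = v" for v by blast
    show ?thesis
    proof (rule ccontr)
      assume "\<not> ?thesis"
      then have kill: "a w = 0" if "a \<in> J" "a y = 0" for a
        using that by (auto simp: J_def)
      define \<phi> where "\<phi> v = (SOME a. a \<in> J \<and> a y = v) w" for v
      have \<phi>: "\<phi> (a y) = a w" if a: "a \<in> J" for a
      proof -
        define b where "b = (SOME b. b \<in> J \<and> b y = a y)"
        have b: "b \<in> J" "b y = a y"
          using someI[of "\<lambda>b. b \<in> J \<and> b y = a y" a] a by (auto simp: b_def)
        have "(\<lambda>v. b v + (- 1) *\<^sub>C a v) \<in> J" using J(2,3) a b(1) by blast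
        from kill[OF this] b(2) have "b w = a w"
          by (simp add: scaleC_one)
        then show ?thesis by (simp add: \<phi>_def b_def)
      qed
      have "linear_on UNIV \<phi>"
        unfolding linear_on_def
      proof (intro conjI ballI allI)
        fix u v
        obtain a b where ab: "a \<in> J" "b \<in> J" "a y = u" "b y = v" using ex by metis
        with \<phi>[OF J(3)[OF ab(1,2)]] show "\<phi> (u + v) = \<phi> u + \<phi> v" using \<phi> by auto
      next
        fix c v
        obtain a where a: "a \<in> J" "a y = v" using ex by metis
        with \<phi>[OF J(2)[OF a(1), of c]] show "\<phi> (c *\<^sub>C v) = c *\<^sub>C \<phi> v" using \<phi> by auto
      qed
      moreover have "\<phi> (mode V u n v) = mode V u n (\<phi> v)" for u n v
      proof -
        obtain a where a: "a \<in> J" "a y = v" using ex by metis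
        with \<phi>[OF J(1)[OF a(1), of u n]] show ?thesis using \<phi> by auto
      qed
      ultimately obtain c where c: "\<And>v. \<phi> v = c *\<^sub>C v" using schur by metis
      have "w - c *\<^sub>C y \<notin> complex_vector.span W"
        using insert.prems complex_vector.span_breakdown_eq[of w y W] by blast
      from insert.IH[OF this] obtain a where a: "a \<in> J" "a (w - c *\<^sub>C y) \<noteq> 0" by (auto simp: J_def)
      have "a (w - c *\<^sub>C y) = a w - c *\<^sub>C a y"
        using linear_on_diff[OF lin[OF a(1)] complex_vector.subspace_UNIV] linear_on_scale[OF lin[OF a(1)]] by simp
      with \<phi>[OF a(1)] c[of "a y"] a(2) show False by simp
    qed
  qed
qed

text \<open>In tensor notation: if \<open>\<Sum>k. Y(u\<^sub>k,z)w\<^sub>k = 0\<close>, then \<open>\<Sum>k. u\<^sub>k \<otimes> w\<^sub>k = 0\<close>.\<close>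

lemma nondegeneracy:
  fixes f :: "'v \<Rightarrow> complex"
  assumes K: "finite K" and zero: "\<And>n. (\<Sum>k\<in>K. mode V (u k) n (w k)) = 0" and f: "linear_on UNIV f"
  shows "(\<Sum>k\<in>K. f (w k) *\<^sub>C u k) = 0"
proof -
  \<comment> \<open>The tensor is regrouped so that its right factors are linearly independent: it
    becomes the sum of \<open>U b \<otimes> b\<close> over \<open>b\<close> in
    \<open>B\<close>.\<close>
  have "finite_dim (complex_vector.span (w ` K))" using K by (auto simp: finite_dim_def)
  then obtain B where B: "finite B" "complex_vector.independent B"
    "complex_vector.span B = complex_vector.span (w ` K)" by (rule finite_dim_basis)
  define r where "r k b = complex_vector.representation B (w k) b" for k b
  define U where "U b = (\<Sum>k\<in>K. r k b *\<^sub>C u k)" for b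
  have w: "w k = (\<Sum>b\<in>B. r k b *\<^sub>C b)" if "k \<in> K" for k
    unfolding r_def
    by (rule complex_vector.sum_representation_eq[OF B(2) _ B(1), symmetric])
      (use that complex_vector.span_base[of "w k" "w ` K"] in \<open>auto simp: B(3)\<close>)
  have zeroU: "(\<Sum>b\<in>B. mode V (U b) n b) = 0" for n
  proof -
    have "(\<Sum>b\<in>B. mode V (U b) n b) = (\<Sum>k\<in>K. \<Sum>b\<in>B. r k b *\<^sub>C mode V (u k) n b)"
      by (subst sum.swap) (simp add: U_def mode_sum_left mode_scale_left)
    also have "\<dots> = (\<Sum>k\<in>K. mode V (u k) n (w k))"
      by (rule sum.cong[OF refl], subst w) (simp_all add: mode_sum_right mode_scale_right)
    finally show ?thesis by (simp add: zero)
  qed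
  have U: "U b = 0" if b: "b \<in> B" for b
  proof -
    have "b \<notin> complex_vector.span (B - {b})"
      using B(2) b by (simp add: complex_vector.dependent_def)
    then obtain a where a: "a \<in> mode_algebra" "a b \<noteq> 0" "\<forall>x\<in>B - {b}. a x = 0"
      using density[of "B - {b}" b] B(1) by blast
    \<comment> \<open>The density operator \<open>a\<close> kills every basis vector except
      \<open>b\<close>, isolating one term of the sum.\<close>
    have ab: "mode V (U b) n (a b) = 0" for n
    proof -
      have "(\<Sum>x\<in>B. mode V (U x) n (a x)) = (\<Sum>x\<in>{b}. mode V (U x) n (a x))"
        using a(3) b B(1) by (intro sum.mono_neutral_right) auto
      then show ?thesis using annihilator_mode_algebra[OF a(1) B(1) zeroU, of n] by simp
    qed
    \<comment> \<open>The vectors killed by all modes of \<open>U b\<close> form a left ideal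
      containing \<open>a b\<close>. By simplicity it contains the vacuum, from which creation
      recovers \<open>U b\<close>.\<close>
    have "{v. \<forall>n. mode V (U b) n v = 0} = UNIV"
    proof (rule left_ideal_eq_UNIV)
      show "complex_vector.subspace {v. \<forall>n. mode V (U b) n v = 0}"
        by (rule complex_vector.subspaceI) (auto simp: mode_add_right mode_scale_right)
      show "mode V x m v \<in> {v. \<forall>n. mode V (U b) n v = 0}" if "v \<in> {v. \<forall>n. mode V (U b) n v = 0}" for x m v
        using annihilator_mode[of "{()}" "\<lambda>_. U b" "\<lambda>_. v"] that by simp
      show "a b \<in> {v. \<forall>n. mode V (U b) n v = 0}" "a b \<noteq> 0" using ab a(2) by auto
    qed
    then have "mode V (U b) (- 1) (vacuum V) = 0" by blast
    then show ?thesis by (simp add: creation)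
  qed
  have "(\<Sum>k\<in>K. f (w k) *\<^sub>C u k) = (\<Sum>k\<in>K. \<Sum>b\<in>B. (f b * r k b) *\<^sub>C u k)"
  proof (rule sum.cong[OF refl])
    fix k assume "k \<in> K"
    have "f (w k) = (\<Sum>b\<in>B. f b * r k b)"
      using linear_on_sum[OF f complex_vector.subspace_UNIV UNIV_I, of "\<lambda>b. r k b *\<^sub>C b" B] w[OF \<open>k \<in> K\<close>]
      by (simp add: linear_on_scale[OF f] mult.commute)
    then show "f (w k) *\<^sub>C u k = (\<Sum>b\<in>B. (f b * r k b) *\<^sub>C u k)"
      by (simp add: complex_vector.scale_sum_left)
  qed
  also have "\<dots> = (\<Sum>b\<in>B. f b *\<^sub>C U b)"
    by (subst sum.swap) (simp add: U_def complex_vector.scale_sum_right scaleC_scaleC)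
  also have "\<dots> = 0" by (simp add: U)
  finally show ?thesis .
qed

end


section \<open>Hopf algebras\<close>

lemma linear_on_tensor_lift_param:
  assumes A: "complex_vector.subspace A" and B: "complex_vector.subspace B" and C: "complex_vector.subspace C"
    and k: "\<And>c. c \<in> C \<Longrightarrow> bilinear_on A B (k c)"
    and lin: "\<And>a b. a \<in> A \<Longrightarrow> b \<in> B \<Longrightarrow> linear_on C (\<lambda>c. k c a b)"
    and t: "t \<in> tensor_space A B"
  shows "linear_on C (\<lambda>c. tensor_lift A B (k c) t)"
  unfolding linear_on_def
proof (intro conjI ballI allI)
  note l = linear_on_tensor_lift[OF A B k]
  fix c d assume c: "c \<in> C" "d \<in> C"
  note cd = complex_vector.subspace_add[OF C c]
  have "linear_on (tensor_space A B) (\<lambda>t. tensor_lift A B (k c) t + tensor_lift A B (k d) t)"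
    using l[OF c(1)] l[OF c(2)] by (simp add: linear_on_def scaleC_add_right)
  from tensor_lift_eq[OF A B k[OF cd] this t]
  show "tensor_lift A B (k (c + d)) t = tensor_lift A B (k c) t + tensor_lift A B (k d) t"
    using c by (simp add: tensor_lift_pure[OF A B k] linear_on_add[OF lin])
next
  fix r c assume c: "c \<in> C"
  note rc = complex_vector.subspace_scale[OF C c, of r]
  have "linear_on (tensor_space A B) (\<lambda>t. r *\<^sub>C tensor_lift A B (k c) t)"
    using linear_on_tensor_lift[OF A B k[OF c]] by (simp add: linear_on_def scaleC_add_right scaleC_scaleC mult.commute)
  from tensor_lift_eq[OF A B k[OF rc] this t]
  show "tensor_lift A B (k (r *\<^sub>C c)) t = r *\<^sub>C tensor_lift A B (k c) t"
    using c by (simp add: tensor_lift_pure[OF A B k] linear_on_scale[OF lin])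
qed

section \<open>The dual algebra acting on a Hopf algebra, and grouplike elements\<close>

context hopf_algebra
begin

abbreviation A where "A \<equiv> carrier H"

lemmas subspace_tensor_square = subspace_tensor_space[of A A]
lemmas A_add = complex_vector.subspace_add[OF subspace_carrier]
lemmas A_scale = complex_vector.subspace_scale[OF subspace_carrier]
lemmas A_diff = complex_vector.subspace_diff[OF subspace_carrier]
lemmas A_zero = complex_vector.subspace_0[OF subspace_carrier]
lemmas A_sum = complex_vector.subspace_sum[OF subspace_carrier]
lemmas lift_A_pure = tensor_lift_pure[OF subspace_carrier subspace_carrier]
lemmas lift_A_compose = tensor_lift_compose[OF subspace_carrier subspace_carrier]
lemmas lift_A_cong = tensor_lift_cong[OF subspace_carrier subspace_carrier]
lemmas linear_lift_A = linear_on_tensor_lift[OF subspace_carrier subspace_carrier]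

lemma linear_mult_left: "x \<in> A \<Longrightarrow> linear_on A (\<lambda>y. x \<otimes> y)"
  using bilinear_mult by (simp add: bilinear_on_def)

lemma linear_mult_right: "y \<in> A \<Longrightarrow> linear_on A (\<lambda>x. x \<otimes> y)"
  using bilinear_mult by (simp add: bilinear_on_def)

lemma linear_functional_mult: "linear_on A f \<Longrightarrow> x \<in> A \<Longrightarrow> linear_on A (\<lambda>y. f (x \<otimes> y))"
  by (rule linear_on_compose[OF linear_mult_left]) auto

lemma one_nonzero: "\<one> \<noteq> 0"
  using counit_one linear_on_zero[OF linear_counit subspace_carrier] by auto

text \<open>The standard action of the dual algebra on H: \<open>hit f x\<close> is the Sweedler sum
  of f(x2) x1.\<close>

definition hit :: "('a \<Rightarrow> complex) \<Rightarrow> 'a \<Rightarrow> 'a" where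
  "hit f x = right_slice A A f (comult H x)"

lemma linear_right_slice: "linear_on A f \<Longrightarrow> linear_on (tensor_space A A) (right_slice A A f)"
  unfolding right_slice_def by (rule linear_lift_A[OF bilinear_right_slice])

lemma right_slice_pure: "linear_on A f \<Longrightarrow> a \<in> A \<Longrightarrow> b \<in> A \<Longrightarrow> right_slice A A f (a \<otimes>\<^sub>t b) = f b *\<^sub>C a"
  unfolding right_slice_def by (rule lift_A_pure[OF bilinear_right_slice])

lemma right_slice_closed: "linear_on A f \<Longrightarrow> t \<in> tensor_space A A \<Longrightarrow> right_slice A A f t \<in> A"
  unfolding right_slice_def
  by (rule tensor_lift_closed[OF subspace_carrier subspace_carrier bilinear_right_slice subspace_carrier])
    (simp_all add: A_scale)

lemma hit_closed: "linear_on A f \<Longrightarrow> x \<in> A \<Longrightarrow> hit f x \<in> A"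
  unfolding hit_def by (rule right_slice_closed[OF _ comult_closed])

lemma linear_hit: "linear_on A f \<Longrightarrow> linear_on A (hit f)"
  unfolding hit_def by (rule linear_on_compose[OF linear_comult linear_right_slice comult_closed])

lemma hit_cong:
  assumes "linear_on A f" "x \<in> A" "\<And>y. y \<in> A \<Longrightarrow> f y = g y"
  shows "hit f x = hit g x"
  unfolding hit_def right_slice_def
  by (rule lift_A_cong[OF bilinear_right_slice[OF assms(1)] comult_closed[OF assms(2)]]) (simp add: assms(3))

lemma counit_hit:
  assumes f: "linear_on A f" and x: "x \<in> A"
  shows "counit H (hit f x) = f x"
proof -
  have "counit H (hit f x) = tensor_lift A A (\<lambda>a b. counit H (f b *\<^sub>C a)) (comult H x)"
    unfolding hit_def right_slice_def
    by (rule lift_A_compose[OF bilinear_right_slice[OF f] subspace_carrier _ linear_counit comult_closed[OF x]])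
      (rule A_scale)
  also have "\<dots> = tensor_lift A A (\<lambda>a b. f (counit H a *\<^sub>C b)) (comult H x)"
    by (rule lift_A_cong[OF bilinear_on_compose[OF bilinear_right_slice[OF f] linear_counit A_scale] comult_closed[OF x]])
      (simp_all add: linear_on_scale[OF f] linear_on_scale[OF linear_counit])
  also have "\<dots> = f (tensor_lift A A (\<lambda>a b. counit H a *\<^sub>C b) (comult H x))"
    by (rule lift_A_compose[OF bilinear_on_scaleC_left[OF linear_counit linear_on_ident] subspace_carrier _ f comult_closed[OF x], symmetric])
      (rule A_scale)
  finally show ?thesis by (simp add: counit_left x)
qed

text \<open>Coassociativity: both sides are the Sweedler sum of f(x2) g(x3) x1. The functional on
  the right is the convolution product of \<open>f\<close> and \<open>g\<close>, so
  \<open>hit\<close> is a module structure.\<close>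

lemma hit_hit:
  assumes f: "linear_on A f" and g: "linear_on A g" and x: "x \<in> A"
  shows "hit f (hit g x) = hit (\<lambda>y. f (hit g y)) x"
proof -
  let ?S = "tensor_space A A"
  define c where "c s = f (right_slice A A g s)" for s
  have c: "linear_on ?S c"
    unfolding c_def by (rule linear_on_compose[OF linear_right_slice[OF g] f right_slice_closed[OF g]])
  \<comment> \<open>\<open>P\<close> applies f to the second and g to the third factor of a triple
    tensor bracketed to the right; it is evaluated on both sides of coassociativity.\<close>
  define P where "P = tensor_lift A ?S (\<lambda>a s. c s *\<^sub>C a)"
  note bP = bilinear_right_slice[OF c, of A]
  have P: "linear_on (tensor_space A ?S) P"
    unfolding P_def by (rule linear_on_tensor_lift[OF subspace_carrier subspace_tensor_square bP])
  have P_pure: "P (a \<otimes>\<^sub>t s) = c s *\<^sub>C a" if "a \<in> A" "s \<in> ?S" for a s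
    unfolding P_def by (rule tensor_lift_pure[OF subspace_carrier subspace_tensor_square bP that])
  have x': "comult H x \<in> ?S" using x by (rule comult_closed)
  have right: "P (tensor_lift A A (\<lambda>a b. a \<otimes>\<^sub>t comult H b) (comult H x)) = hit (\<lambda>y. f (hit g y)) x"
  proof -
    have b: "bilinear_on A A (\<lambda>a b. a \<otimes>\<^sub>t comult H b)"
      by (rule bilinear_on_compose2[OF bilinear_pure_tensor linear_on_ident linear_comult UNIV_I UNIV_I])
    have "P (tensor_lift A A (\<lambda>a b. a \<otimes>\<^sub>t comult H b) (comult H x)) =
        tensor_lift A A (\<lambda>a b. P (a \<otimes>\<^sub>t comult H b)) (comult H x)"
      by (rule lift_A_compose[OF b subspace_tensor_space _ P x']) (simp add: pure_in_tensor_space comult_closed)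
    also have "\<dots> = tensor_lift A A (\<lambda>a b. f (hit g b) *\<^sub>C a) (comult H x)"
      by (rule lift_A_cong[OF bilinear_on_compose[OF b P] x'])
        (simp_all add: P_pure comult_closed pure_in_tensor_space c_def hit_def)
    finally show ?thesis by (simp add: hit_def right_slice_def)
  qed
  define k where "k b s = tensor_lift A A (\<lambda>a' b'. a' \<otimes>\<^sub>t (b' \<otimes>\<^sub>t b)) s" for b :: 'a and s
  have k0: "bilinear_on A A (\<lambda>a' b'. a' \<otimes>\<^sub>t (b' \<otimes>\<^sub>t b))" for b
    by (rule bilinear_on_compose2[OF bilinear_pure_tensor linear_on_ident bilinear_on_left[OF bilinear_pure_tensor] UNIV_I UNIV_I])
      (rule UNIV_I)
  have k: "bilinear_on ?S A (\<lambda>s b. k b s)"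
    unfolding bilinear_on_def
  proof (intro conjI ballI)
    show "linear_on A (\<lambda>b. k b s)" if "s \<in> ?S" for s
      unfolding k_def
      by (rule linear_on_tensor_lift_param[OF subspace_carrier subspace_carrier subspace_carrier k0 _ that])
        (simp add: linear_on_def pure_tensor_add_right pure_tensor_scale_right)
    show "linear_on ?S (\<lambda>s. k b s)" for b
      unfolding k_def by (rule linear_lift_A[OF k0])
  qed
  have kP: "k b s \<in> tensor_space A ?S" if "b \<in> A" "s \<in> ?S" for b s
    unfolding k_def using that
    by (intro tensor_lift_closed[OF subspace_carrier subspace_carrier k0 subspace_tensor_space] pure_in_tensor_space)
  have Pk: "P (k b s) = g b *\<^sub>C right_slice A A f s" if b: "b \<in> A" and s: "s \<in> ?S" for b s
  proof (rule linear_on_tensor_eq[OF subspace_carrier _ _ _ s])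
    show "linear_on ?S (\<lambda>s. P (k b s))"
      by (rule linear_on_compose[OF bilinear_on_left[OF k b] P kP[OF b]])
    show "linear_on ?S (\<lambda>s. g b *\<^sub>C right_slice A A f s)"
      using linear_right_slice[OF f] by (simp add: linear_on_def scaleC_add_right scaleC_scaleC mult.commute)
    fix a' b' assume ab: "a' \<in> A" "b' \<in> A"
    have "P (k b (a' \<otimes>\<^sub>t b')) = c (b' \<otimes>\<^sub>t b) *\<^sub>C a'"
      using ab b by (simp add: k_def lift_A_pure[OF k0] P_pure pure_in_tensor_space)
    also have "c (b' \<otimes>\<^sub>t b) = g b * f b'"
      using ab b by (simp add: c_def right_slice_pure[OF g] linear_on_scale[OF f])
    finally show "P (k b (a' \<otimes>\<^sub>t b')) = g b *\<^sub>C right_slice A A f (a' \<otimes>\<^sub>t b')"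
      using ab by (simp add: right_slice_pure[OF f] scaleC_scaleC)
  qed
  have left: "P (tensor_assoc A (tensor_lift A A (\<lambda>a b. comult H a \<otimes>\<^sub>t b) (comult H x))) = hit f (hit g x)"
  proof -
    have assoc: "linear_on (tensor_space ?S A) (tensor_assoc A)"
      unfolding tensor_assoc_def k_def[symmetric]
      by (rule linear_on_tensor_lift[OF subspace_tensor_square subspace_carrier k])
    have assoc_pure: "tensor_assoc A (s \<otimes>\<^sub>t b) = k b s" if "s \<in> ?S" "b \<in> A" for s b
      unfolding tensor_assoc_def k_def[symmetric]
      by (rule tensor_lift_pure[OF subspace_tensor_square subspace_carrier k that])
    have b: "bilinear_on A A (\<lambda>a b. comult H a \<otimes>\<^sub>t b)"
      by (rule bilinear_on_compose2[OF bilinear_pure_tensor linear_comult linear_on_ident UNIV_I UNIV_I])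
    have b2: "bilinear_on A A (\<lambda>a b. k b (comult H a))"
      by (rule bilinear_on_compose2[OF k linear_comult linear_on_ident comult_closed])
    have b3: "bilinear_on A A (\<lambda>a b. g b *\<^sub>C a)" by (rule bilinear_right_slice[OF g])
    have "tensor_assoc A (tensor_lift A A (\<lambda>a b. comult H a \<otimes>\<^sub>t b) (comult H x)) =
        tensor_lift A A (\<lambda>a b. tensor_assoc A (comult H a \<otimes>\<^sub>t b)) (comult H x)"
      by (rule lift_A_compose[OF b subspace_tensor_space _ assoc x']) (simp add: pure_in_tensor_space comult_closed)
    also have "\<dots> = tensor_lift A A (\<lambda>a b. k b (comult H a)) (comult H x)"
      by (rule lift_A_cong[OF bilinear_on_compose[OF b assoc] x'])
        (simp_all add: pure_in_tensor_space comult_closed assoc_pure)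
    also have "P \<dots> = tensor_lift A A (\<lambda>a b. P (k b (comult H a))) (comult H x)"
      by (rule lift_A_compose[OF b2 subspace_tensor_space _ P x']) (simp add: kP comult_closed)
    also have "\<dots> = tensor_lift A A (\<lambda>a b. hit f (g b *\<^sub>C a)) (comult H x)"
      by (rule lift_A_cong[OF bilinear_on_compose[OF b2 P] x'])
        (simp_all add: kP comult_closed Pk hit_def linear_on_scale[OF linear_comult]
          linear_on_scale[OF linear_right_slice[OF f]])
    also have "\<dots> = hit f (tensor_lift A A (\<lambda>a b. g b *\<^sub>C a) (comult H x))"
      by (rule lift_A_compose[OF b3 subspace_carrier _ linear_hit[OF f] x', symmetric]) (rule A_scale)
    finally show ?thesis by (simp add: hit_def[of g] right_slice_def)
  qed
  show ?thesis using left right coassoc[OF x] by simp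
qed

lemma bilinear_tensor_mult:
  assumes x: "x \<in> A"
  shows "bilinear_on A A (\<lambda>a b. tensor_lift A A (\<lambda>c d. (a \<otimes> c) \<otimes>\<^sub>t (b \<otimes> d)) (comult H x))"
    and "a \<in> A \<Longrightarrow> b \<in> A \<Longrightarrow> bilinear_on A A (\<lambda>c d. (a \<otimes> c) \<otimes>\<^sub>t (b \<otimes> d))"
proof -
  have b: "bilinear_on A A (\<lambda>c d. (a \<otimes> c) \<otimes>\<^sub>t (b \<otimes> d))" if "a \<in> A" "b \<in> A" for a b
    using that by (intro bilinear_on_compose2[OF bilinear_pure_tensor linear_mult_left linear_mult_left UNIV_I UNIV_I])
  then show "a \<in> A \<Longrightarrow> b \<in> A \<Longrightarrow> bilinear_on A A (\<lambda>c d. (a \<otimes> c) \<otimes>\<^sub>t (b \<otimes> d))" .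
  have l1: "linear_on A (\<lambda>a. (a \<otimes> c) \<otimes>\<^sub>t e)" if "c \<in> A" for c e
    by (rule linear_on_compose[OF linear_mult_right[OF that] bilinear_on_left[OF bilinear_pure_tensor UNIV_I] UNIV_I])
  have l2: "linear_on A (\<lambda>b. e \<otimes>\<^sub>t (b \<otimes> d))" if "d \<in> A" for d e
    by (rule linear_on_compose[OF linear_mult_right[OF that] bilinear_on_right[OF bilinear_pure_tensor UNIV_I] UNIV_I])
  show "bilinear_on A A (\<lambda>a b. tensor_lift A A (\<lambda>c d. (a \<otimes> c) \<otimes>\<^sub>t (b \<otimes> d)) (comult H x))"
    unfolding bilinear_on_def
  proof (intro conjI ballI)
    fix a assume "a \<in> A"
    then show "linear_on A (\<lambda>b. tensor_lift A A (\<lambda>c d. (a \<otimes> c) \<otimes>\<^sub>t (b \<otimes> d)) (comult H x))"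
      by (intro linear_on_tensor_lift_param[OF subspace_carrier subspace_carrier subspace_carrier b _ comult_closed[OF x]] l2)
  next
    fix b' assume "b' \<in> A"
    then show "linear_on A (\<lambda>a. tensor_lift A A (\<lambda>c d. (a \<otimes> c) \<otimes>\<^sub>t (b' \<otimes> d)) (comult H x))"
      by (intro linear_on_tensor_lift_param[OF subspace_carrier subspace_carrier subspace_carrier b _ comult_closed[OF x]] l1)
  qed
qed

lemma linear_tensor_mult: "x \<in> A \<Longrightarrow> linear_on (tensor_space A A) (\<lambda>s. tensor_mult H s (comult H x))"
  unfolding tensor_mult_def Let_def by (rule linear_lift_A[OF bilinear_tensor_mult(1)])

lemma tensor_mult_pure:
  "a \<in> A \<Longrightarrow> b \<in> A \<Longrightarrow> x \<in> A \<Longrightarrow> tensor_mult H (a \<otimes>\<^sub>t b) (comult H x) =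
    tensor_lift A A (\<lambda>c d. (a \<otimes> c) \<otimes>\<^sub>t (b \<otimes> d)) (comult H x)"
  unfolding tensor_mult_def Let_def by (rule lift_A_pure[OF bilinear_tensor_mult(1)])

lemma tensor_mult_pure_closed:
  assumes "a \<in> A" "b \<in> A" "x \<in> A"
  shows "tensor_mult H (a \<otimes>\<^sub>t b) (comult H x) \<in> tensor_space A A"
  unfolding tensor_mult_pure[OF assms]
  by (rule tensor_lift_closed[OF subspace_carrier subspace_carrier bilinear_tensor_mult(2)[OF assms(3,1,2)]
      subspace_tensor_space _ comult_closed[OF assms(3)]])
    (use assms in \<open>simp add: pure_in_tensor_space\<close>)

text \<open>Both sides are the Sweedler sum of f(b x2) a x1. Thus \<open>hit\<close> of a product
  reduces to \<open>hit\<close> of the second factor once the coproduct of the first is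
  known.\<close>

lemma right_slice_tensor_mult_pure:
  assumes a: "a \<in> A" and b: "b \<in> A" and x: "x \<in> A" and f: "linear_on A f"
  shows "right_slice A A f (tensor_mult H (a \<otimes>\<^sub>t b) (comult H x)) = a \<otimes> hit (\<lambda>d. f (b \<otimes> d)) x"
proof -
  note bil = bilinear_tensor_mult(2)[OF x a b]
  note fb = linear_functional_mult[OF f b]
  have "right_slice A A f (tensor_mult H (a \<otimes>\<^sub>t b) (comult H x)) =
      tensor_lift A A (\<lambda>c d. right_slice A A f ((a \<otimes> c) \<otimes>\<^sub>t (b \<otimes> d))) (comult H x)"
    unfolding tensor_mult_pure[OF a b x]
    by (rule lift_A_compose[OF bil subspace_tensor_space _ linear_right_slice[OF f] comult_closed[OF x]])
      (simp add: pure_in_tensor_space a b)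
  also have "\<dots> = tensor_lift A A (\<lambda>c d. a \<otimes> (f (b \<otimes> d) *\<^sub>C c)) (comult H x)"
    by (rule lift_A_cong[OF bilinear_on_compose[OF bil linear_right_slice[OF f]] comult_closed[OF x]])
      (simp_all add: pure_in_tensor_space right_slice_pure[OF f] a b linear_on_scale[OF linear_mult_left])
  also have "\<dots> = a \<otimes> tensor_lift A A (\<lambda>c d. f (b \<otimes> d) *\<^sub>C c) (comult H x)"
    by (rule lift_A_compose[OF bilinear_right_slice[OF fb] subspace_carrier _ linear_mult_left[OF a] comult_closed[OF x], symmetric])
      (rule A_scale)
  finally show ?thesis by (simp add: hit_def right_slice_def)
qed

text \<open>The counit condition excludes the zero vector.\<close>

definition grouplikes :: "'a set" where
  "grouplikes = {g \<in> A. comult H g = g \<otimes>\<^sub>t g \<and> counit H g = 1}"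

lemma grouplikes_subset: "grouplikes \<subseteq> A"
  by (auto simp: grouplikes_def)

lemma grouplikes_carrier: "g \<in> grouplikes \<Longrightarrow> g \<in> A"
  by (simp add: grouplikes_def)

lemma grouplike_hit: "g \<in> grouplikes \<Longrightarrow> linear_on A f \<Longrightarrow> hit f g = f g *\<^sub>C g"
  by (simp add: grouplikes_def hit_def right_slice_pure)

lemma grouplike_one: "\<one> \<in> grouplikes"
  by (simp add: grouplikes_def comult_one counit_one)

lemma grouplike_mult: "g \<in> grouplikes \<Longrightarrow> h \<in> grouplikes \<Longrightarrow> g \<otimes> h \<in> grouplikes"
  using tensor_mult_pure[of g g h] bilinear_tensor_mult(2)[of h g g]
  by (simp add: grouplikes_def comult_mult counit_mult lift_A_pure)

lemma hit_mult_grouplike: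
  assumes "g \<in> grouplikes" "x \<in> A" "linear_on A f"
  shows "hit f (g \<otimes> x) = g \<otimes> hit (\<lambda>d. f (g \<otimes> d)) x"
  using assms right_slice_tensor_mult_pure[of g g x f] by (simp add: grouplikes_def hit_def comult_mult)

lemma antipode_grouplike_left: "g \<in> grouplikes \<Longrightarrow> antipode H g \<otimes> g = \<one>"
  using antipode_left[of g]
    lift_A_pure[OF bilinear_on_compose2[OF bilinear_mult linear_antipode linear_on_ident antipode_closed], of g g]
  by (simp add: grouplikes_def scaleC_one)

end

section \<open>Primitive elements in finite dimension\<close>

locale findim_hopf_algebra = hopf_algebra +
  assumes finite_dim: "finite_dim (carrier H)"
begin

lemma grouplikeI:
  assumes g: "g \<in> A" "counit H g = 1" and hit: "\<And>f. linear_on A f \<Longrightarrow> hit f g = f g *\<^sub>C g"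
  shows "g \<in> grouplikes"
proof -
  have "comult H g = g \<otimes>\<^sub>t g"
    by (rule tensor_eqI_right_slice[OF subspace_carrier finite_dim comult_closed[OF g(1)]])
      (use g hit in \<open>simp_all add: pure_in_tensor_space hit_def[symmetric] right_slice_pure\<close>)
  with g show ?thesis by (simp add: grouplikes_def)
qed

text \<open>\<open>prim\<close> is the sliced form of primitivity: the coproduct of \<open>y\<close>
  is \<open>y \<otimes>\<^sub>t \<one> + \<one> \<otimes>\<^sub>t y\<close>. Multiplying its two
  summands by the coproduct of \<open>x\<close> gives the two terms.\<close>

lemma hit_mult_primitive:
  assumes y: "y \<in> A" and prim: "\<And>f. linear_on A f \<Longrightarrow> hit f y = f \<one> *\<^sub>C y + f y *\<^sub>C \<one>"
    and x: "x \<in> A" and f: "linear_on A f"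
  shows "hit f (y \<otimes> x) = y \<otimes> hit f x + hit (\<lambda>d. f (y \<otimes> d)) x"
proof -
  let ?S = "tensor_space A A"
  have S: "y \<otimes>\<^sub>t \<one> \<in> ?S" "\<one> \<otimes>\<^sub>t y \<in> ?S" using y by (simp_all add: pure_in_tensor_space)
  have "comult H y = y \<otimes>\<^sub>t \<one> + \<one> \<otimes>\<^sub>t y"
  proof (rule tensor_eqI_right_slice[OF subspace_carrier finite_dim comult_closed[OF y]])
    show "y \<otimes>\<^sub>t \<one> + \<one> \<otimes>\<^sub>t y \<in> ?S" by (rule complex_vector.subspace_add[OF subspace_tensor_space S])
    show "right_slice A A f (comult H y) = right_slice A A f (y \<otimes>\<^sub>t \<one> + \<one> \<otimes>\<^sub>t y)" if "linear_on A f" for f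
      using prim[OF that] y
      by (simp add: linear_on_add[OF linear_right_slice[OF that] S] right_slice_pure[OF that] hit_def)
  qed
  then have "hit f (y \<otimes> x) = y \<otimes> hit (\<lambda>d. f (\<one> \<otimes> d)) x + \<one> \<otimes> hit (\<lambda>d. f (y \<otimes> d)) x"
    unfolding hit_def comult_mult[OF y x]
    using linear_on_add[OF linear_tensor_mult[OF x] S]
      linear_on_add[OF linear_right_slice[OF f] tensor_mult_pure_closed tensor_mult_pure_closed]
      right_slice_tensor_mult_pure[OF _ _ x f] y x by (simp add: hit_def)
  moreover have "hit (\<lambda>d. f (\<one> \<otimes> d)) x = hit f x"
    by (rule hit_cong[OF f x, symmetric]) simp
  ultimately show ?thesis
    using hit_closed[OF linear_functional_mult[OF f y] x] by simp
qed

text \<open>For a primitive \<open>y\<close>, \<open>hit f (y\<^sup>n) = f(1) y\<^sup>n + n f(y) y\<^bsup>n-1\<^esup>\<close> up to lower powers of \<open>y\<close>. Applied to the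
  first linear dependence \<open>y\<^sup>n \<in> \<langle>1, \<dots>, y\<^bsup>n-1\<^esup>\<rangle>\<close> and functionals \<open>f\<close> with \<open>f(1) = 0\<close>, this forces
  \<open>n f(y) = 0\<close>; here characteristic zero enters.\<close>

lemma primitive_eq_zero:
  assumes y: "y \<in> A" and prim: "\<And>f. linear_on A f \<Longrightarrow> hit f y = f \<one> *\<^sub>C y + f y *\<^sub>C \<one>"
  shows "y = 0"
proof -
  define p where "p n = y [^] n" for n :: nat
  define W where "W n = complex_vector.span (p ` {..<n})" for n
  have p: "p n \<in> A" "p 0 = \<one>" "p (Suc n) = y \<otimes> p n" for n
    using y nat_pow_Suc2[of y n] by (simp_all add: p_def)
  have W: "complex_vector.subspace (W n)" for n unfolding W_def by (rule complex_vector.subspace_span)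
  have WA: "W n \<subseteq> A" for n
    unfolding W_def by (rule complex_vector.span_minimal[OF _ subspace_carrier]) (use p(1) in auto)
  have pW: "p k \<in> W n" if "k < n" for k n
    unfolding W_def by (rule complex_vector.span_base) (use that in auto)
  have W_mono: "W m \<subseteq> W n" if "m \<le> n" for m n
    unfolding W_def by (rule complex_vector.span_mono) (use that in auto)
  have W_induct: "w \<in> U" if "w \<in> W n" "complex_vector.subspace U" "\<And>k. k < n \<Longrightarrow> p k \<in> U" for w n U
    using complex_vector.span_minimal[of "p ` {..<n}" U] that by (auto simp: W_def)
  have yW: "y \<otimes> w \<in> W (Suc n)" if "w \<in> W n" for w n
  proof -
    have "w \<in> {w \<in> A. y \<otimes> w \<in> W (Suc n)}"
    proof (rule W_induct[OF that])
      note l = linear_mult_left[OF y]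
      show "complex_vector.subspace {w \<in> A. y \<otimes> w \<in> W (Suc n)}"
        by (rule complex_vector.subspaceI)
          (auto simp: linear_on_zero[OF l subspace_carrier] linear_on_add[OF l] linear_on_scale[OF l]
            A_zero A_add A_scale complex_vector.subspace_0[OF W] complex_vector.subspace_add[OF W]
            complex_vector.subspace_scale[OF W])
    qed (use p pW in \<open>auto simp flip: p(3)\<close>)
    then show ?thesis by simp
  qed
  \<comment> \<open>In the coproduct of y^(n+1) only y^(n+1) tensor 1 and n+1 times y^n tensor y
    have a left factor of degree at least n. Everything else is sliced into
    \<open>W n\<close>.\<close>
  have key: "hit f (p (Suc n)) - f \<one> *\<^sub>C p (Suc n) - (of_nat (Suc n) * f y) *\<^sub>C p n \<in> W n"
    if "linear_on A f" for f n
    using that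
  proof (induction n arbitrary: f)
    case 0
    then show ?case using prim[OF 0] y by (simp add: p complex_vector.subspace_0[OF W])
  next
    case (Suc n)
    note f = Suc.prems
    let ?f = "\<lambda>d. f (y \<otimes> d)"
    have f': "linear_on A ?f" by (rule linear_functional_mult[OF f y])
    define v where "v = hit f (p (Suc n)) - f \<one> *\<^sub>C p (Suc n) - (of_nat (Suc n) * f y) *\<^sub>C p n"
    define w where "w = hit ?f (p (Suc n)) - ?f \<one> *\<^sub>C p (Suc n) - (of_nat (Suc n) * ?f y) *\<^sub>C p n"
    have v: "v \<in> W n" and w: "w \<in> W n" unfolding v_def w_def by (rule Suc.IH[OF f] Suc.IH[OF f'])+
    have vA: "v \<in> A" using v WA by auto
    have "hit f (p (Suc n)) = f \<one> *\<^sub>C p (Suc n) + (of_nat (Suc n) * f y) *\<^sub>C p n + v"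
      by (simp add: v_def)
    then have "y \<otimes> hit f (p (Suc n)) =
        f \<one> *\<^sub>C p (Suc (Suc n)) + (of_nat (Suc n) * f y) *\<^sub>C p (Suc n) + y \<otimes> v"
      using vA p(1) by (simp only: linear_on_add[OF linear_mult_left[OF y]] linear_on_scale[OF linear_mult_left[OF y]]
          A_add A_scale p(3) m_closed y)
    moreover have "hit ?f (p (Suc n)) = f y *\<^sub>C p (Suc n) + (of_nat (Suc n) * ?f y) *\<^sub>C p n + w"
      using y by (simp add: w_def)
    moreover have "of_nat (Suc (Suc n)) * f y = f y + of_nat (Suc n) * f y"
      by (simp add: algebra_simps)
    ultimately have "hit f (p (Suc (Suc n))) - f \<one> *\<^sub>C p (Suc (Suc n)) - (of_nat (Suc (Suc n)) * f y) *\<^sub>C p (Suc n) =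
      y \<otimes> v + (of_nat (Suc n) * ?f y) *\<^sub>C p n + w"
      using hit_mult_primitive[OF y prim p(1) f, of "Suc n"]
      by (simp add: p(3)[of "Suc n"] scaleC_add_left algebra_simps del: of_nat_Suc)
    also have "\<dots> \<in> W (Suc n)"
      using yW[OF v] pW[of n "Suc n"] w W_mono[of n "Suc n"]
      by (intro complex_vector.subspace_add[OF W] complex_vector.subspace_scale[OF W]) auto
    finally show ?case .
  qed
  \<comment> \<open>For f(1) = 0 the operator \<open>hit f\<close> lowers the filtration
    \<open>W\<close> by one step.\<close>
  have hitW: "hit f w \<in> W n" if f: "linear_on A f" "f \<one> = 0" and w: "w \<in> W (Suc n)" for f :: "'a \<Rightarrow> complex" and w n
  proof -
    note l = linear_hit[OF f(1)]
    have "w \<in> {w \<in> A. hit f w \<in> W n}"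
    proof (rule W_induct[OF w])
      show "complex_vector.subspace {w \<in> A. hit f w \<in> W n}"
        by (rule complex_vector.subspaceI)
          (auto simp: linear_on_zero[OF l subspace_carrier] linear_on_add[OF l] linear_on_scale[OF l]
            A_zero A_add A_scale complex_vector.subspace_0[OF W] complex_vector.subspace_add[OF W]
            complex_vector.subspace_scale[OF W])
      fix k assume k: "k < Suc n"
      have "hit f (p k) \<in> W n"
      proof (cases k)
        case 0
        then show ?thesis
          using grouplike_hit[OF grouplike_one f(1)] by (simp add: p f(2) complex_vector.subspace_0[OF W])
      next
        case (Suc j)
        have "hit f (p (Suc j)) - (of_nat (Suc j) * f y) *\<^sub>C p j \<in> W n"
          using key[OF f(1), of j] W_mono[of j n] k Suc by (auto simp: f(2))
        moreover have "(of_nat (Suc j) * f y) *\<^sub>C p j \<in> W n"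
          using k Suc by (intro complex_vector.subspace_scale[OF W] pW) simp
        ultimately show ?thesis using complex_vector.subspace_add[OF W] Suc by fastforce
      qed
      then show "p k \<in> {w \<in> A. hit f w \<in> W n}" using p(1) by simp
    qed
    then show ?thesis by simp
  qed
  obtain B where B: "finite B" "complex_vector.span B = A" using finite_dim by (auto simp: finite_dim_def)
  then have "\<exists>n. p n \<in> W n"
    unfolding W_def by (intro dependent_sequence[of B]) (simp_all add: p(1))
  then obtain n where n: "p n \<in> W n" "\<And>m. m < n \<Longrightarrow> p m \<notin> W m"
    using exists_least_iff[of "\<lambda>n. p n \<in> W n"] by auto
  have "n \<noteq> 0" using n(1) one_nonzero by (auto simp: W_def p(2) intro: ccontr)
  then obtain m where m: "n = Suc m" using not0_implies_Suc by blast
  have fy: "f y = 0" if f: "linear_on A f" "f \<one> = 0" for f :: "'a \<Rightarrow> complex"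
  proof (rule ccontr)
    assume "f y \<noteq> 0"
    have "hit f (p (Suc m)) \<in> W m"
      using hitW[OF f] n(1) m by simp
    \<comment> \<open>As \<open>p (Suc m)\<close> lies in \<open>W (Suc m)\<close>,
      \<open>hit f\<close> sends it into \<open>W m\<close>. By \<open>key\<close> the vector (m+1)
      f(y) y^m lies there too, against the minimality of n.\<close>
    with key[OF f(1), of m] have "(of_nat (Suc m) * f y) *\<^sub>C p m \<in> W m"
      using complex_vector.subspace_diff[OF W, of "hit f (p (Suc m))" m] f(2) by fastforce
    moreover have "inverse (of_nat (Suc m) * f y) * (of_nat (Suc m) * f y) = 1"
      by (rule left_inverse) (use \<open>f y \<noteq> 0\<close> in \<open>simp del: of_nat_Suc\<close>)
    ultimately have "p m \<in> W m"
      using complex_vector.subspace_scale[OF W, of "(of_nat (Suc m) * f y) *\<^sub>C p m" m "inverse (of_nat (Suc m) * f y)"]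
      by (simp only: scaleC_scaleC scaleC_one)
    with n(2)[of m] m show False by simp
  qed
  \<comment> \<open>By \<open>fy\<close> every functional vanishing at \<open>\<one>\<close>
    vanishes at \<open>y\<close>, which forces proportionality.\<close>
  have "y \<in> complex_vector.span {\<one>}"
  proof (rule ccontr)
    assume not: "y \<notin> complex_vector.span {\<one>}"
    then have "complex_vector.independent {y, \<one>}" "y \<noteq> \<one>"
      using one_nonzero complex_vector.span_base[of "\<one>" "{\<one>}"]
      by (auto simp: complex_vector.independent_insert)
    then show False
    proof (rule_tac functional_extend[of "{y, \<one>}" "\<lambda>x. if x = y then 1 else 0"])
      fix f :: "'a \<Rightarrow> complex"
      assume f: "linear_on UNIV f" "\<And>x. x \<in> {y, \<one>} \<Longrightarrow> f x = (if x = y then 1 else 0)"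
      from fy[OF linear_on_subset[OF f(1) subset_UNIV]] f(2)[of y] f(2)[of "\<one>"] \<open>y \<noteq> \<one>\<close> show False by simp
    qed
  qed
  then obtain c where c: "y = c *\<^sub>C \<one>" by (auto simp: complex_vector.span_singleton)
  have "c = counit H y" by (simp add: c linear_on_scale[OF linear_counit] counit_one)
  \<comment> \<open>\<open>prim\<close> at f = counit, followed by the counit, says that counit(y)
    equals twice itself.\<close>
  also have "\<dots> = 0"
    using counit_hit[OF linear_counit y] prim[OF linear_counit] y
    by (simp add: linear_on_add[OF linear_counit] A_scale linear_on_scale[OF linear_counit] counit_one)
  finally show ?thesis by (simp add: c)
qed

end


section \<open>Cocommutative Hopf algebras\<close>

context findim_hopf_algebra
begin

lemma findim_basis:
  obtains E where "finite E" "complex_vector.independent E" "complex_vector.span E = A"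
  by (rule finite_dim_basis[OF finite_dim])

lemma finite_if_independent:
  assumes "complex_vector.independent D" "D \<subseteq> A"
  shows "finite D"
proof -
  obtain E where E: "finite E" "complex_vector.independent E" "complex_vector.span E = A"
    by (rule findim_basis)
  with assms complex_vector.independent_span_bound[OF E(1) assms(1)] show ?thesis by simp
qed

text \<open>Grouplikes are common eigenvectors of all \<open>hit f\<close>, with pairwise distinct eigencharacters \<open>f \<mapsto> f(g)\<close>.\<close>

lemma independent_grouplikes: "complex_vector.independent grouplikes"
proof -
  obtain B where B: "B \<subseteq> grouplikes" "complex_vector.independent B" "grouplikes \<subseteq> complex_vector.span B"
    by (rule complex_vector.maximal_independent_subset)
  have BA: "B \<subseteq> A" using B(1) grouplikes_subset by blast
  have fin: "finite B" by (rule finite_if_independent[OF B(2) BA])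
  have "g \<in> B" if g: "g \<in> grouplikes" for g
  proof -
    define r where "r = complex_vector.representation B g"
    have g_eq: "(\<Sum>b\<in>B. r b *\<^sub>C b) = g"
      unfolding r_def using complex_vector.sum_representation_eq[OF B(2) _ fin subset_refl] g B(3) by blast
    have "g \<noteq> 0"
      using g linear_on_zero[OF linear_counit subspace_carrier] by (auto simp: grouplikes_def)
    then obtain b where b: "b \<in> B" "r b \<noteq> 0"
      using g_eq by (metis (no_types, lifting) complex_vector.scale_zero_left sum.neutral)
    \<comment> \<open>Applying \<open>hit f\<close> to the expansion of \<open>g\<close> and
      comparing coefficients gives r b (f b - f g) = 0. A basis element with r b nonzero is
      therefore indistinguishable from \<open>g\<close> by functionals.\<close>
    have "f (b - g) = 0" if f: "linear_on UNIV f" for f :: "'a \<Rightarrow> complex"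
    proof -
      have fA: "linear_on A f" using f by (rule linear_on_subset) simp
      have "hit f g = (\<Sum>b\<in>B. hit f (r b *\<^sub>C b))"
        by (subst g_eq[symmetric], rule linear_on_sum[OF linear_hit[OF fA] subspace_carrier])
          (use BA A_scale in auto)
      also have "\<dots> = (\<Sum>b\<in>B. (r b * f b) *\<^sub>C b)"
      proof (rule sum.cong[OF refl])
        fix b assume "b \<in> B"
        with BA B(1) have "b \<in> A" "b \<in> grouplikes" by auto
        then show "hit f (r b *\<^sub>C b) = (r b * f b) *\<^sub>C b"
          by (simp add: linear_on_scale[OF linear_hit[OF fA]] grouplike_hit[OF _ fA] scaleC_scaleC)
      qed
      finally have "(\<Sum>b\<in>B. (r b * f b) *\<^sub>C b) = f g *\<^sub>C (\<Sum>b\<in>B. r b *\<^sub>C b)"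
        using grouplike_hit[OF g fA] g_eq by simp
      then have "(\<Sum>b\<in>B. (r b * f b - f g * r b) *\<^sub>C b) = 0"
        by (simp add: complex_vector.scale_left_diff_distrib sum_subtractf complex_vector.scale_sum_right scaleC_scaleC)
      from complex_vector.independentD[OF B(2) fin subset_refl this b(1)]
      have "r b * f b - f g * r b = 0" .
      with b(2) show ?thesis
        by (simp add: linear_on_diff[OF f complex_vector.subspace_UNIV] algebra_simps)
    qed
    then have "b - g = 0" by (rule eq_zero_if_functionals_zero)
    with b(1) show "g \<in> B" by simp
  qed
  with B(1,2) show ?thesis by (metis subsetI subset_antisym)
qed

lemma finite_grouplikes: "finite grouplikes"
  by (rule finite_if_independent[OF independent_grouplikes grouplikes_subset])

text \<open>Left multiplication by \<open>g\<close> is injective, as the antipode axiom gives a left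
  inverse, and maps the finite set of grouplikes into itself. Being surjective there, it reaches
  \<open>\<one>\<close>, and the grouplike right inverse so obtained must equal the left
  inverse.\<close>

lemma antipode_grouplike:
  assumes g: "g \<in> grouplikes"
  shows "antipode H g \<in> grouplikes" and "g \<otimes> antipode H g = \<one>"
proof -
  have A: "g \<in> A" "antipode H g \<in> A" using g by (simp_all add: grouplikes_def antipode_closed)
  have left: "antipode H g \<otimes> (g \<otimes> x) = x" if "x \<in> A" for x
    using A that antipode_grouplike_left[OF g] by (simp flip: m_assoc)
  have "inj_on ((\<otimes>) g) grouplikes"
    using left grouplikes_subset by (intro inj_on_inverseI[of _ "(\<otimes>) (antipode H g)"]) auto
  moreover have "(\<otimes>) g ` grouplikes \<subseteq> grouplikes" using g grouplike_mult by auto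
  ultimately have "(\<otimes>) g ` grouplikes = grouplikes" by (rule endo_inj_surj[OF finite_grouplikes, rotated])
  then obtain g' where g': "g' \<in> grouplikes" "g \<otimes> g' = \<one>" using grouplike_one by (metis imageE)
  with left[of g'] grouplikes_carrier A have "antipode H g = g'" by simp
  with g' show "antipode H g \<in> grouplikes" "g \<otimes> antipode H g = \<one>" by simp_all
qed

end

text \<open>\<open>f (hit g x)\<close> is the Sweedler sum of f(x1) g(x2), so the axiom tests flip
  invariance of the coproduct on pairs of functionals.\<close>

locale cocommutative_hopf_algebra = findim_hopf_algebra +
  assumes cocommutative: "linear_on (carrier H) f \<Longrightarrow> linear_on (carrier H) g \<Longrightarrow> x \<in> carrier H \<Longrightarrow>
    f (hit g x) = g (hit f x)"
begin

lemma hit_commute: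
  assumes f: "linear_on A f" and g: "linear_on A g" and x: "x \<in> A"
  shows "hit f (hit g x) = hit g (hit f x)"
proof -
  have "hit (\<lambda>y. f (hit g y)) x = hit (\<lambda>y. g (hit f y)) x"
    by (rule hit_cong[OF linear_on_compose[OF linear_hit[OF g] f hit_closed[OF g]] x])
      (simp_all add: cocommutative[OF f g])
  then show ?thesis by (simp add: hit_hit f g x)
qed

text \<open>Modulo the span \<open>C\<close> of the grouplikes, the commuting operators \<open>hit f\<close> would have a common eigenvector
  \<open>x\<close>, so \<open>\<Delta> x = x \<otimes> g + \<Sum>i. i \<otimes> y\<^sub>i\<close> with \<open>i\<close> ranging over the grouplikes. Coassociativity makes \<open>g\<close> grouplike
  and gives \<open>\<Delta> y\<^sub>i = y\<^sub>i \<otimes> g + i \<otimes> y\<^sub>i\<close>. By cocommutativity \<open>y\<^sub>i\<close> is a multiple of \<open>g - i\<close> if \<open>i \<noteq> g\<close>, whereas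
  the inverse of \<open>g\<close> times \<open>y\<^sub>g\<close> is primitive, hence zero. So all \<open>y\<^sub>i\<close> lie in \<open>C\<close>, and so does
  \<open>x = \<epsilon>(x) g + \<Sum>i. y\<^sub>i\<close>.\<close>

lemma span_grouplikes: "complex_vector.span grouplikes = A"
proof (rule ccontr)
  let ?C = "complex_vector.span grouplikes"
  assume neq: "?C \<noteq> A"
  have CA: "?C \<subseteq> A" by (rule complex_vector.span_minimal[OF grouplikes_subset subspace_carrier])
  with neq obtain x0 where x0: "x0 \<in> A" "x0 \<notin> ?C" by blast
  have C: "complex_vector.subspace ?C" by (rule complex_vector.subspace_span)
  obtain E where E: "finite E" "complex_vector.independent E" "complex_vector.span E = A"
    by (rule findim_basis)
  let ?r = "\<lambda>j b. complex_vector.representation E b j"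
  have r: "linear_on A (?r j)" for j
    using E by (auto simp: linear_on_def complex_vector.representation_add complex_vector.representation_scale)
  have hitC: "hit f y \<in> ?C" if f: "linear_on A f" and y: "y \<in> ?C" for f y
  proof -
    note l = linear_hit[OF f]
    have "?C \<subseteq> {y \<in> A. hit f y \<in> ?C}"
    proof (rule complex_vector.span_minimal)
      show "complex_vector.subspace {y \<in> A. hit f y \<in> ?C}"
        by (rule complex_vector.subspaceI)
          (auto simp: linear_on_zero[OF l subspace_carrier] linear_on_add[OF l] linear_on_scale[OF l]
            A_zero A_add A_scale complex_vector.span_zero complex_vector.span_add complex_vector.span_scale)
      show "grouplikes \<subseteq> {y \<in> A. hit f y \<in> ?C}"
        by (auto simp: grouplike_hit[OF _ f] grouplikes_carrier complex_vector.span_scale complex_vector.span_base)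
    qed
    with y show ?thesis by blast
  qed
  have "\<exists>x\<in>A - ?C. \<forall>j\<in>E. \<exists>c. hit (?r j) x - c *\<^sub>C x \<in> ?C"
    by (rule common_eigenvector_modulo[OF E(1) E(1) _ subspace_carrier C x0 linear_hit[OF r] hit_closed[OF r]
          hitC[OF r] hit_commute[OF r r]]) (simp add: E(3))
  then obtain x where x: "x \<in> A" "x \<notin> ?C" and "\<forall>j\<in>E. \<exists>c. hit (?r j) x - c *\<^sub>C x \<in> ?C" by blast
  from bchoice[OF this(3)] obtain c where c: "\<forall>j\<in>E. hit (?r j) x - c j *\<^sub>C x \<in> ?C" ..
  \<comment> \<open>The eigenvector was found for the finitely many coordinate functionals of
    \<open>E\<close>. Every \<open>f\<close> is a combination of them on \<open>A\<close>, and the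
    eigenvalues combine accordingly.\<close>
  have eigen: "\<exists>d. hit f x - d *\<^sub>C x \<in> ?C" if f: "linear_on A f" for f
  proof -
    have "hit f x = right_slice A A f (\<Sum>j\<in>E. hit (?r j) x \<otimes>\<^sub>t j)"
      using tensor_space_decompose[OF subspace_carrier E comult_closed[OF x(1)]] by (simp add: hit_def)
    also have "\<dots> = (\<Sum>j\<in>E. right_slice A A f (hit (?r j) x \<otimes>\<^sub>t j))"
      by (rule linear_on_sum[OF linear_right_slice[OF f] subspace_tensor_space])
        (use E(3) complex_vector.span_base[of _ E] hit_closed[OF r x(1)] in \<open>auto intro: pure_in_tensor_space\<close>)
    also have "\<dots> = (\<Sum>j\<in>E. f j *\<^sub>C hit (?r j) x)"
      using E(3) complex_vector.span_base[of _ E] hit_closed[OF r x(1)]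
      by (intro sum.cong[OF refl]) (simp add: right_slice_pure[OF f])
    finally have "hit f x - (\<Sum>j\<in>E. f j * c j) *\<^sub>C x = (\<Sum>j\<in>E. f j *\<^sub>C (hit (?r j) x - c j *\<^sub>C x))"
      by (simp add: complex_vector.scale_right_diff_distrib sum_subtractf complex_vector.scale_sum_left scaleC_scaleC)
    also have "\<dots> \<in> ?C"
      by (rule complex_vector.span_sum, rule complex_vector.span_scale) (use c in blast)
    finally show ?thesis by blast
  qed
  let ?D = "insert x grouplikes"
  have xG: "x \<notin> grouplikes" using x(2) complex_vector.span_base[of x grouplikes] by blast
  have D: "complex_vector.independent ?D"
    using independent_grouplikes x(2) xG by (simp add: complex_vector.independent_insert)
  have "\<forall>i\<in>?D. \<exists>q. linear_on UNIV q \<and> (\<forall>d\<in>?D. q d = (if d = i then 1 else 0 :: complex))"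
  proof
    fix i
    show "\<exists>q. linear_on UNIV q \<and> (\<forall>d\<in>?D. q d = (if d = i then 1 else 0 :: complex))"
      by (rule functional_extend[OF D, of "\<lambda>d. if d = i then 1 else 0"]) blast
  qed
  from bchoice[OF this] obtain q where
    q: "\<forall>i\<in>?D. linear_on UNIV (q i) \<and> (\<forall>d\<in>?D. q i d = (if d = i then 1 else 0 :: complex))" ..
  have qA: "linear_on A (q i)" if "i \<in> ?D" for i
    by (rule linear_on_subset[OF _ subset_UNIV]) (use q that in blast)
  have qq: "q i d = (if d = i then 1 else 0)" if "i \<in> ?D" "d \<in> ?D" for i d using q that by blast
  \<comment> \<open>The functionals \<open>q\<close> are dual to the independent family consisting
    of \<open>x\<close> and the grouplikes. Applied to the left factor of the expected coproduct of
    \<open>x\<close> they read off g and the y_i; by cocommutativity the right slice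
    \<open>hit\<close> gives the same.\<close>
  define g where "g = hit (q x) x"
  define y where "y i = hit (q i) x" for i
  have gA: "g \<in> A" unfolding g_def by (rule hit_closed[OF qA x(1)]) simp
  have yA: "y i \<in> A" if "i \<in> grouplikes" for i
    unfolding y_def by (rule hit_closed[OF qA x(1)]) (use that in simp)
  note q_sum = linear_on_sum[OF qA subspace_carrier]
  have hit_x: "hit f x = f g *\<^sub>C x + (\<Sum>i\<in>grouplikes. f (y i) *\<^sub>C i)" if f: "linear_on A f" for f
  proof -
    from eigen[OF f] obtain d where d: "hit f x - d *\<^sub>C x \<in> ?C" by blast
    define s where "s = complex_vector.representation grouplikes (hit f x - d *\<^sub>C x)"
    have "(\<Sum>i\<in>grouplikes. s i *\<^sub>C i) = hit f x - d *\<^sub>C x"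
      unfolding s_def
      by (rule complex_vector.sum_representation_eq[OF independent_grouplikes d finite_grouplikes subset_refl])
    then have s: "hit f x = d *\<^sub>C x + (\<Sum>i\<in>grouplikes. s i *\<^sub>C i)" by (simp add: algebra_simps)
    have sA: "s i *\<^sub>C i \<in> A" if "i \<in> grouplikes" for i using that by (simp add: A_scale grouplikes_carrier)
    have q_hit: "q j (hit f x) = d * q j x + (\<Sum>i\<in>grouplikes. s i * q j i)" if j: "j \<in> ?D" for j
    proof -
      have "q j (hit f x) = q j (d *\<^sub>C x) + q j (\<Sum>i\<in>grouplikes. s i *\<^sub>C i)"
        unfolding s by (rule linear_on_add[OF qA[OF j]]) (use x(1) sA in \<open>auto intro: A_scale A_sum\<close>)
      also have "q j (\<Sum>i\<in>grouplikes. s i *\<^sub>C i) = (\<Sum>i\<in>grouplikes. q j (s i *\<^sub>C i))"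
        by (rule q_sum[OF j sA])
      finally show ?thesis
        using x(1) grouplikes_carrier by (simp add: linear_on_scale[OF qA[OF j]])
    qed
    have "f g = q x (hit f x)"
      unfolding g_def by (rule cocommutative[OF f qA x(1)]) simp
    also have "(\<Sum>i\<in>grouplikes. s i * q x i) = 0"
      by (rule sum.neutral) (use xG in \<open>auto simp: qq\<close>)
    then have "q x (hit f x) = d" using q_hit[of x] qq[of x x] by simp
    finally have d_eq: "d = f g" by simp
    have s_eq: "s i = f (y i)" if i: "i \<in> grouplikes" for i
    proof -
      have "f (y i) = q i (hit f x)"
        unfolding y_def by (rule cocommutative[OF f qA x(1)]) (use i in simp)
      also have "\<dots> = (\<Sum>j\<in>grouplikes. s j * q i j)"
        using q_hit[of i] qq[of i x] i xG by auto
      also have "\<dots> = (\<Sum>j\<in>grouplikes. if j = i then s j else 0)"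
        by (rule sum.cong) (use i in \<open>auto simp: qq\<close>)
      finally show ?thesis using i finite_grouplikes by simp
    qed
    show ?thesis unfolding s d_eq by (simp add: s_eq)
  qed
  \<comment> \<open>One computation for both purposes: j = x shows that \<open>g\<close> is
    grouplike, and a grouplike j gives the coproduct of \<open>y j\<close>.\<close>
  have hit_q: "hit f (hit (q j) x) = f g *\<^sub>C hit (q j) x + (\<Sum>i\<in>grouplikes. (f (y i) * q j i) *\<^sub>C i)"
    if f: "linear_on A f" and j: "j \<in> ?D" for f j
  proof -
    note l = linear_hit[OF qA[OF j]]
    have "hit f (hit (q j) x) = hit (q j) (f g *\<^sub>C x + (\<Sum>i\<in>grouplikes. f (y i) *\<^sub>C i))"
      by (simp add: hit_commute[OF f qA[OF j] x(1)] flip: hit_x[OF f])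
    also have "\<dots> = hit (q j) (f g *\<^sub>C x) + hit (q j) (\<Sum>i\<in>grouplikes. f (y i) *\<^sub>C i)"
      by (rule linear_on_add[OF l]) (use x(1) grouplikes_carrier in \<open>auto intro: A_scale A_sum\<close>)
    also have "hit (q j) (\<Sum>i\<in>grouplikes. f (y i) *\<^sub>C i) = (\<Sum>i\<in>grouplikes. hit (q j) (f (y i) *\<^sub>C i))"
      by (rule linear_on_sum[OF l subspace_carrier]) (simp add: A_scale grouplikes_carrier)
    also have "\<dots> = (\<Sum>i\<in>grouplikes. (f (y i) * q j i) *\<^sub>C i)"
      by (rule sum.cong) (simp_all add: linear_on_scale[OF l] grouplikes_carrier grouplike_hit[OF _ qA[OF j]] scaleC_scaleC)
    finally show ?thesis using x(1) by (simp add: linear_on_scale[OF l])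
  qed
  have g: "g \<in> grouplikes"
  proof (rule grouplikeI[OF gA])
    show "counit H g = 1" unfolding g_def by (subst counit_hit[OF qA x(1)]) (simp_all add: qq)
    show "hit f g = f g *\<^sub>C g" if f: "linear_on A f" for f
    proof -
      have "(\<Sum>i\<in>grouplikes. (f (y i) * q x i) *\<^sub>C i) = 0"
        by (rule sum.neutral) (use xG in \<open>auto simp: qq\<close>)
      then show ?thesis using hit_q[OF f, of x] by (simp add: g_def[symmetric])
    qed
  qed
  have hit_y: "hit f (y i) = f g *\<^sub>C y i + f (y i) *\<^sub>C i" if f: "linear_on A f" and i: "i \<in> grouplikes" for f i
  proof -
    have "(\<Sum>j\<in>grouplikes. (f (y j) * q i j) *\<^sub>C j) = (\<Sum>j\<in>grouplikes. if j = i then f (y j) *\<^sub>C j else 0)"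
      by (rule sum.cong) (use i in \<open>auto simp: qq\<close>)
    then show ?thesis
      using hit_q[OF f, of i] i finite_grouplikes by (simp add: y_def[symmetric])
  qed
  have yC: "y i \<in> ?C" if i: "i \<in> grouplikes" for i
  proof (cases "i = g")
    case True
    define g' where "g' = antipode H g"
    have g': "g' \<in> grouplikes" "g' \<otimes> g = \<one>" "g \<otimes> g' = \<one>"
      unfolding g'_def using antipode_grouplike[OF g] antipode_grouplike_left[OF g] by simp_all
    note g'A = grouplikes_carrier[OF g'(1)]
    note yg = yA[OF i, unfolded True]
    have "g' \<otimes> y g = 0"
    proof (rule primitive_eq_zero)
      show "g' \<otimes> y g \<in> A" using yg g'A by simp
      fix f :: "'a \<Rightarrow> complex" assume f: "linear_on A f"
      have "hit f (g' \<otimes> y g) = g' \<otimes> (f \<one> *\<^sub>C y g + f (g' \<otimes> y g) *\<^sub>C g)"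
        using hit_mult_grouplike[OF g'(1) yg f] hit_y[OF linear_functional_mult[OF f g'A] g] g'(2) by simp
      also have "\<dots> = f \<one> *\<^sub>C (g' \<otimes> y g) + f (g' \<otimes> y g) *\<^sub>C (g' \<otimes> g)"
        using yg gA by (simp add: linear_on_add[OF linear_mult_left[OF g'A]] linear_on_scale[OF linear_mult_left[OF g'A]] A_scale)
      finally show "hit f (g' \<otimes> y g) = f \<one> *\<^sub>C (g' \<otimes> y g) + f (g' \<otimes> y g) *\<^sub>C \<one>" by (simp add: g'(2))
    qed
    then have "g \<otimes> (g' \<otimes> y g) = 0" using linear_on_zero[OF linear_mult_left[OF gA] subspace_carrier] by simp
    moreover have "g \<otimes> (g' \<otimes> y g) = y g" using gA g'A yg g'(3) by (simp flip: m_assoc)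
    ultimately show ?thesis using True by (simp add: complex_vector.span_zero)
  next
    case False
    let ?z = "y i - q g (y i) *\<^sub>C (g - i)"
    have iA: "i \<in> A" using i by (rule grouplikes_carrier)
    have "h ?z = 0" if h': "linear_on UNIV h" for h :: "'a \<Rightarrow> complex"
    proof -
      have h: "linear_on A h" by (rule linear_on_subset[OF h' subset_UNIV])
      have f: "linear_on A (q g)" by (rule qA) (use g in simp)
      have *: "k (hit l (y i)) = l g * k (y i) + l (y i) * k i" if "linear_on A k" "linear_on A l" for k l :: "'a \<Rightarrow> complex"
        using that yA[OF i] iA by (simp add: hit_y[OF _ i] linear_on_add[OF that(1)] linear_on_scale[OF that(1)] A_scale)
      \<comment> \<open>Flip symmetry of the coproduct of \<open>y i\<close>, tested on h and
        \<open>q g\<close>. As \<open>q g\<close> is 1 at g and 0 at i, the equation can be solved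
        for h(y i).\<close>
      have "h (y i) + q g (y i) * h i = h g * q g (y i)"
        using cocommutative[OF h f yA[OF i]] *[OF h f] *[OF f h] qq[of g g] qq[of g i] g i False by simp
      then show ?thesis
        unfolding linear_on_diff[OF h' complex_vector.subspace_UNIV UNIV_I UNIV_I] linear_on_scale[OF h' UNIV_I]
        by (simp add: algebra_simps)
    qed
    then have "?z = 0" by (rule eq_zero_if_functionals_zero)
    then have "y i = q g (y i) *\<^sub>C (g - i)" by simp
    moreover have "\<dots> \<in> ?C"
      using g i by (intro complex_vector.span_scale complex_vector.span_diff complex_vector.span_base)
    ultimately show ?thesis by simp
  qed
  let ?w = "counit H x *\<^sub>C g + (\<Sum>i\<in>grouplikes. y i)"
  have "x - ?w = 0"
  proof (rule eq_zero_if_functionals_zero)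
    fix f :: "'a \<Rightarrow> complex" assume f': "linear_on UNIV f"
    have f: "linear_on A f" by (rule linear_on_subset[OF f' subset_UNIV])
    note l = linear_counit
    have mem: "f g *\<^sub>C x \<in> A" "\<And>i. i \<in> grouplikes \<Longrightarrow> f (y i) *\<^sub>C i \<in> A"
      using x(1) by (simp_all add: A_scale grouplikes_carrier)
    have "f x = counit H (f g *\<^sub>C x + (\<Sum>i\<in>grouplikes. f (y i) *\<^sub>C i))"
      by (simp add: counit_hit[OF f x(1)] flip: hit_x[OF f])
    also have "\<dots> = counit H (f g *\<^sub>C x) + counit H (\<Sum>i\<in>grouplikes. f (y i) *\<^sub>C i)"
      by (rule linear_on_add[OF l]) (use mem in \<open>auto intro: A_sum\<close>)
    also have "counit H (\<Sum>i\<in>grouplikes. f (y i) *\<^sub>C i) = (\<Sum>i\<in>grouplikes. counit H (f (y i) *\<^sub>C i))"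
      by (rule linear_on_sum[OF l subspace_carrier mem(2)])
    also have "\<dots> = (\<Sum>i\<in>grouplikes. f (y i))"
      by (rule sum.cong) (simp_all add: linear_on_scale[OF l] grouplikes_def)
    finally have "f x = f g * counit H x + (\<Sum>i\<in>grouplikes. f (y i))"
      using x(1) by (simp add: linear_on_scale[OF l])
    then show "f (x - ?w) = 0"
      by (simp add: linear_on_diff[OF f' complex_vector.subspace_UNIV] linear_on_add[OF f'] linear_on_scale[OF f']
          linear_on_sum[OF f' complex_vector.subspace_UNIV])
  qed
  then have "x = ?w" by simp
  moreover have "?w \<in> ?C"
    by (intro complex_vector.span_add complex_vector.span_scale complex_vector.span_sum yC)
      (rule complex_vector.span_base[OF g])
  ultimately show False using x(2) by simp
qed

section \<open>The isomorphism with the group algebra of the grouplikes\<close>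

definition grouplike_group :: "'a monoid" where
  "grouplike_group = \<lparr>carrier = grouplikes, monoid.mult = (\<otimes>), one = \<one>\<rparr>"

lemma group_grouplike: "group grouplike_group"
proof (rule groupI)
  show "\<exists>h\<in>carrier grouplike_group. h \<otimes>\<^bsub>grouplike_group\<^esub> g = \<one>\<^bsub>grouplike_group\<^esub>"
    if "g \<in> carrier grouplike_group" for g
    using that antipode_grouplike(1)[of g] antipode_grouplike_left[of g] by (auto simp: grouplike_group_def)
qed (auto simp: grouplike_group_def grouplike_one grouplike_mult grouplikes_carrier m_assoc)

lemma inv_grouplike: "g \<in> grouplikes \<Longrightarrow> inv\<^bsub>grouplike_group\<^esub> g = antipode H g"
  by (rule group.inv_equality[OF group_grouplike])
    (simp_all add: grouplike_group_def antipode_grouplike_left antipode_grouplike)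

definition coordinates :: "'a \<Rightarrow> 'a \<Rightarrow>\<^sub>0 complex" where
  "coordinates x = (\<Sum>g\<in>grouplikes. Poly_Mapping.single g (complex_vector.representation grouplikes x g))"

lemma lookup_coordinates: "Poly_Mapping.lookup (coordinates x) g = complex_vector.representation grouplikes x g"
proof -
  have "Poly_Mapping.lookup (coordinates x) g =
      (\<Sum>h\<in>grouplikes. if h = g then complex_vector.representation grouplikes x h else 0)"
    unfolding coordinates_def
    by (simp add: Poly_Mapping.lookup_sum lookup_single when_def)
  also have "\<dots> = (if g \<in> grouplikes then complex_vector.representation grouplikes x g else 0)"
    using finite_grouplikes by simp
  finally show ?thesis using complex_vector.representation_ne_zero[of grouplikes x g] by auto
qed

lemma keys_coordinates: "Poly_Mapping.keys (coordinates x) \<subseteq> grouplikes"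
  using complex_vector.representation_ne_zero[of grouplikes x] by (auto simp: in_keys_iff lookup_coordinates)

lemma linear_coordinates: "linear_on A coordinates"
  unfolding linear_on_def span_grouplikes[symmetric]
  by (auto intro!: poly_mapping_eqI simp: lookup_coordinates lookup_add
      complex_vector.representation_add[OF independent_grouplikes]
      complex_vector.representation_scale[OF independent_grouplikes])

lemma coordinates_grouplike: "g \<in> grouplikes \<Longrightarrow> coordinates g = Poly_Mapping.single g 1"
  by (rule poly_mapping_eqI)
    (auto simp: lookup_coordinates complex_vector.representation_basis[OF independent_grouplikes] lookup_single when_def)

lemma linear_expand:
  assumes F: "linear_on A F" and x: "x \<in> A"
  shows "F x = (\<Sum>g\<in>grouplikes. Poly_Mapping.lookup (coordinates x) g *\<^sub>C F g)"
proof -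
  have "F x = F (\<Sum>g\<in>grouplikes. Poly_Mapping.lookup (coordinates x) g *\<^sub>C g)"
    using complex_vector.sum_representation_eq[OF independent_grouplikes _ finite_grouplikes subset_refl, of x] x
    by (simp add: lookup_coordinates span_grouplikes)
  also have "\<dots> = (\<Sum>g\<in>grouplikes. F (Poly_Mapping.lookup (coordinates x) g *\<^sub>C g))"
    by (rule linear_on_sum[OF F subspace_carrier]) (simp add: A_scale grouplikes_carrier)
  also have "\<dots> = (\<Sum>g\<in>grouplikes. Poly_Mapping.lookup (coordinates x) g *\<^sub>C F g)"
    by (rule sum.cong) (simp_all add: linear_on_scale[OF F] grouplikes_carrier)
  finally show ?thesis .
qed

text \<open>\<open>group_algebra\<close> sums over the support of an element, whereas
  \<open>linear_expand\<close> sums over all grouplikes; the extra terms vanish.\<close>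

lemma sum_keys_coordinates:
  assumes "\<And>g. F g 0 = 0"
  shows "(\<Sum>g\<in>Poly_Mapping.keys (coordinates x). F g (Poly_Mapping.lookup (coordinates x) g)) =
    (\<Sum>g\<in>grouplikes. F g (Poly_Mapping.lookup (coordinates x) g))"
  by (rule sum.mono_neutral_left) (use assms finite_grouplikes keys_coordinates in \<open>auto simp: in_keys_iff\<close>)

lemma single_eq_scaleC: "Poly_Mapping.single k c = c *\<^sub>C Poly_Mapping.single k (1 :: complex)"
  by (rule poly_mapping_eqI) (simp add: lookup_single when_def)

lemma bij_betw_coordinates: "bij_betw coordinates A {p. Poly_Mapping.keys p \<subseteq> grouplikes}"
proof (rule bij_betw_byWitness[where f' = "\<lambda>p. \<Sum>g\<in>grouplikes. Poly_Mapping.lookup p g *\<^sub>C g"])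
  show "\<forall>x\<in>A. (\<Sum>g\<in>grouplikes. Poly_Mapping.lookup (coordinates x) g *\<^sub>C g) = x"
    using linear_expand[OF linear_on_ident] by simp
  have memA: "(\<Sum>g\<in>grouplikes. Poly_Mapping.lookup p g *\<^sub>C g) \<in> A" for p
    by (rule A_sum) (simp add: A_scale grouplikes_carrier)
  then show "(\<lambda>p. \<Sum>g\<in>grouplikes. Poly_Mapping.lookup p g *\<^sub>C g) ` {p. Poly_Mapping.keys p \<subseteq> grouplikes} \<subseteq> A" by auto
  show "coordinates ` A \<subseteq> {p. Poly_Mapping.keys p \<subseteq> grouplikes}" using keys_coordinates by auto
  show "\<forall>p\<in>{p. Poly_Mapping.keys p \<subseteq> grouplikes}. coordinates (\<Sum>g\<in>grouplikes. Poly_Mapping.lookup p g *\<^sub>C g) = p"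
  proof clarify
    fix p :: "'a \<Rightarrow>\<^sub>0 complex" assume p: "Poly_Mapping.keys p \<subseteq> grouplikes"
    have "coordinates (\<Sum>g\<in>grouplikes. Poly_Mapping.lookup p g *\<^sub>C g) =
        (\<Sum>g\<in>grouplikes. coordinates (Poly_Mapping.lookup p g *\<^sub>C g))"
      by (rule linear_on_sum[OF linear_coordinates subspace_carrier]) (simp add: A_scale grouplikes_carrier)
    also have "\<dots> = (\<Sum>g\<in>grouplikes. Poly_Mapping.single g (Poly_Mapping.lookup p g))"
      by (rule sum.cong)
        (simp_all add: linear_on_scale[OF linear_coordinates] grouplikes_carrier coordinates_grouplike flip: single_eq_scaleC)
    also have "\<dots> = p"
    proof (rule poly_mapping_eqI)
      fix k
      show "Poly_Mapping.lookup (\<Sum>g\<in>grouplikes. Poly_Mapping.single g (Poly_Mapping.lookup p g)) k = Poly_Mapping.lookup p k"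
        using p finite_grouplikes
        by (auto simp: Poly_Mapping.lookup_sum lookup_single when_def in_keys_iff)
    qed
    finally show "coordinates (\<Sum>g\<in>grouplikes. Poly_Mapping.lookup p g *\<^sub>C g) = p" .
  qed
qed

text \<open>The compatibility conditions with product, coproduct, counit and antipode are linear in
  each argument, so \<open>linear_expand\<close> reduces them to grouplikes, where they follow from
  the group structure.\<close>

theorem hopf_iso_group_algebra: "hopf_iso H (group_algebra grouplike_group) coordinates"
  unfolding hopf_iso_def
proof (intro conjI ballI)
  let ?l = "\<lambda>x. Poly_Mapping.lookup (coordinates x)"
  show "bij_betw coordinates A (carrier (group_algebra grouplike_group))"
    using bij_betw_coordinates by (simp add: group_algebra_def grouplike_group_def)
  show "linear_on A coordinates" by (rule linear_coordinates)
  show "coordinates \<one> = \<one>\<^bsub>group_algebra grouplike_group\<^esub>"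
    by (simp add: group_algebra_def grouplike_group_def coordinates_grouplike grouplike_one)
  fix x assume x: "x \<in> A"
  show "coordinates (x \<otimes> y) = coordinates x \<otimes>\<^bsub>group_algebra grouplike_group\<^esub> coordinates y" if y: "y \<in> A" for y
  proof -
    have l1: "linear_on A (\<lambda>x. coordinates (x \<otimes> y))"
      by (rule linear_on_compose[OF linear_mult_right[OF y] linear_coordinates]) (use y in simp)
    have l2: "linear_on A (\<lambda>y. coordinates (g \<otimes> y))" if "g \<in> grouplikes" for g
      by (rule linear_on_compose[OF linear_mult_left linear_coordinates]) (use grouplikes_carrier[OF that] in simp_all)
    have "coordinates (x \<otimes> y) = (\<Sum>g\<in>grouplikes. \<Sum>h\<in>grouplikes. Poly_Mapping.single (g \<otimes> h) (?l x g * ?l y h))"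
      unfolding linear_expand[OF l1 x]
    proof (rule sum.cong[OF refl])
      fix g assume g: "g \<in> grouplikes"
      show "?l x g *\<^sub>C coordinates (g \<otimes> y) = (\<Sum>h\<in>grouplikes. Poly_Mapping.single (g \<otimes> h) (?l x g * ?l y h))"
        unfolding linear_expand[OF l2[OF g] y]
        by (subst single_eq_scaleC) (simp add: complex_vector.scale_sum_right scaleC_scaleC coordinates_grouplike grouplike_mult g)
    qed
    also have "\<dots> = (\<Sum>g\<in>Poly_Mapping.keys (coordinates x). \<Sum>h\<in>Poly_Mapping.keys (coordinates y).
        Poly_Mapping.single (g \<otimes> h) (?l x g * ?l y h))"
      by (subst sum_keys_coordinates, simp)+ simp
    finally show ?thesis by (simp add: group_algebra_def grouplike_group_def)
  qed
  let ?b = "\<lambda>a b. coordinates a \<otimes>\<^sub>t coordinates b"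
  have b: "bilinear_on A A ?b"
    by (rule bilinear_on_compose2[OF bilinear_pure_tensor linear_coordinates linear_coordinates UNIV_I UNIV_I])
  show "comult (group_algebra grouplike_group) (coordinates x) = tensor_lift A A ?b (comult H x)"
  proof -
    have "linear_on A (\<lambda>x. tensor_lift A A ?b (comult H x))"
      by (rule linear_on_compose[OF linear_comult linear_lift_A[OF b] comult_closed])
    from linear_expand[OF this x]
    have "tensor_lift A A ?b (comult H x) =
        (\<Sum>g\<in>grouplikes. ?l x g *\<^sub>C (Poly_Mapping.single g 1 \<otimes>\<^sub>t Poly_Mapping.single g 1))"
      by (simp add: grouplikes_def[THEN equalityD1, THEN subsetD, simplified] lift_A_pure[OF b] coordinates_grouplike)
    then show ?thesis
      using sum_keys_coordinates[of "\<lambda>g c. c *\<^sub>C (Poly_Mapping.single g 1 \<otimes>\<^sub>t Poly_Mapping.single g 1)" x]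
      by (simp add: group_algebra_def)
  qed
  show "counit (group_algebra grouplike_group) (coordinates x) = counit H x"
    using linear_expand[OF linear_counit x] sum_keys_coordinates[of "\<lambda>g c. c" x]
    by (simp add: group_algebra_def grouplikes_def)
  show "antipode (group_algebra grouplike_group) (coordinates x) = coordinates (antipode H x)"
  proof -
    have "linear_on A (\<lambda>x. coordinates (antipode H x))"
      by (rule linear_on_compose[OF linear_antipode linear_coordinates antipode_closed])
    from linear_expand[OF this x]
    have "coordinates (antipode H x) = (\<Sum>g\<in>grouplikes. Poly_Mapping.single (antipode H g) (?l x g))"
      by (subst single_eq_scaleC) (simp add: antipode_grouplike coordinates_grouplike)
    also have "\<dots> = (\<Sum>g\<in>grouplikes. Poly_Mapping.single (inv\<^bsub>grouplike_group\<^esub> g) (?l x g))"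
      by (simp add: inv_grouplike)
    also have "\<dots> = antipode (group_algebra grouplike_group) (coordinates x)"
      using sum_keys_coordinates[of "\<lambda>g. Poly_Mapping.single (inv\<^bsub>grouplike_group\<^esub> g)" x]
      by (simp add: group_algebra_def)
    finally show ?thesis by simp
  qed
qed

end


section \<open>Actions on vertex operator algebras\<close>

locale faithful_hopf_voa_action = findim_hopf_algebra H + simple_voa V
  for H :: "'h::complex_vector hopf" (structure) and V :: "'v::complex_vector vertex_data" +
  fixes act :: "'h \<Rightarrow> 'v \<Rightarrow> 'v"
  assumes module_voa: "hopf_module_voa H V act" and faithful: "faithful_action H act"
begin

lemma linear_act_left: "linear_on A (\<lambda>h. act h v)"
  using module_voa by (simp add: hopf_module_voa_def hopf_module_def bilinear_on_def)

lemma linear_act_right: "h \<in> A \<Longrightarrow> linear_on UNIV (act h)"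
  using module_voa by (simp add: hopf_module_voa_def hopf_module_def bilinear_on_def)

lemma act_conformal: "h \<in> A \<Longrightarrow> act h (conformal V) = counit H h *\<^sub>C conformal V"
  using module_voa by (simp add: hopf_module_voa_def)

lemma act_mode: "h \<in> A \<Longrightarrow> act h (mode V u n v) =
    tensor_lift A A (\<lambda>a b. mode V (act a u) n (act b v)) (comult H h)"
  using module_voa by (simp add: hopf_module_voa_def)

lemma bilinear_act_mode: "bilinear_on A A (\<lambda>a b. mode V (act a u) n (act b v))"
  by (rule bilinear_on_compose2[OF bilinear_mode linear_act_left linear_act_left UNIV_I UNIV_I])

lemma act_eq_zero: "h \<in> A \<Longrightarrow> (\<And>v. act h v = 0) \<Longrightarrow> h = 0"
  using faithful by (simp add: faithful_action_def)

text \<open>L(-1) is mode 0 of the conformal vector, on which h1 acts by its counit; the counit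
  axiom then collapses the Sweedler sum to h acting on v.\<close>

lemma act_translation:
  assumes h: "h \<in> A"
  shows "act h (virasoro V (- 1) v) = virasoro V (- 1) (act h v)"
proof -
  let ?T = "mode V (conformal V) 0"
  have lin: "linear_on A (\<lambda>b. ?T (act b v))"
    by (rule linear_on_compose[OF linear_act_left linear_mode_right UNIV_I])
  have "act h (?T v) = tensor_lift A A (\<lambda>a b. ?T (act (counit H a *\<^sub>C b) v)) (comult H h)"
    unfolding act_mode[OF h]
    by (rule lift_A_cong[OF bilinear_act_mode comult_closed[OF h]])
      (simp add: act_conformal mode_scale_left linear_on_scale[OF lin])
  also have "\<dots> = ?T (act (tensor_lift A A (\<lambda>a b. counit H a *\<^sub>C b) (comult H h)) v)"
    by (rule lift_A_compose[OF bilinear_on_scaleC_left[OF linear_counit linear_on_ident] subspace_carrier _ lin comult_closed[OF h], symmetric])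
      (rule A_scale)
  finally show ?thesis by (simp add: virasoro_def counit_left h)
qed

text \<open>By skew symmetry \<open>Y(v,z)u\<close> is determined by \<open>Y(u,-z)v\<close> and \<open>L(-1)\<close>, which commutes with the action.\<close>

lemma act_mode_flip:
  assumes h: "h \<in> A" and p: "Poly_Mapping.keys p \<subseteq> A \<times> A" "abs_tensor p = comult H h"
  shows "(\<Sum>k\<in>Poly_Mapping.keys p. Poly_Mapping.lookup p k *\<^sub>C mode V (act (snd k) v) l (act (fst k) u)) =
    (\<Sum>k\<in>Poly_Mapping.keys p. Poly_Mapping.lookup p k *\<^sub>C mode V (act (fst k) v) l (act (snd k) u))"
proof -
  let ?K = "Poly_Mapping.keys p" and ?c = "Poly_Mapping.lookup p"
  have act_p: "act h (mode V u n v) = (\<Sum>k\<in>?K. ?c k *\<^sub>C mode V (act (fst k) u) n (act (snd k) v))" for u n v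
    using tensor_lift_abs[OF subspace_carrier subspace_carrier bilinear_act_mode p(1)]
    by (simp add: act_mode[OF h] p(2) case_prod_unfold)
  have "\<forall>k. \<exists>N. \<forall>q>N. mode V (act (fst k) u) (l + int q) (act (snd k) v) = 0"
    using truncation_nat by blast
  from choice[OF this] obtain M where
    M: "\<forall>k. \<forall>q>M k. mode V (act (fst k) u) (l + int q) (act (snd k) v) = 0" ..
  obtain M' where M': "\<forall>q>M'. mode V u (l + int q) v = 0" using truncation_nat by blast
  \<comment> \<open>A single cutoff valid for all terms of the Sweedler sum, so that the sums over k
    and q can be exchanged.\<close>
  define N where "N = M' + sum M ?K"
  have N: "mode V (act (fst k) u) (l + int q) (act (snd k) v) = 0" if "k \<in> ?K" "q > N" for k q
    using M member_le_sum[OF that(1), of M] that(2) by (auto simp: N_def)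
  have N': "mode V u (l + int q) v = 0" if "q > N" for q
    using M' that by (simp add: N_def)
  let ?s = "- ((- 1) powi l) :: complex" and ?b = "\<lambda>q. (- 1 gchoose q) :: complex"
  let ?D = "\<lambda>q y. mode V y (- 1 - int q) (vacuum V)"
  note lin = linear_act_right[OF h]
  have "(\<Sum>k\<in>?K. ?c k *\<^sub>C mode V (act (snd k) v) l (act (fst k) u)) =
      (\<Sum>k\<in>?K. ?c k *\<^sub>C ?s *\<^sub>C (\<Sum>q\<le>N. ?b q *\<^sub>C ?D q (mode V (act (fst k) u) (l + int q) (act (snd k) v))))"
    by (rule sum.cong[OF refl], subst skew_symmetry, rule N, assumption+, rule refl)
  \<comment> \<open>After the exchange the inner Sweedler sum is the action of h on one vector,
    which then passes through the modes on the vacuum.\<close>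
  also have "\<dots> = ?s *\<^sub>C (\<Sum>q\<le>N. ?b q *\<^sub>C ?D q (\<Sum>k\<in>?K. ?c k *\<^sub>C mode V (act (fst k) u) (l + int q) (act (snd k) v)))"
    unfolding mode_sum_left mode_scale_left complex_vector.scale_sum_right
    by (subst sum.swap) (simp add: scaleC_scaleC mult_ac)
  also have "\<dots> = ?s *\<^sub>C (\<Sum>q\<le>N. ?b q *\<^sub>C ?D q (act h (mode V u (l + int q) v)))"
    by (simp add: act_p)
  also have "\<dots> = ?s *\<^sub>C (\<Sum>q\<le>N. act h (?b q *\<^sub>C ?D q (mode V u (l + int q) v)))"
    by (simp add: mode_vacuum_commute[OF lin act_translation[OF h]] linear_on_scale[OF lin])
  also have "\<dots> = act h (?s *\<^sub>C (\<Sum>q\<le>N. ?b q *\<^sub>C ?D q (mode V u (l + int q) v)))"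
    by (simp only: linear_on_sum[OF lin complex_vector.subspace_UNIV UNIV_I] linear_on_scale[OF lin UNIV_I])
  also have "\<dots> = act h (mode V v l u)"
    by (subst skew_symmetry[of N u l v]) (simp_all add: N')
  also have "\<dots> = (\<Sum>k\<in>?K. ?c k *\<^sub>C mode V (act (fst k) v) l (act (snd k) u))"
    by (rule act_p)
  finally show ?thesis .
qed

text \<open>\<open>act_mode_flip\<close> and nondegeneracy give an identity in the tensor square of
  V. A functional \<open>\<phi>\<close> on one factor and faithfulness on the other yield an
  identity in H; then \<open>f\<close> is applied and faithfulness is used again for the remaining
  factor.\<close>

lemma right_slice_flip:
  fixes f :: "'h \<Rightarrow> complex"
  assumes h: "h \<in> A" and p: "Poly_Mapping.keys p \<subseteq> A \<times> A" "abs_tensor p = comult H h" and f: "linear_on A f"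
  shows "(\<Sum>k\<in>Poly_Mapping.keys p. (Poly_Mapping.lookup p k * f (fst k)) *\<^sub>C snd k) =
    (\<Sum>k\<in>Poly_Mapping.keys p. (Poly_Mapping.lookup p k * f (snd k)) *\<^sub>C fst k)"
proof -
  let ?K = "Poly_Mapping.keys p" and ?c = "Poly_Mapping.lookup p"
  have pA: "fst k \<in> A" "snd k \<in> A" if "k \<in> ?K" for k using p(1) that by (auto simp: mem_Times_iff)
  have *: "(\<Sum>k\<in>?K. ?c k *\<^sub>C (\<phi> (act (fst k) u) *\<^sub>C snd k - \<phi> (act (snd k) u) *\<^sub>C fst k)) = 0"
    (is "?h = 0") if \<phi>: "linear_on UNIV \<phi>" for \<phi> :: "'v \<Rightarrow> complex" and u
  proof (rule act_eq_zero)
    show "?h \<in> A" by (rule A_sum) (simp add: A_scale A_diff pA)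
    fix v
    \<comment> \<open>The Boolean index writes the difference of the two flipped Sweedler sums as a
      single sum of tensors, as nondegeneracy requires.\<close>
    let ?U = "\<lambda>(k, s). ?c k *\<^sub>C (if s then act (snd k) v else - act (fst k) v)"
    let ?W = "\<lambda>(k, s). if s then act (fst k) u else act (snd k) u"
    have sum_bool: "sum F (?K \<times> UNIV) = (\<Sum>k\<in>?K. F (k, True) + F (k, False))"
      for F :: "('h \<times> 'h) \<times> bool \<Rightarrow> 'v"
      by (simp add: sum.cartesian_product' UNIV_bool add.commute)
    have mode_minus: "mode V (- y) n w = - mode V y n w" for y n w
      using mode_scale_left[of "- 1" y n w] by (simp add: scaleC_one)
    have "(\<Sum>k\<in>?K \<times> UNIV. mode V (?U k) n (?W k)) = 0" for n
      using act_mode_flip[OF h p, of v n u]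
      by (simp add: sum_bool sum_subtractf mode_scale_left mode_minus)
    from nondegeneracy[OF _ this \<phi>]
    have "(\<Sum>k\<in>?K. ?c k *\<^sub>C (\<phi> (act (fst k) u) *\<^sub>C act (snd k) v - \<phi> (act (snd k) u) *\<^sub>C act (fst k) v)) = 0"
      by (simp add: sum_bool complex_vector.scale_right_diff_distrib scaleC_scaleC mult.commute)
    moreover have "act ?h v = (\<Sum>k\<in>?K. act (?c k *\<^sub>C (\<phi> (act (fst k) u) *\<^sub>C snd k - \<phi> (act (snd k) u) *\<^sub>C fst k)) v)"
      by (rule linear_on_sum[OF linear_act_left subspace_carrier]) (simp add: A_scale A_diff pA)
    moreover have "\<dots> = (\<Sum>k\<in>?K. ?c k *\<^sub>C (\<phi> (act (fst k) u) *\<^sub>C act (snd k) v - \<phi> (act (snd k) u) *\<^sub>C act (fst k) v))"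
      by (rule sum.cong[OF refl])
        (simp add: linear_on_scale[OF linear_act_left] linear_on_diff[OF linear_act_left subspace_carrier] A_scale A_diff pA)
    ultimately show "act ?h v = 0" by simp
  qed
  let ?z = "\<Sum>k\<in>?K. ?c k *\<^sub>C (f (snd k) *\<^sub>C fst k - f (fst k) *\<^sub>C snd k)"
  have "?z = 0"
  proof (rule act_eq_zero)
    show "?z \<in> A" by (rule A_sum) (simp add: A_scale A_diff pA)
    fix u
    have act_z: "act ?z u = (\<Sum>k\<in>?K. ?c k *\<^sub>C (f (snd k) *\<^sub>C act (fst k) u - f (fst k) *\<^sub>C act (snd k) u))"
      by (subst linear_on_sum[OF linear_act_left subspace_carrier])
        (simp_all add: linear_on_scale[OF linear_act_left] linear_on_diff[OF linear_act_left subspace_carrier] A_scale A_diff pA)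
    show "act ?z u = 0"
    proof (rule eq_zero_if_functionals_zero)
      fix \<phi> :: "'v \<Rightarrow> complex" assume \<phi>: "linear_on UNIV \<phi>"
      have "\<phi> (act ?z u) = (\<Sum>k\<in>?K. ?c k * (f (snd k) * \<phi> (act (fst k) u) - f (fst k) * \<phi> (act (snd k) u)))"
        unfolding act_z
        by (simp add: linear_on_sum[OF \<phi> complex_vector.subspace_UNIV] linear_on_scale[OF \<phi>]
            linear_on_diff[OF \<phi> complex_vector.subspace_UNIV])
      \<comment> \<open>The roles are exchanged: \<open>\<phi>\<close> of the action of
        \<open>?z\<close> on u equals \<open>f\<close> of the element already shown to
        vanish.\<close>
      also have "\<dots> = f (\<Sum>k\<in>?K. ?c k *\<^sub>C (\<phi> (act (fst k) u) *\<^sub>C snd k - \<phi> (act (snd k) u) *\<^sub>C fst k))"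
        by (subst linear_on_sum[OF f subspace_carrier])
          (simp_all add: linear_on_scale[OF f] linear_on_diff[OF f subspace_carrier] A_scale A_diff pA mult.commute)
      also have "\<dots> = 0" using *[OF \<phi>] linear_on_zero[OF f subspace_carrier] by simp
      finally show "\<phi> (act ?z u) = 0" .
    qed
  qed
  then show ?thesis
    by (simp add: complex_vector.scale_right_diff_distrib sum_subtractf scaleC_scaleC)
qed

lemma cocommutative:
  assumes f: "linear_on A f" and g: "linear_on A g" and h: "h \<in> A"
  shows "f (hit g h) = g (hit f h)"
proof -
  obtain p where p: "Poly_Mapping.keys p \<subseteq> A \<times> A" "abs_tensor p = comult H h"
    by (rule tensor_space_rep[OF subspace_carrier subspace_carrier comult_closed[OF h]])
  let ?K = "Poly_Mapping.keys p" and ?c = "Poly_Mapping.lookup p"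
  have pA: "fst k \<in> A" "snd k \<in> A" if "k \<in> ?K" for k using p(1) that by (auto simp: mem_Times_iff)
  have hit_p: "hit f h = (\<Sum>k\<in>?K. (?c k * f (snd k)) *\<^sub>C fst k)" if "linear_on A f" for f
    using tensor_lift_abs[OF subspace_carrier subspace_carrier bilinear_right_slice[OF that] p(1)]
    by (simp add: hit_def right_slice_def p(2) case_prod_unfold scaleC_scaleC)
  have "f (hit g h) = (\<Sum>k\<in>?K. ?c k * g (snd k) * f (fst k))"
    unfolding hit_p[OF g]
    by (subst linear_on_sum[OF f subspace_carrier]) (simp_all add: linear_on_scale[OF f] A_scale pA)
  also have "\<dots> = g (\<Sum>k\<in>?K. (?c k * f (fst k)) *\<^sub>C snd k)"
    by (subst linear_on_sum[OF g subspace_carrier]) (simp_all add: linear_on_scale[OF g] A_scale pA mult_ac)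
  also have "\<dots> = g (hit f h)"
    by (simp add: right_slice_flip[OF h p f] hit_p[OF f])
  finally show ?thesis .
qed

end

theorem theorem5p2:
  fixes H :: "'h::complex_vector hopf"
    and V :: "'v::complex_vector vertex_data"
    and act :: "'h \<Rightarrow> 'v \<Rightarrow> 'v"
  assumes "hopf_algebra H" and "finite_dim (carrier H)"
    and "vertex_operator_algebra V" and "voa_simple V"
    and "hopf_module_voa H V act" and "faithful_action H act"
  shows "\<exists>(G :: 'h monoid) \<phi>. group G \<and> finite (carrier G) \<and> hopf_iso H (group_algebra G) \<phi>"
proof -
  interpret faithful_hopf_voa_action H V act
    using assms by (simp add: faithful_hopf_voa_action_def faithful_hopf_voa_action_axioms_def
        findim_hopf_algebra_def findim_hopf_algebra_axioms_def simple_voa_def simple_voa_axioms_def)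
  interpret cocommutative_hopf_algebra H
    by unfold_locales (rule cocommutative)
  have "finite (carrier grouplike_group)"
    by (simp add: grouplike_group_def finite_grouplikes)
  with group_grouplike hopf_iso_group_algebra show ?thesis by blast
qed

end
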